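(* Let $\mathbf w=\{w_j\}_{j=2}^\infty$ be a sequence of positive real numbers with $\sigma_{\mathbf w}<+\infty$ and $\delta_{\mathbf w}\in\mathbb R$. Suppose that $$\sum_{\substack{j\geq 2\\ j\mid n}} j^{-\delta_{\mathbf w}}\, w_j\, \mu\Big(\frac nj\Big)\geq 0\quad\text{for every integer } n\geq 2,$$ where $\mu$ is the Möbius function. Then the multiplier algebra $\mathcal M(\mathscr H_{\mathbf w})$ is isometrically isomorphic to $H^\infty(\mathbb H_{\delta_{\mathbf w}/2})\cap\mathcal D$.
   Context: For $\rho\in\mathbb R$, $\mathbb H_\rho=\{s\in\mathbb C:\Re(s)>\rho\}$ (and $\mathbb H_{-\infty}=\mathbb C$). For an integer $n\geq 2$, $\mathrm{gpf}(n)$ is the greatest prime factor of $n$; $\{p_j\}_{j\geq1}$ is the increasing enumeration of the primes. For a sequence $\mathbf x=\{x_j\}_{j\geq2}$ of non-negative reals, $$\sigma_{\mathbf x}=\inf\Big\{\Re(s):\sum_{j=2}^\infty x_jj^{-s}<\infty\Big\},\qquad \delta_{\mathbf x}=\inf\Big\{\Re(s):\sum_{j\geq2,\ \mathrm{gpf}(j)\leq p_n}x_jj^{-s}<\infty\ \text{for all integers } n\geq1\Big\},$$ so that $\delta_{\mathbf x}\leq\sigma_{\mathbf x}$. For a sequence $\mathbf w=\{w_j\}_{j\geq 2}$ of positive reals, $\mathscr H_{\mathbf w}$ is the Hilbert space of Dirichlet series $f(s)=\sum_{j=2}^\infty\hat f(j)j^{-s}$ with $\|f\|_{\mathbf w}^2=\sum_{j=2}^\infty|\hat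 f(j)|^2/w_j<\infty$. If $\sigma_{\mathbf w}<+\infty$, it is a reproducing kernel Hilbert space of holomorphic functions on $\mathbb H_{\sigma_{\mathbf w}/2}$ with kernel $\kappa_{\mathbf w}(s,u)=\sum_{j=2}^\infty w_jj^{-s-\overline u}$. A multiplier of $\mathscr H_{\mathbf w}$ is a function $\varphi:\mathbb H_{\sigma_{\mathbf w}/2}\to\mathbb C$ with $\varphi f\in\mathscr H_{\mathbf w}$ for every $f\in\mathscr H_{\mathbf w}$. $\mathcal M(\mathscr H_{\mathbf w})$ is the algebra of all multipliers, normed by the operator norm of the multiplication operator $M_{\varphi,\mathbf w}:f\mapsto\varphi f$ on $\mathscr H_{\mathbf w}$. $H^\infty(X)$ is the Banach space of bounded holomorphic functions on the open set $X\subseteq\mathbb C$ with the supremum norm, and $\mathcal D$ is the set of all functions representable by a convergent Dirichlet series $\sum_{j\geq1}a_jj^{-s}$ in some right half-plane; $H^\infty(X)\cap\mathcal D$ carries the supremum norm over $X$. *)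

theory Defs
  imports
    "HOL-Analysis.Analysis"
    "HOL-Computational_Algebra.Computational_Algebra"
    "HOL-Library.FuncSet"
    "HOL-Library.Infinite_Set"
begin

definition moebius_mu :: "nat \<Rightarrow> int" where
  "moebius_mu n = (if squarefree n then (-1) ^ card (prime_factors n) else 0)"

definition gpf :: "nat \<Rightarrow> nat" where
  "gpf n = Max (prime_factors n)"

(* The primes are numbered from 1, so nth_prime 1 = 2; enumerate counts from 0. *)
definition nth_prime :: "nat \<Rightarrow> nat" where
  "nth_prime j = enumerate {p. prime p} (j - 1)"

definition half_plane :: "ereal \<Rightarrow> complex set" where
  "half_plane \<rho> = {s. \<rho> < ereal (Re s)}"

(* Sequences indexed by j >= 2 are functions on nat whose values at 0 and 1 are ignored.
   For non-negative x, finiteness of the sum of x j * j powr (-s) is read as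
   unconditional summability of the complex series. *)
definition sigma_abs :: "(nat \<Rightarrow> real) \<Rightarrow> ereal" where
  "sigma_abs x = Inf {ereal (Re s) | s.
     (\<lambda>j. complex_of_real (x j) * of_nat j powr (- s)) summable_on {2..}}"

definition delta_abs :: "(nat \<Rightarrow> real) \<Rightarrow> ereal" where
  "delta_abs x = Inf {ereal (Re s) | s. \<forall>n\<ge>1.
     (\<lambda>j. complex_of_real (x j) * of_nat j powr (- s))
       summable_on {j. 2 \<le> j \<and> gpf j \<le> nth_prime n}}"

(* Functions on a set X of complex numbers are total functions that are extensional on X,
   so that equality of functions on X is equality in HOL. *)

definition Hw_dom :: "(nat \<Rightarrow> real) \<Rightarrow> complex set" where
  "Hw_dom w = half_plane (sigma_abs w / 2)"

definition Hw_repr :: "(nat \<Rightarrow> real) \<Rightarrow> (nat \<Rightarrow> complex) \<Rightarrow> (complex \<Rightarrow> complex) \<Rightarrow> bool" where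
  "Hw_repr w a f \<longleftrightarrow>
     (\<forall>j<2. a j = 0) \<and>
     (\<lambda>j. (cmod (a j))\<^sup>2 / w j) summable_on {2..} \<and>
     (\<forall>s\<in>Hw_dom w. ((\<lambda>j. a j * of_nat j powr (- s)) has_sum f s) {2..})"

definition Hw :: "(nat \<Rightarrow> real) \<Rightarrow> (complex \<Rightarrow> complex) set" where
  "Hw w = {f \<in> extensional (Hw_dom w). \<exists>a. Hw_repr w a f}"

(* The coefficients are unique when sigma_abs w < \<infinity>, by the uniqueness theorem
   for Dirichlet series. *)
definition Hw_coeff :: "(nat \<Rightarrow> real) \<Rightarrow> (complex \<Rightarrow> complex) \<Rightarrow> nat \<Rightarrow> complex" where
  "Hw_coeff w f = (THE a. Hw_repr w a f)"

definition Hw_norm :: "(nat \<Rightarrow> real) \<Rightarrow> (complex \<Rightarrow> complex) \<Rightarrow> real" where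
  "Hw_norm w f = sqrt (\<Sum>\<^sub>\<infinity>j\<in>{2..}. (cmod (Hw_coeff w f j))\<^sup>2 / w j)"

definition pointwise_mult ::
  "complex set \<Rightarrow> (complex \<Rightarrow> complex) \<Rightarrow> (complex \<Rightarrow> complex) \<Rightarrow> complex \<Rightarrow> complex" where
  "pointwise_mult X f g = (\<lambda>s\<in>X. f s * g s)"

definition pointwise_add ::
  "complex set \<Rightarrow> (complex \<Rightarrow> complex) \<Rightarrow> (complex \<Rightarrow> complex) \<Rightarrow> complex \<Rightarrow> complex" where
  "pointwise_add X f g = (\<lambda>s\<in>X. f s + g s)"

definition pointwise_scale ::
  "complex set \<Rightarrow> complex \<Rightarrow> (complex \<Rightarrow> complex) \<Rightarrow> complex \<Rightarrow> complex" where
  "pointwise_scale X c f = (\<lambda>s\<in>X. c * f s)"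

definition multipliers :: "(nat \<Rightarrow> real) \<Rightarrow> (complex \<Rightarrow> complex) set" where
  "multipliers w = {\<phi> \<in> extensional (Hw_dom w).
     \<forall>f\<in>Hw w. pointwise_mult (Hw_dom w) \<phi> f \<in> Hw w}"

(* Both norms take values in ereal, so that no convention for suprema of unbounded
   sets of reals enters. *)
definition multiplier_norm :: "(nat \<Rightarrow> real) \<Rightarrow> (complex \<Rightarrow> complex) \<Rightarrow> ereal" where
  "multiplier_norm w \<phi> =
     (SUP f\<in>{f \<in> Hw w. Hw_norm w f \<le> 1}. ereal (Hw_norm w (pointwise_mult (Hw_dom w) \<phi> f)))"

definition sup_norm :: "complex set \<Rightarrow> (complex \<Rightarrow> complex) \<Rightarrow> ereal" where
  "sup_norm X f = (SUP s\<in>X. ereal (cmod (f s)))"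

definition H_infty :: "complex set \<Rightarrow> (complex \<Rightarrow> complex) set" where
  "H_infty X = {f \<in> extensional X. f holomorphic_on X \<and> bounded (f ` X)}"

definition dirichlet_functions :: "(complex \<Rightarrow> complex) set" where
  "dirichlet_functions = {f. \<exists>(a :: nat \<Rightarrow> complex) (\<rho> :: real).
     \<forall>s\<in>half_plane (ereal \<rho>). (\<lambda>j. a (Suc j) * of_nat (Suc j) powr (- s)) sums f s}"

(* A, with pointwise operations on X and norm N, and B, with pointwise operations on Y
   and norm N', are isometrically isomorphic as complex normed algebras. *)
definition isometrically_isomorphic ::
  "complex set \<Rightarrow> (complex \<Rightarrow> complex) set \<Rightarrow> ((complex \<Rightarrow> complex) \<Rightarrow> ereal) \<Rightarrow>
   complex set \<Rightarrow> (complex \<Rightarrow> complex) set \<Rightarrow> ((complex \<Rightarrow> complex) \<Rightarrow> ereal) \<Rightarrow> bool" where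
  "isometrically_isomorphic X A N Y B N' \<longleftrightarrow>
     (\<exists>\<Phi>. bij_betw \<Phi> A B \<and>
       (\<forall>f\<in>A. \<forall>g\<in>A. \<Phi> (pointwise_add X f g) = pointwise_add Y (\<Phi> f) (\<Phi> g)) \<and>
       (\<forall>c. \<forall>f\<in>A. \<Phi> (pointwise_scale X c f) = pointwise_scale Y c (\<Phi> f)) \<and>
       (\<forall>f\<in>A. \<forall>g\<in>A. \<Phi> (pointwise_mult X f g) = pointwise_mult Y (\<Phi> f) (\<Phi> g)) \<and>
       (\<forall>f\<in>A. N' (\<Phi> f) = N f))"

end

theory Submission
  imports Defs "HOL-Complex_Analysis.Complex_Analysis"
begin

text \<open>
  Everything is read off coefficients. A multiplier \<open>\<phi>\<close> turns out to be a Dirichlet series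
  \<open>\<Sum> a\<^sub>k k\<^sup>-\<^sup>s\<close>, and multiplication by it is the Dirichlet convolution \<open>f \<mapsto> dconv a f\<close> on the
  weighted \<open>\<ell>\<^sup>2\<close> space with weight \<open>1 / w\<close>. The predicate \<open>dconv_bounded w a C\<close> says that this
  operator has norm at most \<open>C\<close>. The theorem follows once the multipliers, the operators bounded
  in this sense, and the functions in \<open>H\<^sup>\<infinity> \<inter> \<D>\<close> of the larger half-plane \<open>Re s > \<delta> / 2\<close> are seen to
  correspond, with the same constant \<open>C\<close> throughout. The isomorphism is the inverse of restriction
  to the smaller half-plane \<open>Re s > \<sigma> / 2\<close>; being inverse to restriction, it respects the pointwise
  operations by the identity theorem.

  A function bounded by \<open>C\<close> gives an operator of norm at most \<open>C\<close> (\<open>dconv_bounded_of_bounded\<close>).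
  Suppose first that the weight is constant. On a far right vertical line the coefficients of a
  Dirichlet series are means of it against \<open>n\<^sup>s\<close>, and for a bounded holomorphic function these
  means do not change when the line is moved, so they can be computed on every line inside the
  half-plane, even where the series does not converge. Bessel's inequality for these means gives
  the unweighted bound (\<open>bounded_dirichlet_convolution_l2\<close>). The Moebius condition carries it over
  to the weight \<open>w\<close>: it says that \<open>j\<^sup>-\<^sup>\<delta> w\<^sub>j = \<Sum>\<^bsub>n dvd j\<^esub> b\<^sub>n\<close> with \<open>b\<^sub>n \<ge> 0\<close>, that is, up to a
  translation of \<open>s\<close> the reproducing kernel is formally \<open>\<zeta>\<close> times a positive definite kernel.
  Accordingly, every element of the weighted space is a superposition of dilates of
  square-summable sequences. Convolution commutes with dilation, so the bound is inherited
  (\<open>dconv_bounded_divisor_sum_weight\<close>).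

  Conversely, let the operator have norm at most \<open>C\<close>. Keep only the coefficients \<open>a\<^sub>k\<close> whose index
  has no prime factor above a bound. The series then converges for \<open>Re s > \<delta> / 2\<close>, and evaluating
  the operator at the kernel of the corresponding subspace shows that its sum is at most \<open>C\<close> there
  (\<open>compressed_symbol_bound\<close>). Montel's theorem provides a limit as the bound on the primes grows;
  it is the extension sought (\<open>bounded_extension\<close>).

  Finally, a multiplier is a Dirichlet series because its products with \<open>2\<^sup>-\<^sup>s\<close> and \<open>3\<^sup>-\<^sup>s\<close> both lie in
  the space (\<open>multiplier_obtain_coefficients\<close>), and it acts as a bounded operator by a gliding
  hump argument (\<open>dconv_maps_imp_bounded\<close>).
\<close>

section \<open>Dirichlet series and Dirichlet convolution\<close>

text \<open>
  Since \<open>0 powr z = 0\<close>, the term with index 0 vanishes whatever \<open>a 0\<close> is, so Dirichlet series can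
  be summed over all of \<open>UNIV\<close>. Unconditional summability of complex terms is absolute summability.
\<close>

definition dirichlet_term :: "(nat \<Rightarrow> complex) \<Rightarrow> complex \<Rightarrow> nat \<Rightarrow> complex" where
  "dirichlet_term a s k = a k * of_nat k powr (- s)"

definition dirichlet_sum :: "(nat \<Rightarrow> complex) \<Rightarrow> complex \<Rightarrow> complex" where
  "dirichlet_sum a s = infsum (dirichlet_term a s) UNIV"

definition dconv :: "(nat \<Rightarrow> complex) \<Rightarrow> (nat \<Rightarrow> complex) \<Rightarrow> nat \<Rightarrow> complex" where
  "dconv a f m = (\<Sum>d | d dvd m. a (m div d) * f d)"

lemma powr_mult_nat: "of_nat (j * k) powr s = of_nat j powr s * (of_nat k powr s :: complex)"
proof (cases "j = 0 \<or> k = 0")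
  case False
  then show ?thesis
    using powr_times_real[of "of_nat j" "of_nat k" s] by simp
qed auto

lemma norm_dirichlet_term:
  "norm (dirichlet_term a s k) = norm (a k) * real k powr (- Re s)"
proof (cases "k = 0")
  case False
  then have "norm (of_nat k powr (- s) :: complex) = real k powr (- Re s)"
    by (subst norm_powr_real_powr) auto
  then show ?thesis by (simp add: dirichlet_term_def norm_mult)
qed (simp add: dirichlet_term_def)

lemma dirichlet_term_0 [simp]: "dirichlet_term a s 0 = 0"
  by (simp add: dirichlet_term_def)

lemma dirichlet_term_nonzero_imp: "dirichlet_term a s k \<noteq> 0 \<Longrightarrow> Suc 0 \<le> k"
  by (cases k) auto

lemma norm_dirichlet_term_mono:
  assumes "Re s \<le> Re t"
  shows "norm (dirichlet_term a t k) \<le> norm (dirichlet_term a s k)"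
proof (cases "k = 0")
  case False
  then have "real k powr (- Re t) \<le> real k powr (- Re s)"
    using assms by (intro powr_mono) auto
  then show ?thesis unfolding norm_dirichlet_term by (intro mult_left_mono) auto
qed simp

lemma dirichlet_summable_mono:
  assumes "dirichlet_term a s summable_on A" "Re s \<le> Re t"
  shows "dirichlet_term a t summable_on A"
proof -
  have "(\<lambda>k. norm (dirichlet_term a s k)) summable_on A"
    using assms(1) summable_on_iff_abs_summable_on_complex by blast
  then have "(\<lambda>k. norm (dirichlet_term a t k)) summable_on A"
    by (rule Infinite_Sum.abs_summable_on_comparison_test)
      (use assms(2) in \<open>auto intro: norm_dirichlet_term_mono\<close>)
  then show ?thesis using summable_on_iff_abs_summable_on_complex by blast
qed

lemma has_sum_dirichlet_sum:
  "dirichlet_term a s summable_on UNIV \<Longrightarrow> (dirichlet_term a s has_sum dirichlet_sum a s) UNIV"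
  unfolding dirichlet_sum_def by (rule has_sum_infsum)

lemma dconv_cong:
  assumes "\<And>d. d dvd m \<Longrightarrow> f d = g d"
  shows "dconv a f m = dconv a g m"
  unfolding dconv_def by (rule sum.cong) (use assms in auto)

lemma dconv_dirichlet_term:
  "dirichlet_term (dconv a f) s m = (\<Sum>d | d dvd m. dirichlet_term a s (m div d) * dirichlet_term f s d)"
proof (cases "m = 0")
  case False
  show ?thesis
    unfolding dirichlet_term_def dconv_def sum_distrib_right
  proof (rule sum.cong)
    fix d assume d: "d \<in> {d. d dvd m}"
    then have "of_nat m powr (- s) = of_nat (m div d) powr (- s) * (of_nat d powr (- s) :: complex)"
      by (metis dvd_div_mult_self mem_Collect_eq powr_mult_nat)
    then show "a (m div d) * f d * of_nat m powr - s =
         a (m div d) * of_nat (m div d) powr - s * (f d * of_nat d powr - s)" by simp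
  qed simp
qed (simp add: dirichlet_term_def)

text \<open>
  The family \<open>a\<^sub>k f\<^sub>d (k d)\<^sup>-\<^sup>s\<close> is absolutely summable over pairs; grouping the pairs by the product
  \<open>m = k d\<close> gives the convolution. Index 0 has to be dropped first, because the regrouping is a
  bijection only on positive integers.
\<close>

lemma has_sum_dirichlet_product:
  assumes a: "(dirichlet_term a s has_sum A) UNIV" and f: "(dirichlet_term f s has_sum B) UNIV"
  shows "(dirichlet_term (dconv a f) s has_sum A * B) UNIV"
proof -
  let ?a = "dirichlet_term a s" and ?f = "dirichlet_term f s"
  define I where "I = (SIGMA m:{1::nat..}. {d. d dvd m})"
  have na: "(\<lambda>k. norm (?a k)) summable_on UNIV" and nf: "(\<lambda>k. norm (?f k)) summable_on UNIV"
    using a f summable_on_iff_abs_summable_on_complex has_sum_imp_summable by blast+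
  have "(\<lambda>x. norm (case x of (k, d) \<Rightarrow> ?a k * ?f d)) summable_on (UNIV \<times> UNIV)"
    unfolding Infinite_Sum.abs_summable_on_Sigma_iff
    using na nf by (auto simp: norm_mult infsum_cmult_right' abs_mult infsum_nonneg intro!: summable_on_cmult_right summable_on_cmult_left)
  then have summ: "(\<lambda>(k, d). ?a k * ?f d) summable_on (UNIV \<times> UNIV)"
    by (rule abs_summable_summable)
  have "((\<lambda>(k, d). ?a k * ?f d) has_sum A * B) (UNIV \<times> UNIV)"
  proof -
    obtain S where S: "((\<lambda>(k, d). ?a k * ?f d) has_sum S) (UNIV \<times> UNIV)"
      using summ by (auto simp: summable_on_def)
    have "((\<lambda>k. ?a k * B) has_sum S) UNIV"
      using has_sum_Sigma[OF isUCont_plus S, of "\<lambda>k. ?a k * B"] has_sum_cmult_right[OF f] by simp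
    moreover have "((\<lambda>k. ?a k * B) has_sum A * B) UNIV"
      by (rule has_sum_cmult_left[OF a])
    ultimately have "S = A * B" by (rule has_sum_unique)
    with S show ?thesis by simp
  qed
  then have "((\<lambda>(k, d). ?a k * ?f d) has_sum A * B) ({1..} \<times> {1..})"
    by (rule has_sum_cong_neutral[THEN iffD1, rotated -1])
      (auto intro: dirichlet_term_nonzero_imp)
  moreover have bij: "bij_betw (\<lambda>(m, d). (m div d, d)) I ({1..} \<times> {1..})"
    by (rule bij_betwI[where g = "\<lambda>(k, d). (k * d, d)"])
      (auto simp: I_def Suc_le_eq dvd_div_eq_0_iff dvd_pos_nat)
  ultimately have "((\<lambda>(m, d). ?a (m div d) * ?f d) has_sum A * B) I"
    using has_sum_reindex_bij_betw[OF bij, of "\<lambda>(k, d). ?a k * ?f d"] by (simp add: case_prod_unfold)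
  then have "(dirichlet_term (dconv a f) s has_sum A * B) {1..}"
    unfolding I_def
    by (rule has_sum_Sigma[OF isUCont_plus])
      (auto simp: dconv_dirichlet_term intro!: has_sum_finite)
  then show ?thesis
    by (rule has_sum_cong_neutral[THEN iffD1, rotated -1]) (auto intro: dirichlet_term_nonzero_imp)
qed

section \<open>Mean values along vertical lines\<close>

definition line_mean :: "real \<Rightarrow> (real \<Rightarrow> complex) \<Rightarrow> complex" where
  "line_mean T h = integral {-T..T} h / of_real (2 * T)"

lemma line_mean_add:
  assumes "continuous_on UNIV f" "continuous_on UNIV g"
  shows "line_mean T (\<lambda>t. f t + g t) = line_mean T f + line_mean T g"
proof -
  have "f integrable_on {-T..T}" "g integrable_on {-T..T}"
    using assms continuous_on_subset by (blast intro: integrable_continuous_real)+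
  then show ?thesis
    by (simp add: line_mean_def Henstock_Kurzweil_Integration.integral_add add_divide_distrib)
qed

lemma line_mean_cmult: "line_mean T (\<lambda>t. c * f t) = c * line_mean T f"
  by (simp add: line_mean_def)

lemma line_mean_diff:
  assumes "continuous_on UNIV f" "continuous_on UNIV g"
  shows "line_mean T (\<lambda>t. f t - g t) = line_mean T f - line_mean T g"
  using line_mean_add[of f "\<lambda>t. -1 * g t" T] assms
  by (simp only: line_mean_cmult continuous_intros) simp

lemma line_mean_sum:
  assumes "\<And>i. i \<in> I \<Longrightarrow> continuous_on UNIV (f i)"
  shows "line_mean T (\<lambda>t. \<Sum>i\<in>I. f i t) = (\<Sum>i\<in>I. line_mean T (f i))"
  using assms
proof (induction I rule: infinite_finite_induct)
  case (insert i I)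
  then have "continuous_on UNIV (\<lambda>t. \<Sum>i\<in>I. f i t)" by (intro continuous_intros) auto
  with insert show ?case by (simp add: line_mean_add)
qed (auto simp: line_mean_def)

lemma norm_line_mean_le:
  assumes "continuous_on UNIV h" "T > 0" "\<And>t. norm (h t) \<le> B"
  shows "norm (line_mean T h) \<le> B"
proof -
  have "norm (integral {-T..T} h) \<le> B * (T - (- T))"
    by (rule integral_bound) (use assms continuous_on_subset[OF assms(1)] in auto)
  then show ?thesis using assms(2) by (simp add: line_mean_def norm_divide field_simps)
qed

lemma Re_line_mean_nonneg:
  assumes "continuous_on UNIV h" "T > 0" "\<And>t. Re (h t) \<ge> 0"
  shows "Re (line_mean T h) \<ge> 0"
proof -
  have "h integrable_on {-T..T}"
    using assms(1) continuous_on_subset by (blast intro: integrable_continuous_real)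
  then have "(h has_integral integral {-T..T} h) {-T..T}" by (rule integrable_integral)
  then have "((\<lambda>t. Re (h t)) has_integral Re (integral {-T..T} h)) {-T..T}"
    by (rule has_integral_Re)
  then have "Re (integral {-T..T} h) \<ge> 0"
    by (rule has_integral_nonneg) (use assms in auto)
  then show ?thesis
    using assms(2) unfolding line_mean_def by (simp add: Re_divide_of_real del: of_real_mult)
qed

lemma line_mean_const: "T > 0 \<Longrightarrow> line_mean T (\<lambda>t. c) = c"
  by (simp add: line_mean_def field_simps scaleR_conv_of_real)

lemma tendsto_zero_divide_at_top:
  assumes "\<And>T. T > 0 \<Longrightarrow> norm (f T) \<le> B / T"
  shows "((f :: real \<Rightarrow> complex) \<longlongrightarrow> 0) at_top"
proof (rule Lim_null_comparison)
  show "\<forall>\<^sub>F T in at_top. norm (f T) \<le> B / T"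
    using eventually_gt_at_top[of 0] by eventually_elim (rule assms)
  show "((\<lambda>T. B / T) \<longlongrightarrow> 0) at_top"
    by (rule real_tendsto_divide_at_top[OF tendsto_const filterlim_ident])
qed

lemma line_mean_oscillation:
  assumes "\<theta> \<noteq> 0"
  shows "((\<lambda>T. line_mean T (\<lambda>t. exp (\<i> * of_real (\<theta> * t)))) \<longlongrightarrow> 0) at_top"
proof (rule tendsto_zero_divide_at_top)
  fix T :: real assume T: "T > 0"
  define G where "G = (\<lambda>t. exp (\<i> * of_real (\<theta> * t)) / (\<i> * of_real \<theta>))"
  have "((\<lambda>t. exp (\<i> * of_real (\<theta> * t))) has_integral G T - G (-T)) {-T..T}"
  proof (rule fundamental_theorem_of_calculus)
    fix t
    show "(G has_vector_derivative exp (\<i> * of_real (\<theta> * t))) (at t within {-T..T})"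
      unfolding G_def using assms
      by (auto intro!: derivative_eq_intros has_vector_derivative_real_field simp: field_simps)
  qed (use T in auto)
  then have "integral {-T..T} (\<lambda>t. exp (\<i> * of_real (\<theta> * t))) = G T - G (-T)"
    by (rule integral_unique)
  moreover have "norm (G t) = 1 / \<bar>\<theta>\<bar>" for t
    unfolding G_def norm_divide norm_mult norm_exp_i_times by simp
  then have "norm (G T - G (-T)) \<le> 1 / \<bar>\<theta>\<bar> + 1 / \<bar>\<theta>\<bar>"
    by (metis norm_triangle_ineq4)
  ultimately show "norm (line_mean T (\<lambda>t. exp (\<i> * of_real (\<theta> * t)))) \<le> (1 / \<bar>\<theta>\<bar>) / T"
    using T by (simp only: line_mean_def norm_divide) (simp add: field_simps)
qed

lemma continuous_on_Complex_line [continuous_intros]: "continuous_on A (\<lambda>t. Complex x t)"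
  by (simp add: Complex_eq continuous_intros)

lemma continuous_on_dirichlet_term: "continuous_on UNIV (\<lambda>t. dirichlet_term a (Complex x t) k)"
proof (cases "k = 0")
  case False
  then show ?thesis unfolding dirichlet_term_def by (auto intro!: continuous_intros simp: powr_def)
qed simp

lemma continuous_on_nat_powr_line:
  "n \<ge> 1 \<Longrightarrow> continuous_on UNIV (\<lambda>t. of_nat n powr Complex x t :: complex)"
  by (auto intro!: continuous_intros simp: powr_def)

lemma line_mean_dirichlet_term:
  assumes n: "n \<ge> (1::nat)"
  shows "((\<lambda>T. line_mean T (\<lambda>t. dirichlet_term a (Complex x t) k * of_nat n powr Complex x t))
           \<longlongrightarrow> (if k = n then a n else 0)) at_top"
proof (cases "k = 0")
  case True
  then show ?thesis using n by (simp add: line_mean_def)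
next
  case False
  define c :: complex where "c = a k * of_real (exp (x * (ln n - ln k)))"
  define \<theta> where "\<theta> = ln (real n) - ln (real k)"
  have eq: "dirichlet_term a (Complex x t) k * of_nat n powr Complex x t = c * exp (\<i> * of_real (\<theta> * t))" for t
  proof -
    have "of_nat k powr (- Complex x t) * of_nat n powr Complex x t
         = exp (Complex x t * of_real \<theta>)"
      using n False by (simp add: powr_def \<theta>_def algebra_simps flip: exp_add)
    also have "\<dots> = exp (of_real (x * \<theta>) + \<i> * of_real (\<theta> * t))"
      by (simp add: Complex_eq algebra_simps)
    also have "\<dots> = of_real (exp (x * \<theta>)) * exp (\<i> * of_real (\<theta> * t))"
      by (simp only: exp_add exp_of_real)
    finally show ?thesis by (simp add: dirichlet_term_def c_def \<theta>_def)
  qed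
  show ?thesis
  proof (cases "k = n")
    case True
    have "\<forall>\<^sub>F T in at_top. a n = line_mean T (\<lambda>t. c * exp (\<i> * of_real (\<theta> * t)))"
      using eventually_gt_at_top[of 0]
      by eventually_elim (use True in \<open>simp add: c_def \<theta>_def line_mean_const\<close>)
    then show ?thesis unfolding eq using True by (simp add: tendsto_eventually eventually_mono)
  next
    case nk: False
    then have "\<theta> \<noteq> 0" using n False by (auto simp: \<theta>_def)
    from tendsto_mult[OF tendsto_const line_mean_oscillation[OF this], of c] show ?thesis
      unfolding eq line_mean_cmult using nk by simp
  qed
qed

lemma dirichlet_uniform_limit_line:
  assumes "dirichlet_term a (of_real x) summable_on UNIV" "n \<ge> 1"
  shows "uniform_limit UNIV
     (\<lambda>K t. \<Sum>k\<in>K. dirichlet_term a (Complex x t) k * of_nat n powr Complex x t)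
     (\<lambda>t. dirichlet_sum a (Complex x t) * of_nat n powr Complex x t) (finite_subsets_at_top UNIV)"
proof (rule Weierstrass_m_test_general')
  fix k :: nat and t :: real
  have "norm (of_nat n powr Complex x t) = real n powr x"
    using norm_powr_real_powr[of "of_nat n" "Complex x t"] assms(2) by simp
  then show "norm (dirichlet_term a (Complex x t) k * of_nat n powr Complex x t)
       \<le> norm (dirichlet_term a (of_real x) k) * real n powr x"
    by (simp add: norm_mult norm_dirichlet_term)
  have "dirichlet_term a (Complex x t) summable_on UNIV"
    using assms(1) by (rule dirichlet_summable_mono) simp
  then show "((\<lambda>k. dirichlet_term a (Complex x t) k * of_nat n powr Complex x t) has_sum
      dirichlet_sum a (Complex x t) * of_nat n powr Complex x t) UNIV"
    by (intro has_sum_cmult_left has_sum_dirichlet_sum)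
next
  have "(\<lambda>k. norm (dirichlet_term a (of_real x) k)) summable_on UNIV"
    using assms(1) summable_on_iff_abs_summable_on_complex by blast
  then show "(\<lambda>k. norm (dirichlet_term a (of_real x) k) * real n powr x) summable_on UNIV"
    by (rule summable_on_cmult_left)
qed

lemma continuous_on_dirichlet_sum_line:
  assumes "dirichlet_term a (of_real x) summable_on UNIV"
  shows "continuous_on UNIV (\<lambda>t. dirichlet_sum a (Complex x t))"
proof -
  have "continuous_on UNIV (\<lambda>t. dirichlet_sum a (Complex x t) * of_nat 1 powr Complex x t)"
    by (rule uniform_limit_theorem[OF _ dirichlet_uniform_limit_line[OF assms]])
      (auto intro!: continuous_intros always_eventually continuous_on_dirichlet_term continuous_on_nat_powr_line)
  then show ?thesis by simp
qed

text \<open>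
  For a finite sum this is orthogonality of the functions \<open>k\<^sup>-\<^sup>i\<^sup>t\<close>. The partial sums converge
  uniformly on the line, so their means converge uniformly in \<open>T\<close>, and the two limits may be
  interchanged.
\<close>

lemma line_mean_dirichlet_coefficient:
  assumes sum: "dirichlet_term a (of_real x) summable_on UNIV" and n: "n \<ge> 1"
  shows "((\<lambda>T. line_mean T (\<lambda>t. dirichlet_sum a (Complex x t) * of_nat n powr Complex x t))
           \<longlongrightarrow> a n) at_top"
proof (rule swap_uniform_limit')
  let ?F = "\<lambda>K t. \<Sum>k\<in>K. dirichlet_term a (Complex x t) k * of_nat n powr Complex x t"
  let ?G = "\<lambda>t. dirichlet_sum a (Complex x t) * of_nat n powr Complex x t"
  have cterm: "continuous_on UNIV (\<lambda>t. dirichlet_term a (Complex x t) k * of_nat n powr Complex x t)" for k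
    using n by (intro continuous_on_mult continuous_on_dirichlet_term continuous_on_nat_powr_line) auto
  then have cF: "continuous_on UNIV (?F K)" for K
    by (intro continuous_on_sum) auto
  have cG: "continuous_on UNIV ?G"
    using n sum by (intro continuous_on_mult continuous_on_dirichlet_sum_line continuous_on_nat_powr_line) auto
  show "\<forall>\<^sub>F K in finite_subsets_at_top UNIV.
      ((\<lambda>T. line_mean T (?F K)) \<longlongrightarrow> (\<Sum>k\<in>K. if k = n then a n else 0)) at_top"
    using cterm by (intro always_eventually allI)
      (simp add: line_mean_sum, intro tendsto_sum line_mean_dirichlet_term n)
  show "((\<lambda>K. \<Sum>k\<in>K. if k = n then a n else 0) \<longlongrightarrow> a n) (finite_subsets_at_top UNIV)"
  proof (rule tendsto_eventually)
    have "\<forall>\<^sub>F K in finite_subsets_at_top UNIV. finite K \<and> {n} \<subseteq> K \<and> K \<subseteq> UNIV"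
      by (auto simp: eventually_finite_subsets_at_top intro!: exI[of _ "{n}"])
    then show "\<forall>\<^sub>F K in finite_subsets_at_top UNIV. (\<Sum>k\<in>K. if k = n then a n else 0) = a n"
      by eventually_elim auto
  qed
  show "uniform_limit {0<..} (\<lambda>K T. line_mean T (?F K)) (\<lambda>T. line_mean T ?G) (finite_subsets_at_top UNIV)"
  proof (rule uniform_limitI)
    fix e :: real assume e: "e > 0"
    then have "\<forall>\<^sub>F K in finite_subsets_at_top UNIV. \<forall>t\<in>UNIV. dist (?F K t) (?G t) < e / 2"
      by (intro uniform_limitD[OF dirichlet_uniform_limit_line[OF sum n]]) auto
    then show "\<forall>\<^sub>F K in finite_subsets_at_top UNIV. \<forall>T\<in>{0<..}. dist (line_mean T (?F K)) (line_mean T ?G) < e"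
    proof eventually_elim
      case (elim K)
      show ?case
      proof
        fix T :: real assume T: "T \<in> {0<..}"
        have "norm (line_mean T (\<lambda>t. ?F K t - ?G t)) \<le> e / 2"
          using elim T cF cG
          by (intro norm_line_mean_le continuous_on_diff) (auto simp: dist_norm less_imp_le)
        then show "dist (line_mean T (?F K)) (line_mean T ?G) < e"
          using e by (simp add: dist_norm line_mean_diff[OF cF cG])
      qed
    qed
  qed
qed (auto intro: eventually_gt_at_top)

text \<open>
  The mean value formula recovers the coefficients from the values on one vertical line.
\<close>

lemma dirichlet_coefficients_unique:
  assumes "dirichlet_term a (of_real x) summable_on UNIV" "dirichlet_term b (of_real x) summable_on UNIV"
    and "\<And>t. dirichlet_sum a (Complex x t) = dirichlet_sum b (Complex x t)" and n: "n \<ge> 1"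
  shows "a n = b n"
  using line_mean_dirichlet_coefficient[OF assms(1) n] line_mean_dirichlet_coefficient[OF assms(2) n]
  unfolding assms(3) by (rule tendsto_unique[rotated]) simp

text \<open>
  Let \<open>H\<close> be a primitive of \<open>h\<close>. The integral over a vertical segment is a difference of values of
  \<open>H\<close> at its end points, and moving an end point horizontally from \<open>x\<close> to \<open>y\<close> changes \<open>H\<close> by at most
  \<open>B (y - x)\<close>. This error is independent of \<open>T\<close> and disappears after division by \<open>2 T\<close>.
\<close>

lemma line_mean_shift:
  assumes hol: "h holomorphic_on {s. Re s > \<alpha>}" and x: "\<alpha> < x" "x \<le> y"
    and bd: "\<And>s. x \<le> Re s \<Longrightarrow> Re s \<le> y \<Longrightarrow> norm (h s) \<le> B"
  shows "((\<lambda>T. line_mean T (\<lambda>t. h (Complex x t)) - line_mean T (\<lambda>t. h (Complex y t))) \<longlongrightarrow> 0) at_top"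
proof -
  have "convex {s. Re s > \<alpha>}" "open {s. Re s > \<alpha>}"
    by (simp_all add: convex_halfspace_Re_gt open_halfspace_Re_gt)
  from holomorphic_convex_primitive'[OF this(1) this(2) hol] obtain H
    where H0: "\<And>s. Re s > \<alpha> \<Longrightarrow> (H has_field_derivative h s) (at s within {s. Re s > \<alpha>})"
    by auto
  have H: "(H has_field_derivative h s) (at s)" if "Re s > \<alpha>" for s
    using H0[OF that] at_within_open[of s "{s. Re s > \<alpha>}"] that
    by (metis mem_Collect_eq open_halfspace_Re_gt)
  have int: "integral {-T..T} (\<lambda>t. h (Complex z t)) = - \<i> * (H (Complex z T) - H (Complex z (-T)))"
    if "z > \<alpha>" "T > 0" for z T
  proof -
    have "((\<lambda>t. h (Complex z t)) has_integral - \<i> * H (Complex z T) - - \<i> * H (Complex z (-T))) {-T..T}"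
    proof (rule fundamental_theorem_of_calculus)
      fix t
      have "((\<lambda>u. Complex z u) has_vector_derivative \<i>) (at t within {-T..T})"
        unfolding Complex_eq by (auto intro!: derivative_eq_intros)
      moreover have "((\<lambda>s. - \<i> * H s) has_field_derivative - \<i> * h (Complex z t)) (at (Complex z t) within A)" for A
        by (rule DERIV_cmult[OF has_field_derivative_at_within[OF H]]) (use that in simp)
      ultimately have "((\<lambda>s. - \<i> * H s) \<circ> (\<lambda>u. Complex z u) has_vector_derivative \<i> * (- \<i> * h (Complex z t)))
          (at t within {-T..T})"
        by (intro field_vector_diff_chain_within)
      then show "((\<lambda>u. - \<i> * H (Complex z u)) has_vector_derivative h (Complex z t)) (at t within {-T..T})"
        by (simp add: o_def)
    qed (use that in auto)
    then show ?thesis by (simp add: integral_unique algebra_simps)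
  qed
  have near: "norm (H (Complex x t) - H (Complex y t)) \<le> B * (y - x)" for t
  proof -
    have "norm (H (Complex x t) - H (Complex y t)) \<le> B * norm (Complex x t - Complex y t)"
    proof (rule field_differentiable_bound)
      show "convex ({s. x \<le> Re s} \<inter> {s. Re s \<le> y})"
        by (intro convex_Int convex_halfspace_Re_ge convex_halfspace_Re_le)
      show "(H has_field_derivative h s) (at s within {s. x \<le> Re s} \<inter> {s. Re s \<le> y})"
        if "s \<in> {s. x \<le> Re s} \<inter> {s. Re s \<le> y}" for s
        by (rule has_field_derivative_at_within[OF H]) (use that x in auto)
    qed (use x bd in auto)
    moreover have "Complex x t - Complex y t = of_real (x - y)" by (simp add: complex_eq_iff)
    ultimately show ?thesis using x by (simp add: norm_of_real del: of_real_diff)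
  qed
  show ?thesis
  proof (rule tendsto_zero_divide_at_top)
    fix T :: real assume T: "T > 0"
    have eq: "line_mean T (\<lambda>t. h (Complex x t)) - line_mean T (\<lambda>t. h (Complex y t)) =
       - \<i> * ((H (Complex x T) - H (Complex y T)) - (H (Complex x (-T)) - H (Complex y (-T)))) / of_real (2 * T)"
    proof -
      have y: "y > \<alpha>" using x by simp
      show ?thesis
        unfolding line_mean_def int[OF x(1) T] int[OF y T] diff_divide_distrib[symmetric]
        by (intro arg_cong2[where f = "(/)"]) (simp_all add: algebra_simps)
    qed
    have le: "norm ((H (Complex x T) - H (Complex y T)) - (H (Complex x (-T)) - H (Complex y (-T))))
        \<le> B * (y - x) + B * (y - x)"
      using near by (meson add_mono norm_triangle_ineq4 order_trans)
    have "norm (line_mean T (\<lambda>t. h (Complex x t)) - line_mean T (\<lambda>t. h (Complex y t))) =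
        norm ((H (Complex x T) - H (Complex y T)) - (H (Complex x (-T)) - H (Complex y (-T)))) / (2 * T)"
      unfolding eq norm_divide norm_mult norm_of_real using T by simp
    also have "\<dots> \<le> (B * (y - x) + B * (y - x)) / (2 * T)"
      using le T by (intro divide_right_mono) auto
    finally show "norm (line_mean T (\<lambda>t. h (Complex x t)) - line_mean T (\<lambda>t. h (Complex y t)))
        \<le> B * (y - x) / T"
      by simp
  qed
qed

section \<open>Bounded Dirichlet series as contractions of square-summable coefficients\<close>

text \<open>
  On the line \<open>Re s = x\<close> the conjugate of \<open>m\<^sup>-\<^sup>s\<close> is \<open>m\<^sup>-\<^sup>2\<^sup>x m\<^sup>s\<close>, which turns inner products with
  Dirichlet polynomials into the means that compute coefficients.
\<close>

lemma cnj_dirichlet_term: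
  "cnj (dirichlet_term g (Complex x t) m) = cnj (g m) * of_real (real m powr (- 2 * x)) * of_nat m powr Complex x t"
proof (cases "m = 0")
  case False
  have "cnj (of_nat m powr (- Complex x t)) = exp (- cnj (Complex x t) * of_real (ln (real m)))"
    using False by (simp add: powr_def exp_cnj)
  also have "- cnj (Complex x t) * of_real (ln (real m)) =
      of_real (- 2 * x * ln (real m)) + Complex x t * of_real (ln (real m))"
    by (simp add: complex_eq_iff algebra_simps)
  also have "exp \<dots> = of_real (real m powr (- 2 * x)) * of_nat m powr Complex x t"
    using False by (simp only: exp_add exp_of_real) (simp add: powr_def)
  finally show ?thesis by (simp add: dirichlet_term_def)
qed simp

lemma line_mean_mult_cnj_polynomial:
  assumes contF: "continuous_on UNIV F" and "finite S" "0 \<notin> S"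
    and coef: "\<And>m. m \<ge> 1 \<Longrightarrow> ((\<lambda>T. line_mean T (\<lambda>t. F t * of_nat m powr Complex x t)) \<longlongrightarrow> c m) at_top"
  shows "((\<lambda>T. line_mean T (\<lambda>t. F t * cnj (\<Sum>m\<in>S. dirichlet_term g (Complex x t) m)))
     \<longlongrightarrow> (\<Sum>m\<in>S. c m * cnj (g m) * of_real (real m powr (- 2 * x)))) at_top"
proof -
  define b where "b m = cnj (g m) * of_real (real m powr (- 2 * x))" for m
  have cont: "continuous_on UNIV (\<lambda>t. b m * (F t * of_nat m powr Complex x t))" if "m \<in> S" for m
    using that \<open>0 \<notin> S\<close> contF
    by (intro continuous_intros continuous_on_nat_powr_line) (auto intro: Nat.gr0I simp: Suc_le_eq)
  have "F t * cnj (\<Sum>m\<in>S. dirichlet_term g (Complex x t) m)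
      = (\<Sum>m\<in>S. b m * (F t * of_nat m powr Complex x t))" for t
    by (simp add: cnj_dirichlet_term b_def sum_distrib_left mult_ac)
  then have "line_mean T (\<lambda>t. F t * cnj (\<Sum>m\<in>S. dirichlet_term g (Complex x t) m)) =
      (\<Sum>m\<in>S. b m * line_mean T (\<lambda>t. F t * of_nat m powr Complex x t))" for T
    by (simp only:) (subst line_mean_sum, use cont in \<open>auto simp: line_mean_cmult\<close>)
  moreover have "((\<lambda>T. \<Sum>m\<in>S. b m * line_mean T (\<lambda>t. F t * of_nat m powr Complex x t))
      \<longlongrightarrow> (\<Sum>m\<in>S. b m * c m)) at_top"
    using \<open>0 \<notin> S\<close> by (intro tendsto_sum tendsto_mult tendsto_const coef) (metis Suc_le_eq Nat.gr0I One_nat_def)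
  ultimately show ?thesis by (simp add: b_def mult_ac)
qed

lemma dirichlet_sum_finite_support:
  assumes "finite S" "\<And>j. j \<notin> S \<Longrightarrow> f j = 0"
  shows "(dirichlet_term f s has_sum (\<Sum>j\<in>S. dirichlet_term f s j)) UNIV"
    and "dirichlet_sum f s = (\<Sum>j\<in>S. dirichlet_term f s j)"
proof -
  show *: "(dirichlet_term f s has_sum (\<Sum>j\<in>S. dirichlet_term f s j)) UNIV"
    by (rule has_sum_finiteI[OF assms(1), THEN has_sum_cong_neutral[THEN iffD1, rotated -1]])
      (use assms in \<open>auto simp: dirichlet_term_def\<close>)
  then show "dirichlet_sum f s = (\<Sum>j\<in>S. dirichlet_term f s j)"
    unfolding dirichlet_sum_def by (rule infsumI)
qed

text \<open>
  Bessel's inequality for the mean along the line \<open>Re s = x\<close>: the series of \<open>F\<close> is only assumed to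
  converge on the line \<open>Re s = y\<close>, but by \<open>line_mean_shift\<close> its coefficients are means of
  \<open>F(s) n\<^sup>s\<close> on the line \<open>Re s = x\<close> as well. With \<open>g\<close> the partial sum of the series of \<open>F\<close>, the
  pointwise inequality \<open>0 \<le> |F - g|\<^sup>2 \<le> C\<^sup>2 |P|\<^sup>2 - 2 Re (F cnj g) + |g|\<^sup>2\<close> survives taking means, and
  all three means on the right are known.
\<close>

lemma dominated_coefficients_line:
  fixes C :: real
  assumes hol: "F holomorphic_on {s. Re s > \<alpha>}" and S: "finite S" "0 \<notin> S"
    and supp: "\<And>j. j \<notin> S \<Longrightarrow> f j = 0"
    and dom: "\<And>s. Re s > \<alpha> \<Longrightarrow> norm (F s) \<le> C * norm (\<Sum>j\<in>S. dirichlet_term f s j)" and C: "C \<ge> 0"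
    and x: "\<alpha> < x" "x \<le> y"
    and summ: "dirichlet_term c (of_real y) summable_on UNIV"
    and repr: "\<And>t. F (Complex y t) = dirichlet_sum c (Complex y t)"
  shows "(\<Sum>m=1..M. (cmod (c m))\<^sup>2 * real m powr (- 2 * x))
       \<le> C\<^sup>2 * (\<Sum>j\<in>S. (cmod (f j))\<^sup>2 * real j powr (- 2 * x))"
proof -
  define P where "P s = (\<Sum>j\<in>S. dirichlet_term f s j)" for s
  define g where "g t = (\<Sum>m=1..M. dirichlet_term c (Complex x t) m)" for t
  have coefF: "((\<lambda>T. line_mean T (\<lambda>t. F (Complex x t) * of_nat n powr Complex x t)) \<longlongrightarrow> c n) at_top"
    if n: "n \<ge> 1" for n
  proof -
    have hol': "(\<lambda>s. F s * of_nat n powr s) holomorphic_on {s. Re s > \<alpha>}"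
      using n by (intro holomorphic_intros hol) auto
    have bd: "norm (F s * of_nat n powr s)
        \<le> (C * (\<Sum>j\<in>S. norm (dirichlet_term f (of_real x) j))) * real n powr y"
      if s: "x \<le> Re s" "Re s \<le> y" for s
    proof -
      have "norm (\<Sum>j\<in>S. dirichlet_term f s j) \<le> (\<Sum>j\<in>S. norm (dirichlet_term f (of_real x) j))"
        by (rule sum_norm_le) (use s in \<open>auto intro: norm_dirichlet_term_mono\<close>)
      then have "norm (F s) \<le> C * (\<Sum>j\<in>S. norm (dirichlet_term f (of_real x) j))"
        using dom[of s] s x C by (smt (verit) mult_left_mono)
      moreover have "norm (of_nat n powr s :: complex) \<le> real n powr y"
        using norm_powr_real_powr[of "of_nat n" s] n s by (simp add: powr_mono)
      ultimately show ?thesis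
        unfolding norm_mult using C by (intro mult_mono mult_nonneg_nonneg sum_nonneg) auto
    qed
    have "((\<lambda>T. line_mean T (\<lambda>t. F (Complex y t) * of_nat n powr Complex y t)) \<longlongrightarrow> c n) at_top"
      unfolding repr by (rule line_mean_dirichlet_coefficient[OF summ n])
    from tendsto_add[OF line_mean_shift[OF hol' x bd] this] show ?thesis by simp
  qed
  have summf: "dirichlet_term f (of_real x) summable_on UNIV"
    using dirichlet_sum_finite_support(1)[OF S(1) supp] by (rule has_sum_imp_summable)
  have P: "dirichlet_sum f = P"
    using dirichlet_sum_finite_support(2)[OF S(1) supp] by (auto simp: P_def)
  have coefP: "((\<lambda>T. line_mean T (\<lambda>t. P (Complex x t) * of_nat n powr Complex x t)) \<longlongrightarrow> f n) at_top"
    if n: "n \<ge> 1" for n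
    using line_mean_dirichlet_coefficient[OF summf n] by (simp add: P)
  define c' where "c' m = (if m \<in> {1..M} then c m else 0)" for m
  have c': "dirichlet_sum c' (Complex x t) = g t" for t
    unfolding g_def by (subst dirichlet_sum_finite_support(2)[of "{1..M}"])
      (auto simp: c'_def dirichlet_term_def)
  have summc': "dirichlet_term c' (of_real x) summable_on UNIV"
    by (rule has_sum_imp_summable[OF dirichlet_sum_finite_support(1)[of "{1..M}"]]) (auto simp: c'_def)
  have coefg: "((\<lambda>T. line_mean T (\<lambda>t. g t * of_nat n powr Complex x t)) \<longlongrightarrow> c' n) at_top"
    if n: "n \<ge> 1" for n
    using line_mean_dirichlet_coefficient[OF summc' n] by (simp add: c')
  have contP: "continuous_on UNIV (\<lambda>t. P (Complex x t))" and contg: "continuous_on UNIV g"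
    unfolding P_def g_def by (intro continuous_on_sum continuous_on_dirichlet_term)+
  have contF: "continuous_on UNIV (\<lambda>t. F (Complex x t))"
    by (rule continuous_on_compose2[OF holomorphic_on_imp_continuous_on[OF hol] continuous_on_Complex_line])
      (use x in auto)
  \<comment> \<open>The real part of \<open>Q\<close> is the right-hand side of the pointwise inequality.\<close>
  define Q where "Q t = of_real (C\<^sup>2) * (P (Complex x t) * cnj (P (Complex x t)))
      - 2 * (F (Complex x t) * cnj (g t)) + g t * cnj (g t)" for t
  define EP where "EP = (\<Sum>j\<in>S. f j * cnj (f j) * of_real (real j powr (- 2 * x)))"
  define Ec where "Ec = (\<Sum>m=1..M. c m * cnj (c m) * of_real (real m powr (- 2 * x)))"
  have Ec': "(\<Sum>m=1..M. c' m * cnj (c m) * of_real (real m powr (- 2 * x))) = Ec"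
    unfolding Ec_def by (rule sum.cong) (auto simp: c'_def)
  have "((\<lambda>T. of_real (C\<^sup>2) * line_mean T (\<lambda>t. P (Complex x t) * cnj (P (Complex x t)))
      - 2 * line_mean T (\<lambda>t. F (Complex x t) * cnj (g t)) + line_mean T (\<lambda>t. g t * cnj (g t)))
      \<longlongrightarrow> of_real (C\<^sup>2) * EP - 2 * Ec + Ec) at_top"
  proof (intro tendsto_add tendsto_diff tendsto_mult tendsto_const)
    show "((\<lambda>T. line_mean T (\<lambda>t. P (Complex x t) * cnj (P (Complex x t)))) \<longlongrightarrow> EP) at_top"
      using line_mean_mult_cnj_polynomial[OF contP S coefP, of f] by (simp add: EP_def P_def)
    show "((\<lambda>T. line_mean T (\<lambda>t. F (Complex x t) * cnj (g t))) \<longlongrightarrow> Ec) at_top"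
      using line_mean_mult_cnj_polynomial[OF contF _ _ coefF, of "{1..M}" c] by (simp add: Ec_def g_def)
    show "((\<lambda>T. line_mean T (\<lambda>t. g t * cnj (g t))) \<longlongrightarrow> Ec) at_top"
      using line_mean_mult_cnj_polynomial[OF contg _ _ coefg, of "{1..M}" c]
      unfolding Ec' by (simp add: g_def)
  qed
  moreover have "line_mean T Q = of_real (C\<^sup>2) * line_mean T (\<lambda>t. P (Complex x t) * cnj (P (Complex x t)))
      - 2 * line_mean T (\<lambda>t. F (Complex x t) * cnj (g t)) + line_mean T (\<lambda>t. g t * cnj (g t))" for T
  proof -
    have c1: "continuous_on UNIV (\<lambda>t. of_real (C\<^sup>2) * (P (Complex x t) * cnj (P (Complex x t))))"
      and c2: "continuous_on UNIV (\<lambda>t. 2 * (F (Complex x t) * cnj (g t)))"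
      and c3: "continuous_on UNIV (\<lambda>t. g t * cnj (g t))"
      using contP contF contg by (auto intro!: continuous_intros)
    show ?thesis
      unfolding Q_def line_mean_add[OF continuous_on_diff[OF c1 c2] c3] line_mean_diff[OF c1 c2]
        line_mean_cmult ..
  qed
  ultimately have "((\<lambda>T. Re (line_mean T Q)) \<longlongrightarrow> Re (of_real (C\<^sup>2) * EP - 2 * Ec + Ec)) at_top"
    by (intro tendsto_Re) simp
  moreover have "\<forall>\<^sub>F T in at_top. Re (line_mean T Q) \<ge> 0"
    using eventually_gt_at_top[of 0]
  proof eventually_elim
    case (elim T)
    show ?case
    proof (rule Re_line_mean_nonneg[OF _ elim])
      show "continuous_on UNIV Q"
        unfolding Q_def using contP contF contg by (intro continuous_intros)
      fix t
      have "(norm (F (Complex x t)))\<^sup>2 \<le> (C * norm (P (Complex x t)))\<^sup>2"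
        using dom[of "Complex x t"] x by (intro power_mono) (auto simp: P_def)
      moreover have "(norm (F (Complex x t) - g t))\<^sup>2 \<ge> 0" by simp
      then have "(norm (F (Complex x t)))\<^sup>2 - 2 * Re (F (Complex x t) * cnj (g t)) + (norm (g t))\<^sup>2 \<ge> 0"
        unfolding cmod_power2 by (simp add: power2_eq_square algebra_simps)
      ultimately show "Re (Q t) \<ge> 0"
        unfolding Q_def complex_norm_square[symmetric] by (simp add: power_mult_distrib)
    qed
  qed
  ultimately have "0 \<le> Re (of_real (C\<^sup>2) * EP - 2 * Ec + Ec)"
    by (rule tendsto_lowerbound) simp
  moreover have "EP = of_real (\<Sum>j\<in>S. (cmod (f j))\<^sup>2 * real j powr (- 2 * x))"
    unfolding EP_def of_real_sum of_real_mult complex_norm_square ..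
  moreover have "Ec = of_real (\<Sum>m=1..M. (cmod (c m))\<^sup>2 * real m powr (- 2 * x))"
    unfolding Ec_def of_real_sum of_real_mult complex_norm_square ..
  ultimately show ?thesis by simp
qed

lemma dominated_coefficients:
  fixes C :: real
  assumes hol: "F holomorphic_on {s. Re s > \<alpha>}" and S: "finite S" "0 \<notin> S"
    and supp: "\<And>j. j \<notin> S \<Longrightarrow> f j = 0"
    and dom: "\<And>s. Re s > \<alpha> \<Longrightarrow> norm (F s) \<le> C * norm (\<Sum>j\<in>S. dirichlet_term f s j)" and C: "C \<ge> 0"
    and y: "\<alpha> < y"
    and summ: "dirichlet_term c (of_real y) summable_on UNIV"
    and repr: "\<And>t. F (Complex y t) = dirichlet_sum c (Complex y t)"
  shows "(\<Sum>m=1..M. (cmod (c m))\<^sup>2 * real m powr (- 2 * \<alpha>))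
       \<le> C\<^sup>2 * (\<Sum>j\<in>S. (cmod (f j))\<^sup>2 * real j powr (- 2 * \<alpha>))"
proof (rule tendsto_le)
  let ?L = "\<lambda>x. \<Sum>m=1..M. (cmod (c m))\<^sup>2 * real m powr (- 2 * x)"
  let ?R = "\<lambda>x. C\<^sup>2 * (\<Sum>j\<in>S. (cmod (f j))\<^sup>2 * real j powr (- 2 * x))"
  have t: "((\<lambda>x. real m powr (- 2 * x)) \<longlongrightarrow> real m powr (- 2 * \<alpha>)) (at_right \<alpha>)" if "m \<noteq> 0" for m
    using that by (intro tendsto_intros) auto
  show "(?L \<longlongrightarrow> ?L \<alpha>) (at_right \<alpha>)"
    by (intro tendsto_sum tendsto_mult tendsto_const t) simp
  have "m \<noteq> 0" if "m \<in> S" for m using that S(2) by metis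
  then show "(?R \<longlongrightarrow> ?R \<alpha>) (at_right \<alpha>)"
    by (intro tendsto_sum tendsto_mult tendsto_const t)
  have "\<forall>\<^sub>F x in at_right \<alpha>. \<alpha> < x \<and> x < y"
    using y by (auto simp: eventually_at_right_field)
  then show "\<forall>\<^sub>F x in at_right \<alpha>. ?L x \<le> ?R x"
  proof eventually_elim
    case (elim x)
    show ?case
      by (rule dominated_coefficients_line[OF hol S supp dom C _ _ summ repr]) (use elim in auto)
  qed
qed simp

text \<open>
  The product of \<open>\<psi>\<close> with a Dirichlet polynomial \<open>f\<close> is dominated by \<open>C |f|\<close>, so Bessel's inequality
  holds on every line inside the half-plane and, in the limit, on the boundary line
  \<open>Re s = \<alpha>\<close>. For \<open>\<alpha> = 0\<close> this says that a Dirichlet series bounded by \<open>C\<close> on the right half-plane convolves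
  \<open>\<ell>\<^sup>2\<close> with norm at most \<open>C\<close>. The truncations are harmless because \<open>dconv a f m\<close> involves \<open>f\<close> only
  at divisors of \<open>m\<close>.
\<close>

lemma bounded_dirichlet_convolution_l2:
  fixes C :: real
  assumes hol: "\<psi> holomorphic_on {s. Re s > \<alpha>}" and bd: "\<And>s. Re s > \<alpha> \<Longrightarrow> norm (\<psi> s) \<le> C"
    and y: "\<alpha> < y" and summ: "dirichlet_term a (of_real y) summable_on UNIV"
    and repr: "\<And>t. \<psi> (Complex y t) = dirichlet_sum a (Complex y t)"
  shows "(\<Sum>m=1..M. (cmod (dconv a f m))\<^sup>2 * real m powr (- 2 * \<alpha>))
       \<le> C\<^sup>2 * (\<Sum>j=1..M. (cmod (f j))\<^sup>2 * real j powr (- 2 * \<alpha>))"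
proof -
  define f' where "f' j = (if j \<in> {1..M} then f j else 0)" for j
  define P where "P s = (\<Sum>j=1..M. dirichlet_term f' s j)" for s
  have P: "(dirichlet_term f' s has_sum P s) UNIV" for s
    unfolding P_def by (rule dirichlet_sum_finite_support) (auto simp: f'_def)
  have C: "C \<ge> 0" using bd[of "of_real y"] y by (smt (verit) norm_ge_zero Re_complex_of_real)
  have prod: "(dirichlet_term (dconv a f') s has_sum dirichlet_sum a s * P s) UNIV" if "Re s \<ge> y" for s
  proof (rule has_sum_dirichlet_product[OF has_sum_dirichlet_sum P])
    show "dirichlet_term a s summable_on UNIV"
      using summ by (rule dirichlet_summable_mono) (use that in simp)
  qed
  have "(\<Sum>m=1..M. (cmod (dconv a f' m))\<^sup>2 * real m powr (- 2 * \<alpha>))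
       \<le> C\<^sup>2 * (\<Sum>j\<in>{1..M}. (cmod (f' j))\<^sup>2 * real j powr (- 2 * \<alpha>))"
  proof (rule dominated_coefficients[where F = "\<lambda>s. \<psi> s * P s"])
    show "(\<lambda>s. \<psi> s * P s) holomorphic_on {s. \<alpha> < Re s}"
      unfolding P_def dirichlet_term_def by (intro holomorphic_intros hol) auto
    show "norm (\<psi> s * P s) \<le> C * norm (\<Sum>j=1..M. dirichlet_term f' s j)" if "Re s > \<alpha>" for s
      using bd[OF that] by (simp add: norm_mult P_def mult_right_mono)
    show "dirichlet_term (dconv a f') (of_real y) summable_on UNIV"
      by (rule has_sum_imp_summable[OF prod]) simp
    show "\<psi> (Complex y t) * P (Complex y t) = dirichlet_sum (dconv a f') (Complex y t)" for t
      unfolding repr dirichlet_sum_def[of "dconv a f'"] by (rule infsumI[symmetric], rule prod) simp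
  qed (use C y in \<open>auto simp: f'_def\<close>)
  moreover have "dconv a f' m = dconv a f m" if "m \<in> {1..M}" for m
    using that by (intro dconv_cong) (auto simp: f'_def dest: dvd_imp_le intro: Nat.gr0I simp: Suc_le_eq)
  moreover have "(\<Sum>j\<in>{1..M}. (cmod (f' j))\<^sup>2 * real j powr (- 2 * \<alpha>)) =
      (\<Sum>j=1..M. (cmod (f j))\<^sup>2 * real j powr (- 2 * \<alpha>))"
    by (rule sum.cong) (auto simp: f'_def)
  ultimately show ?thesis by simp
qed

section \<open>Moebius inversion and weights that are divisor sums\<close>

lemma moebius_mu_prime_mult:
  assumes p: "prime p" and d: "\<not> p dvd d" "d > 0"
  shows "moebius_mu (p * d) = - moebius_mu d"
proof -
  have cop: "coprime p d" using p d(1) by (simp add: prime_imp_coprime)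
  have "squarefree (p * d) \<longleftrightarrow> squarefree d"
    using cop p squarefree_mult_coprime squarefree_prime squarefree_multD(2) by blast
  moreover have "prime_factors (p * d) = insert p (prime_factors d)"
    using p d(2) by (auto simp: prime_factorization_mult prime_factorization_prime)
  moreover have "p \<notin> prime_factors d" using d(1) by auto
  ultimately show ?thesis by (simp add: moebius_mu_def)
qed

text \<open>
  Fix a prime \<open>p\<close> dividing \<open>n\<close>. Multiplication by \<open>p\<close> pairs the squarefree divisors prime to \<open>p\<close> with
  the other squarefree divisors, and \<open>\<mu>\<close> takes opposite values on each pair.
\<close>

lemma sum_moebius_mu_divisors:
  assumes "n \<ge> 1"
  shows "(\<Sum>d | d dvd n. moebius_mu d) = (if n = 1 then 1 else 0)"
proof (cases "n = 1")
  case True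
  then have "{d. d dvd n} = {1}" by auto
  then show ?thesis using True by (simp add: moebius_mu_def)
next
  case False
  then obtain p where p: "prime p" "p dvd n" using prime_factor_nat by blast
  define D where "D = {d. d dvd n \<and> squarefree d}"
  define D0 where "D0 = {d \<in> D. \<not> p dvd d}"
  have fin: "finite {d. d dvd n}" using assms by simp
  then have "finite D" "finite D0" by (auto simp: D_def D0_def)
  have pos: "d > 0" if "d \<in> D" for d
    using that assms by (auto simp: D_def intro: dvd_pos_nat)
  have "D = D0 \<union> (\<lambda>d. p * d) ` D0"
  proof
    show "D \<subseteq> D0 \<union> (\<lambda>d. p * d) ` D0"
    proof
      fix d assume d: "d \<in> D"
      show "d \<in> D0 \<union> (\<lambda>d. p * d) ` D0"
      proof (cases "p dvd d")
        case True
        then obtain e where e: "d = p * e" by blast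
        have "\<not> p dvd e"
        proof
          assume "p dvd e"
          then have "p\<^sup>2 dvd d" unfolding e power2_eq_square by (rule mult_dvd_mono[OF dvd_refl])
          with d have "p dvd 1" unfolding D_def by (blast dest: squarefreeD)
          with p(1) show False by simp
        qed
        moreover have "e \<in> D" using d unfolding e D_def
          by (auto dest: dvd_mult_right squarefree_multD(2))
        ultimately show ?thesis using e by (auto simp: D0_def)
      qed (use d in \<open>auto simp: D0_def\<close>)
    qed
    have "p * d \<in> D" if "d \<in> D0" for d
    proof -
      have "coprime p d" using p that by (simp add: prime_imp_coprime D0_def)
      then show ?thesis using that p squarefree_prime[OF p(1)]
        by (auto simp: D_def D0_def intro: divides_mult squarefree_mult_coprime)
    qed
    then show "D0 \<union> (\<lambda>d. p * d) ` D0 \<subseteq> D" by (auto simp: D0_def)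
  qed
  moreover have "D0 \<inter> (\<lambda>d. p * d) ` D0 = {}" by (auto simp: D0_def)
  moreover have "inj_on (\<lambda>d. p * d) D0" using p(1) by (auto intro!: inj_onI)
  ultimately have "(\<Sum>d\<in>D. moebius_mu d) = (\<Sum>d\<in>D0. moebius_mu d) + (\<Sum>d\<in>D0. moebius_mu (p * d))"
    using \<open>finite D0\<close> by (simp add: sum.union_disjoint sum.reindex)
  also have "(\<Sum>d\<in>D0. moebius_mu (p * d)) = (\<Sum>d\<in>D0. - moebius_mu d)"
    by (rule sum.cong) (use p pos in \<open>auto simp: D0_def moebius_mu_prime_mult\<close>)
  finally have "(\<Sum>d\<in>D. moebius_mu d) = 0" by (simp add: sum_negf)
  moreover have "(\<Sum>d | d dvd n. moebius_mu d) = (\<Sum>d\<in>D. moebius_mu d)"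
    by (rule sum.mono_neutral_right) (use fin in \<open>auto simp: D_def moebius_mu_def\<close>)
  ultimately show ?thesis using False by simp
qed

text \<open>
  Both sides run over the factorisations \<open>m = n i k\<close>.
\<close>

lemma sum_divisors_of_divisors:
  fixes F :: "nat \<Rightarrow> nat \<Rightarrow> 'a::comm_monoid_add"
  assumes "m \<ge> 1"
  shows "(\<Sum>d | d dvd m. \<Sum>n | n dvd d. F n (d div n)) = (\<Sum>n | n dvd m. \<Sum>i | i dvd m div n. F n i)"
proof -
  have fin: "finite {d. d dvd k}" if "k dvd m" for k
    using that assms by (auto intro: dvd_pos_nat simp: finite_divisors_nat)
  have "(\<Sum>d | d dvd m. \<Sum>n | n dvd d. F n (d div n))
      = (\<Sum>(d, n)\<in>(SIGMA d:{d. d dvd m}. {n. n dvd d}). F n (d div n))"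
    by (rule sum.Sigma) (use fin in auto)
  also have "\<dots> = (\<Sum>(n, i)\<in>(SIGMA n:{n. n dvd m}. {i. i dvd m div n}). F n i)"
    by (rule sum.reindex_bij_witness[where j = "\<lambda>(d, n). (n, d div n)" and i = "\<lambda>(n, i). (n * i, n)"])
      (use assms in \<open>auto simp: div_dvd_div dvd_div_iff_mult mult.commute dvd_pos_nat intro: dvd_trans\<close>)
  also have "\<dots> = (\<Sum>n | n dvd m. \<Sum>i | i dvd m div n. F n i)"
    by (rule sum.Sigma[symmetric]) (use fin in \<open>auto intro: div_dvd_iff_mult\<close>)
  finally show ?thesis .
qed

lemma sum_divisors_atMost:
  fixes F :: "nat \<Rightarrow> nat \<Rightarrow> 'a::comm_monoid_add"
  shows "(\<Sum>m=1..M. \<Sum>n | n dvd m. F n (m div n)) = (\<Sum>n=1..M. \<Sum>i=1..M div n. F n i)"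
proof -
  have "(\<Sum>m=1..M. \<Sum>n | n dvd m. F n (m div n))
      = (\<Sum>(m, n)\<in>(SIGMA m:{1..M}. {n. n dvd m}). F n (m div n))"
    by (rule sum.Sigma) auto
  also have "\<dots> = (\<Sum>(n, i)\<in>(SIGMA n:{1..M}. {1..M div n}). F n i)"
  proof (rule sum.reindex_bij_witness[where j = "\<lambda>(m, n). (n, m div n)" and i = "\<lambda>(n, i). (n * i, n)"])
    fix z assume "z \<in> (SIGMA m:{1..M}. {n. n dvd m})"
    then obtain m n where z: "z = (m, n)" "1 \<le> m" "m \<le> M" "n dvd m" by auto
    then have n: "n \<ge> 1" "n \<le> m" "m div n \<ge> 1"
      by (auto simp: Suc_le_eq dvd_imp_le dvd_pos_nat div_greater_zero_iff)
    then show "(case z of (m, n) \<Rightarrow> (n, m div n)) \<in> (SIGMA n:{1..M}. {1..M div n})"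
      using z by (auto intro: div_le_mono)
    show "(case case z of (m, n) \<Rightarrow> (n, m div n) of (n, i) \<Rightarrow> (n * i, n)) = z" using z by simp
  next
    fix z assume "z \<in> (SIGMA n:{1..M}. {1..M div n})"
    then obtain n i where z: "z = (n, i)" "1 \<le> n" "n \<le> M" "1 \<le> i" "i \<le> M div n" by auto
    then have "n * i \<le> M" by (simp add: less_eq_div_iff_mult_less_eq mult.commute)
    then show "(case z of (n, i) \<Rightarrow> (n * i, n)) \<in> (SIGMA m:{1..M}. {n. n dvd m})"
      using z by auto
    show "(case case z of (n, i) \<Rightarrow> (n * i, n) of (m, n) \<Rightarrow> (n, m div n)) = z" using z by simp
  qed auto
  also have "\<dots> = (\<Sum>n=1..M. \<Sum>i=1..M div n. F n i)"
    by (rule sum.Sigma[symmetric]) auto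
  finally show ?thesis .
qed

lemma moebius_inversion:
  fixes v :: "nat \<Rightarrow> real"
  assumes b: "\<And>n. b n = (\<Sum>j | j \<ge> 2 \<and> j dvd n. v j * of_int (moebius_mu (n div j)))" and m: "m \<ge> 2"
  shows "(\<Sum>n | n dvd m. b n) = v m"
proof -
  define u where "u j = (if j \<ge> 2 then v j else 0)" for j
  have fin: "finite {d. d dvd k}" if "k dvd m" for k
    using that m by (intro finite_divisors_nat) (auto intro: Nat.gr0I)
  have "(\<Sum>n | n dvd m. b n) = (\<Sum>n | n dvd m. \<Sum>j | j dvd n. u j * of_int (moebius_mu (n div j)))"
  proof (rule sum.cong)
    fix n assume n: "n \<in> {n. n dvd m}"
    show "b n = (\<Sum>j | j dvd n. u j * of_int (moebius_mu (n div j)))"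
      unfolding b by (rule sum.mono_neutral_cong_left) (use fin n in \<open>auto simp: u_def\<close>)
  qed simp
  also have "\<dots> = (\<Sum>j | j dvd m. \<Sum>e | e dvd m div j. u j * of_int (moebius_mu e))"
    using m by (intro sum_divisors_of_divisors) auto
  also have "\<dots> = (\<Sum>j | j dvd m. if j = m then u m else 0)"
  proof (rule sum.cong)
    fix j assume j: "j \<in> {j. j dvd m}"
    then obtain k where k: "m = j * k" by auto
    then have "j > 0" "k > 0" using m by (auto intro!: Nat.gr0I)
    then have "m div j \<ge> 1" "m div j = 1 \<longleftrightarrow> j = m"
      using k by auto
    moreover have "(\<Sum>e | e dvd m div j. u j * of_int (moebius_mu e)) = u j * of_int (\<Sum>e | e dvd m div j. moebius_mu e)"
      by (simp add: sum_distrib_left)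
    ultimately show "(\<Sum>e | e dvd m div j. u j * of_int (moebius_mu e)) = (if j = m then u m else 0)"
      by (simp add: sum_moebius_mu_divisors)
  qed simp
  also have "\<dots> = v m"
    using m fin[of m] by (simp add: u_def)
  finally show ?thesis .
qed

definition weighted_sq :: "(nat \<Rightarrow> real) \<Rightarrow> nat \<Rightarrow> (nat \<Rightarrow> complex) \<Rightarrow> real" where
  "weighted_sq w M f = (\<Sum>j=2..M. (cmod (f j))\<^sup>2 / w j)"

text \<open>
  Because convolution is triangular for divisibility, bounding it on every initial segment
  \<open>{2..M}\<close> is the same as bounding it on the whole weighted space, and no summability has to be
  mentioned. The condition \<open>f 1 = 0\<close> matters: the sequences of the space start at index 2, while
  \<open>dconv a f\<close> also sees \<open>f 1\<close>.
\<close>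

definition dconv_bounded :: "(nat \<Rightarrow> real) \<Rightarrow> (nat \<Rightarrow> complex) \<Rightarrow> real \<Rightarrow> bool" where
  "dconv_bounded w a C \<longleftrightarrow> C \<ge> 0 \<and>
     (\<forall>M f. f 1 = 0 \<longrightarrow> weighted_sq w M (dconv a f) \<le> C\<^sup>2 * weighted_sq w M f)"

text \<open>
  The Cauchy-Schwarz inequality for the measure with masses \<open>b n\<close>.
\<close>

lemma sum_weighted_sq_le:
  fixes b :: "nat \<Rightarrow> real" and X :: "nat \<Rightarrow> complex"
  assumes "\<And>n. n \<in> N \<Longrightarrow> b n \<ge> 0"
  shows "(cmod (\<Sum>n\<in>N. of_real (b n) * X n))\<^sup>2 \<le> (\<Sum>n\<in>N. b n) * (\<Sum>n\<in>N. b n * (cmod (X n))\<^sup>2)"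
proof -
  have "cmod (\<Sum>n\<in>N. of_real (b n) * X n) \<le> (\<Sum>n\<in>N. sqrt (b n) * (sqrt (b n) * cmod (X n)))"
    by (rule sum_norm_le) (use assms in \<open>simp add: norm_mult flip: mult.assoc\<close>)
  then have "(cmod (\<Sum>n\<in>N. of_real (b n) * X n))\<^sup>2 \<le> (\<Sum>n\<in>N. sqrt (b n) * (sqrt (b n) * cmod (X n)))\<^sup>2"
    by (intro power_mono) auto
  also have "\<dots> \<le> (\<Sum>n\<in>N. (sqrt (b n))\<^sup>2) * (\<Sum>n\<in>N. (sqrt (b n) * cmod (X n))\<^sup>2)"
    by (rule Cauchy_Schwarz_ineq_sum)
  also have "\<dots> = (\<Sum>n\<in>N. b n) * (\<Sum>n\<in>N. b n * (cmod (X n))\<^sup>2)"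
    by (intro arg_cong2[where f = "(*)"] sum.cong) (use assms in \<open>auto simp: power_mult_distrib\<close>)
  finally show ?thesis .
qed

text \<open>
  Put \<open>g\<^sub>n(i) = f(n i) / v(n i)\<close>. Since \<open>v\<close> is the divisor sum of \<open>b\<close>, the sequence \<open>f\<close> is the sum over
  \<open>n\<close> of \<open>b\<^sub>n\<close> times the dilation of \<open>g\<^sub>n\<close> by \<open>n\<close>, and \<open>\<Sum>\<^sub>n b\<^sub>n \<parallel>g\<^sub>n\<parallel>\<^sup>2\<close> is exactly the squared weighted norm of
  \<open>f\<close>. Dilations commute with convolution, so the \<open>\<ell>\<^sup>2\<close> bound applies to each \<open>g\<^sub>n\<close>; Cauchy-Schwarz with
  the masses \<open>b\<^sub>n\<close>, whose total over the divisors of \<open>m\<close> is \<open>v m\<close>, recombines the pieces without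
  loss.
\<close>

lemma dconv_bounded_divisor_sum_weight:
  assumes C: "C \<ge> 0"
    and l2: "\<And>M f. (\<Sum>m=1..M. (cmod (dconv a f m))\<^sup>2) \<le> C\<^sup>2 * (\<Sum>j=1..M. (cmod (f j))\<^sup>2)"
    and b: "\<And>n. n \<ge> 1 \<Longrightarrow> b n \<ge> 0" and v: "\<And>m. m \<ge> 2 \<Longrightarrow> v m = (\<Sum>n | n dvd m. b n)"
    and vpos: "\<And>m. m \<ge> 2 \<Longrightarrow> v m > 0" and b1: "b 1 = 0"
  shows "dconv_bounded v a C"
  unfolding dconv_bounded_def
proof (intro conjI allI impI C)
  fix M and f :: "nat \<Rightarrow> complex" assume f1: "f 1 = 0"
  define g where "g n i = f (n * i) / of_real (v (n * i))" for n i
  have bdvd: "b n \<ge> 0" if "n dvd m" "m \<ge> 1" for m n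
    using that by (intro b) (auto simp: Suc_le_eq dvd_pos_nat)
  have fdecomp: "f j = (\<Sum>n | n dvd j. of_real (b n) * g n (j div n))" if j: "j \<ge> 1" for j
  proof (cases "j = 1")
    case True
    then have "{n. n dvd j} = {1}" by auto
    then show ?thesis using True f1 b1 by simp
  next
    case False
    then have j2: "j \<ge> 2" using j by simp
    have "(\<Sum>n | n dvd j. of_real (b n) * g n (j div n)) = (\<Sum>n | n dvd j. of_real (b n) * (f j / of_real (v j)))"
      by (rule sum.cong) (auto simp: g_def)
    also have "\<dots> = of_real (v j) * (f j / of_real (v j))"
      by (simp only: v[OF j2] of_real_sum sum_distrib_right)
    also have "\<dots> = f j" using vpos[OF j2] by simp
    finally show ?thesis by simp
  qed
  have conv: "dconv a f m = (\<Sum>n | n dvd m. of_real (b n) * dconv a (g n) (m div n))" if m: "m \<ge> 1" for m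
  proof -
    have "dconv a f m = (\<Sum>d | d dvd m. \<Sum>n | n dvd d. a (m div (n * (d div n))) * (of_real (b n) * g n (d div n)))"
      unfolding dconv_def
    proof (rule sum.cong)
      fix d assume "d \<in> {d. d dvd m}"
      then have "d \<ge> 1" using m by (auto simp: Suc_le_eq dvd_pos_nat)
      then show "a (m div d) * f d = (\<Sum>n | n dvd d. a (m div (n * (d div n))) * (of_real (b n) * g n (d div n)))"
        by (simp add: fdecomp[of d] sum_distrib_left)
    qed simp
    also have "\<dots> = (\<Sum>n | n dvd m. \<Sum>i | i dvd m div n. a (m div (n * i)) * (of_real (b n) * g n i))"
      by (rule sum_divisors_of_divisors[OF m])
    also have "\<dots> = (\<Sum>n | n dvd m. of_real (b n) * dconv a (g n) (m div n))"
      by (simp add: dconv_def sum_distrib_left div_mult2_eq mult_ac)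
    finally show ?thesis .
  qed
  have "weighted_sq v M (dconv a f) \<le> (\<Sum>m=2..M. \<Sum>n | n dvd m. b n * (cmod (dconv a (g n) (m div n)))\<^sup>2)"
    unfolding weighted_sq_def
  proof (rule sum_mono)
    fix m assume "m \<in> {2..M}"
    then have m: "m \<ge> 2" by simp
    have "(cmod (dconv a f m))\<^sup>2 \<le> v m * (\<Sum>n | n dvd m. b n * (cmod (dconv a (g n) (m div n)))\<^sup>2)"
      using m unfolding v[OF m] by (subst conv) (auto intro!: sum_weighted_sq_le bdvd)
    then show "(cmod (dconv a f m))\<^sup>2 / v m \<le> (\<Sum>n | n dvd m. b n * (cmod (dconv a (g n) (m div n)))\<^sup>2)"
      using vpos[OF m] by (simp add: field_simps)
  qed
  also have "\<dots> \<le> (\<Sum>m=1..M. \<Sum>n | n dvd m. b n * (cmod (dconv a (g n) (m div n)))\<^sup>2)"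
    by (rule sum_mono2) (auto intro!: sum_nonneg mult_nonneg_nonneg bdvd)
  also have "\<dots> = (\<Sum>n=1..M. \<Sum>i=1..M div n. b n * (cmod (dconv a (g n) i))\<^sup>2)"
    by (rule sum_divisors_atMost)
  also have "\<dots> \<le> (\<Sum>n=1..M. C\<^sup>2 * (\<Sum>i=1..M div n. b n * (cmod (g n i))\<^sup>2))"
  proof (rule sum_mono)
    fix n assume n: "n \<in> {1..M}"
    have "b n * (\<Sum>i=1..M div n. (cmod (dconv a (g n) i))\<^sup>2) \<le> b n * (C\<^sup>2 * (\<Sum>i=1..M div n. (cmod (g n i))\<^sup>2))"
      by (intro mult_left_mono l2 b) (use n in auto)
    then show "(\<Sum>i=1..M div n. b n * (cmod (dconv a (g n) i))\<^sup>2) \<le> C\<^sup>2 * (\<Sum>i=1..M div n. b n * (cmod (g n i))\<^sup>2)"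
      by (simp add: sum_distrib_left mult_ac)
  qed
  also have "\<dots> = C\<^sup>2 * (\<Sum>n=1..M. \<Sum>i=1..M div n. b n * (cmod (g n i))\<^sup>2)"
    by (simp add: sum_distrib_left)
  also have "(\<Sum>n=1..M. \<Sum>i=1..M div n. b n * (cmod (g n i))\<^sup>2)
      = (\<Sum>j=1..M. \<Sum>n | n dvd j. b n * (cmod (g n (j div n)))\<^sup>2)"
    by (rule sum_divisors_atMost[symmetric])
  also have "\<dots> = (\<Sum>j=1..M. if j = 1 then 0 else (cmod (f j))\<^sup>2 / v j)"
  proof (rule sum.cong)
    fix j assume "j \<in> {1..M}"
    show "(\<Sum>n | n dvd j. b n * (cmod (g n (j div n)))\<^sup>2) = (if j = 1 then 0 else (cmod (f j))\<^sup>2 / v j)"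
    proof (cases "j = 1")
      case True
      then have "{n. n dvd j} = {1}" by auto
      then show ?thesis using True b1 by simp
    next
      case False
      then have j2: "j \<ge> 2" using \<open>j \<in> {1..M}\<close> by simp
      have "(\<Sum>n | n dvd j. b n * (cmod (g n (j div n)))\<^sup>2) = (\<Sum>n | n dvd j. b n * ((cmod (f j))\<^sup>2 / (v j)\<^sup>2))"
        by (rule sum.cong) (auto simp: g_def norm_divide power_divide)
      also have "\<dots> = v j * ((cmod (f j))\<^sup>2 / (v j)\<^sup>2)"
        by (simp only: v[OF j2] sum_distrib_right)
      finally show ?thesis using False vpos[OF j2] by (simp add: power2_eq_square)
    qed
  qed simp
  also have "\<dots> = weighted_sq v M f"
    unfolding weighted_sq_def by (rule sum.mono_neutral_cong_right) auto
  finally show "weighted_sq v M (dconv a f) \<le> C\<^sup>2 * weighted_sq v M f" .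
qed

text \<open>
  Twisting by \<open>k\<^sup>t\<close>, which is a translation of the variable \<open>s\<close>, is multiplicative and hence an
  automorphism of the convolution algebra.
\<close>

lemma dconv_shift:
  "dconv (\<lambda>k. a k * of_real (real k powr t)) (\<lambda>k. f k * of_real (real k powr t)) m
    = dconv a f m * of_real (real m powr t)"
  unfolding dconv_def sum_distrib_right
proof (rule sum.cong)
  fix d assume "d \<in> {d. d dvd m}"
  then have "real m = real (m div d) * real d" by (metis dvd_div_mult_self mem_Collect_eq of_nat_mult)
  then have "real m powr t = real (m div d) powr t * real d powr t" by (simp only: powr_mult)
  then show "a (m div d) * of_real (real (m div d) powr t) * (f d * of_real (real d powr t))
      = a (m div d) * f d * of_real (real m powr t)" by simp
qed simp

text \<open>
  The twist by \<open>k\<^sup>-\<^sup>\<delta>\<^sup>/\<^sup>2\<close> translates the half-plane to \<open>Re s > 0\<close> and turns the weight into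
  \<open>v\<^sub>j = j\<^sup>-\<^sup>\<delta> w\<^sub>j\<close>, which Moebius inversion writes as a divisor sum with non-negative masses.
\<close>

lemma dconv_bounded_of_bounded:
  fixes C \<delta> :: real
  assumes wpos: "\<And>j. j \<ge> 2 \<Longrightarrow> w j > 0"
    and mob: "\<And>n::nat. n \<ge> 2 \<Longrightarrow>
      (\<Sum>j | j \<ge> 2 \<and> j dvd n. real j powr (- \<delta>) * w j * real_of_int (moebius_mu (n div j))) \<ge> 0"
    and hol: "\<psi> holomorphic_on {s. Re s > \<delta> / 2}" and bd: "\<And>s. Re s > \<delta> / 2 \<Longrightarrow> norm (\<psi> s) \<le> C"
    and y: "\<delta> / 2 < y" and summ: "dirichlet_term a (of_real y) summable_on UNIV"
    and repr: "\<And>t. \<psi> (Complex y t) = dirichlet_sum a (Complex y t)"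
  shows "dconv_bounded w a C"
proof -
  define v where "v j = real j powr (- \<delta>) * w j" for j
  define b where "b n = (\<Sum>j | j \<ge> 2 \<and> j dvd n. v j * real_of_int (moebius_mu (n div j)))" for n
  define a' where "a' k = a k * of_real (real k powr (- \<delta> / 2))" for k
  have C: "C \<ge> 0" using bd[of "of_real y"] y by (smt (verit) norm_ge_zero Re_complex_of_real)
  have sq: "(real k powr (- \<delta> / 2))\<^sup>2 = real k powr (- \<delta>)" for k
    by (simp add: power2_eq_square flip: powr_add)
  have one: "real k powr (\<delta> / 2) * real k powr (- \<delta> / 2) = 1" if "k \<ge> 1" for k
    using that by (simp flip: powr_add)
  have b1: "b 1 = 0" unfolding b_def by (rule sum.neutral) auto
  have "dconv_bounded v a' C"
  proof (rule dconv_bounded_divisor_sum_weight[OF C])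
    show "b n \<ge> 0" if "n \<ge> 1" for n
      using that mob[of n] b1 unfolding b_def v_def by (cases "n = 1") auto
    show "v m = (\<Sum>n | n dvd m. b n)" if "m \<ge> 2" for m
      using moebius_inversion[OF b_def that] by simp
    show "v m > 0" if "m \<ge> 2" for m using that wpos by (simp add: v_def)
    show "(\<Sum>m=1..M. (cmod (dconv a' f m))\<^sup>2) \<le> C\<^sup>2 * (\<Sum>j=1..M. (cmod (f j))\<^sup>2)" for M f
    proof -
      define f' where "f' k = f k * of_real (real k powr (\<delta> / 2))" for k
      have *: "(cmod (f' j))\<^sup>2 * real j powr (- 2 * (\<delta> / 2)) = (cmod (f j))\<^sup>2" if "j \<ge> 1" for j
      proof -
        have "(cmod (f' j))\<^sup>2 * real j powr (- 2 * (\<delta> / 2)) =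
           (cmod (f j))\<^sup>2 * (real j powr (\<delta> / 2) * real j powr (- \<delta> / 2))\<^sup>2"
          using sq[of j] by (simp add: f'_def norm_mult power_mult_distrib)
        then show ?thesis using one[OF that] by simp
      qed
      have "dconv a' f m = dconv a f' m * of_real (real m powr (- \<delta> / 2))" if "m \<ge> 1" for m
      proof -
        have "dconv a' f m = dconv a' (\<lambda>k. f' k * of_real (real k powr (- \<delta> / 2))) m"
        proof (rule dconv_cong)
          fix d assume "d dvd m"
          then have "d \<ge> 1" using that by (auto simp: Suc_le_eq dvd_pos_nat)
          from one[OF this] show "f d = f' d * of_real (real d powr (- \<delta> / 2))"
            by (simp add: f'_def mult.assoc flip: of_real_mult)
        qed
        then show ?thesis unfolding a'_def dconv_shift .
      qed
      then have "(cmod (dconv a' f m))\<^sup>2 = (cmod (dconv a f' m))\<^sup>2 * real m powr (- 2 * (\<delta> / 2))" if "m \<ge> 1" for m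
        using that sq[of m] by (simp add: norm_mult power_mult_distrib)
      then show ?thesis
        using bounded_dirichlet_convolution_l2[OF hol bd y summ repr, of f' M] * by simp
    qed
  qed (rule b1)
  show ?thesis unfolding dconv_bounded_def
  proof (intro conjI allI impI C)
    fix M and f :: "nat \<Rightarrow> complex" assume f1: "f 1 = 0"
    define f' where "f' k = f k * of_real (real k powr (- \<delta> / 2))" for k
    have *: "weighted_sq v M (\<lambda>k. h k * of_real (real k powr (- \<delta> / 2))) = weighted_sq w M h" for h
      unfolding weighted_sq_def
    proof (rule sum.cong)
      fix j assume "j \<in> {2..M}"
      then have "real j powr (- \<delta>) \<noteq> 0" by simp
      then show "(cmod (h j * of_real (real j powr (- \<delta> / 2))))\<^sup>2 / v j = (cmod (h j))\<^sup>2 / w j"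
        using sq[of j] by (simp add: norm_mult power_mult_distrib v_def)
    qed simp
    have "f' 1 = 0" using f1 by (simp add: f'_def)
    then have "weighted_sq v M (dconv a' f') \<le> C\<^sup>2 * weighted_sq v M f'"
      using \<open>dconv_bounded v a' C\<close> unfolding dconv_bounded_def by blast
    moreover have "dconv a' f' = (\<lambda>k. dconv a f k * of_real (real k powr (- \<delta> / 2)))"
      unfolding a'_def f'_def by (rule ext) (rule dconv_shift)
    ultimately show "weighted_sq w M (dconv a f) \<le> C\<^sup>2 * weighted_sq w M f"
      unfolding f'_def by (simp only: *)
  qed
qed

section \<open>Bounded convolutions and bounded analytic extension\<close>

text \<open>
  On a closed disc inside the half-plane all terms are dominated by those at its leftmost real part,
  so the Weierstrass test applies.
\<close>

lemma holomorphic_dirichlet_sum: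
  assumes summ: "\<And>x. x > \<alpha> \<Longrightarrow> dirichlet_term a (of_real x) summable_on UNIV"
  shows "dirichlet_sum a holomorphic_on {s. Re s > \<alpha>}"
proof (rule holomorphic_uniform_sequence[where f = "\<lambda>n s. \<Sum>k<n. dirichlet_term a s k"])
  show "open {s. Re s > \<alpha>}" by (rule open_halfspace_Re_gt)
  have "(\<lambda>s. dirichlet_term a s k) holomorphic_on {s. \<alpha> < Re s}" for k
  proof (cases "k = 0")
    case False
    then show ?thesis unfolding dirichlet_term_def by (intro holomorphic_intros) auto
  qed simp
  then show "(\<lambda>s. \<Sum>k<n. dirichlet_term a s k) holomorphic_on {s. \<alpha> < Re s}" for n
    by (intro holomorphic_on_sum)
next
  fix z assume "z \<in> {s. \<alpha> < Re s}"
  then have z: "\<alpha> < Re z" by simp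
  define d where "d = (Re z - \<alpha>) / 2"
  define x where "x = \<alpha> + d"
  have d: "d > 0" "x > \<alpha>" using z by (auto simp: d_def x_def)
  have near: "Re s \<ge> x" if "s \<in> cball z d" for s
  proof -
    have "\<bar>Re z - Re s\<bar> \<le> d"
      using that abs_Re_le_cmod[of "z - s"] by (simp add: dist_norm)
    then have "Re z - d \<le> Re s" by linarith
    then show ?thesis by (simp add: x_def d_def field_simps)
  qed
  have unif: "uniform_limit (cball z d) (\<lambda>n s. \<Sum>k<n. dirichlet_term a s k)
      (\<lambda>s. suminf (dirichlet_term a s)) sequentially"
  proof (rule Weierstrass_m_test)
    show "norm (dirichlet_term a s k) \<le> norm (dirichlet_term a (of_real x) k)" if "s \<in> cball z d" for k s
      using near[OF that] by (intro norm_dirichlet_term_mono) simp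
    show "summable (\<lambda>k. norm (dirichlet_term a (of_real x) k))"
      using summ[OF d(2)] summable_on_iff_abs_summable_on_complex summable_on_imp_summable by blast
  qed
  have eq: "suminf (dirichlet_term a s) = dirichlet_sum a s" if "s \<in> cball z d" for s
  proof -
    have "dirichlet_term a s summable_on UNIV"
      by (rule dirichlet_summable_mono[OF summ[OF d(2)]]) (use near[OF that] in simp)
    then show ?thesis using has_sum_dirichlet_sum has_sum_imp_sums sums_unique[symmetric] by blast
  qed
  have "uniform_limit (cball z d) (\<lambda>n s. \<Sum>k<n. dirichlet_term a s k) (dirichlet_sum a) sequentially"
    by (rule uniform_limit_cong'[THEN iffD1, OF refl eq unif])
  moreover have "cball z d \<subseteq> {s. \<alpha> < Re s}" using near d by fastforce
  ultimately show "\<exists>d>0. cball z d \<subseteq> {s. \<alpha> < Re s} \<and>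
      uniform_limit (cball z d) (\<lambda>n s. \<Sum>k<n. dirichlet_term a s k) (dirichlet_sum a) sequentially"
    using d(1) by blast
qed

text \<open>
  The coefficient sequences of the elements of the weighted Hilbert space.
\<close>

definition coeff_space :: "(nat \<Rightarrow> real) \<Rightarrow> (nat \<Rightarrow> complex) set" where
  "coeff_space w = {f. (\<forall>j<2. f j = 0) \<and> (\<lambda>j. (cmod (f j))\<^sup>2 / w j) summable_on {2..}}"

lemma coeff_spaceD:
  assumes "f \<in> coeff_space w"
  shows "f 0 = 0" "f 1 = 0" "(\<lambda>j. (cmod (f j))\<^sup>2 / w j) summable_on {2..}"
  using assms by (auto simp: coeff_space_def)

lemma norm_dirichlet_term_weighted:
  assumes "w > (0 :: real)" "k > 0"
  shows "norm (dirichlet_term f s k) = sqrt ((cmod (f k))\<^sup>2 / w) * sqrt (w * real k powr (- 2 * Re s))"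
proof -
  have "real k powr (- 2 * Re s) = (real k powr (- Re s))\<^sup>2"
    by (simp add: power2_eq_square flip: powr_add)
  then show ?thesis using assms by (simp add: norm_dirichlet_term real_sqrt_divide real_sqrt_mult)
qed

lemma indicator_in_coeff_space:
  assumes "n \<ge> 2"
  shows "(\<lambda>j. if j = n then 1 else 0) \<in> coeff_space w"
proof -
  have "(\<lambda>j. (cmod (if j = n then 1 else 0))\<^sup>2 / w j) summable_on {2..} \<longleftrightarrow>
      (\<lambda>j. (cmod (if j = n then 1 else 0))\<^sup>2 / w j) summable_on {n}"
    by (rule summable_on_cong_neutral) (use assms in auto)
  then show ?thesis using assms by (auto simp: coeff_space_def)
qed

text \<open>
  The evaluation functional at \<open>s\<close>, restricted to coefficients indexed by \<open>A\<close>, has squared norm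
  \<open>\<Sum>\<^bsub>j \<in> A\<^esub> w j * j powr (- 2 * Re s)\<close>.
\<close>

lemma weighted_Cauchy_Schwarz:
  assumes w: "\<And>j. j \<in> A \<Longrightarrow> w j > 0 \<and> j > 0"
    and f: "(\<lambda>j. (cmod (f j))\<^sup>2 / w j) summable_on A"
    and ws: "(\<lambda>j. w j * real j powr (- 2 * Re s)) summable_on A"
  shows "dirichlet_term f s summable_on A"
    and "norm (infsum (dirichlet_term f s) A)
      \<le> sqrt (\<Sum>\<^sub>\<infinity>j\<in>A. (cmod (f j))\<^sup>2 / w j) * sqrt (\<Sum>\<^sub>\<infinity>j\<in>A. w j * real j powr (- 2 * Re s))"
proof -
  let ?B = "sqrt (\<Sum>\<^sub>\<infinity>j\<in>A. (cmod (f j))\<^sup>2 / w j) * sqrt (\<Sum>\<^sub>\<infinity>j\<in>A. w j * real j powr (- 2 * Re s))"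
  have fin: "(\<Sum>j\<in>F. norm (dirichlet_term f s j)) \<le> ?B" if F: "finite F" "F \<subseteq> A" for F
  proof -
    have pos: "0 \<le> (cmod (f j))\<^sup>2 / w j" "0 \<le> w j * real j powr (- 2 * Re s)" if "j \<in> A" for j
      using w[OF that] by auto
    have "(\<Sum>j\<in>F. norm (dirichlet_term f s j))
        = (\<Sum>j\<in>F. \<bar>sqrt ((cmod (f j))\<^sup>2 / w j)\<bar> * \<bar>sqrt (w j * real j powr (- 2 * Re s))\<bar>)"
    proof (rule sum.cong[OF refl])
      fix j assume "j \<in> F"
      then have j: "j \<in> A" using F by auto
      then show "norm (dirichlet_term f s j) = \<bar>sqrt ((cmod (f j))\<^sup>2 / w j)\<bar> * \<bar>sqrt (w j * real j powr (- 2 * Re s))\<bar>"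
        using norm_dirichlet_term_weighted[of "w j" j f s] w[OF j] pos[OF j] by simp
    qed
    also have "\<dots> \<le> L2_set (\<lambda>j. sqrt ((cmod (f j))\<^sup>2 / w j)) F * L2_set (\<lambda>j. sqrt (w j * real j powr (- 2 * Re s))) F"
      by (rule L2_set_mult_ineq)
    also have "\<dots> = sqrt (\<Sum>j\<in>F. (cmod (f j))\<^sup>2 / w j) * sqrt (\<Sum>j\<in>F. w j * real j powr (- 2 * Re s))"
      unfolding L2_set_def using pos F(2)
      by (intro arg_cong2[where f = "(*)"] arg_cong[where f = sqrt] sum.cong) (auto simp: subset_iff)
    also have "\<dots> \<le> ?B"
      using pos F f ws
      by (intro mult_mono real_sqrt_le_mono finite_sum_le_infsum real_sqrt_ge_zero sum_nonneg infsum_nonneg) auto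
    finally show ?thesis .
  qed
  have abs: "(\<lambda>j. norm (dirichlet_term f s j)) summable_on A"
  proof (rule nonneg_bdd_above_summable_on)
    show "bdd_above (sum (\<lambda>j. norm (dirichlet_term f s j)) ` {F. F \<subseteq> A \<and> finite F})"
      by (rule bdd_aboveI2[where M = ?B]) (use fin in auto)
  qed simp
  then show "dirichlet_term f s summable_on A"
    using summable_on_iff_abs_summable_on_complex by blast
  have "norm (infsum (dirichlet_term f s) A) \<le> (\<Sum>\<^sub>\<infinity>j\<in>A. norm (dirichlet_term f s j))"
    by (rule norm_infsum_bound[OF abs])
  also have "\<dots> \<le> ?B" by (rule infsum_le_finite_sums[OF abs fin])
  finally show "norm (infsum (dirichlet_term f s) A) \<le> ?B" .
qed

lemma dconv_indicator:
  assumes "m \<ge> 1"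
  shows "dconv a (\<lambda>j. if j = n then 1 else 0) m = (if n dvd m then a (m div n) else 0)"
proof -
  have fin: "finite {d. d dvd m}" using assms by simp
  have "dconv a (\<lambda>j. if j = n then 1 else 0) m = (\<Sum>d | d dvd m. if d = n then a (m div n) else 0)"
    unfolding dconv_def by (rule sum.cong) auto
  then show ?thesis using fin by simp
qed

context
  fixes w :: "nat \<Rightarrow> real"
  assumes wpos: "\<And>j. j \<ge> 2 \<Longrightarrow> w j > 0"
begin

lemma dconv_bounded_infsum:
  assumes bdd: "dconv_bounded w a C" and f: "f \<in> coeff_space w"
  shows "dconv a f \<in> coeff_space w"
    and "(\<Sum>\<^sub>\<infinity>m\<in>{2..}. (cmod (dconv a f m))\<^sup>2 / w m) \<le> C\<^sup>2 * (\<Sum>\<^sub>\<infinity>j\<in>{2..}. (cmod (f j))\<^sup>2 / w j)"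
proof -
  let ?B = "C\<^sup>2 * (\<Sum>\<^sub>\<infinity>j\<in>{2..}. (cmod (f j))\<^sup>2 / w j)"
  have nn: "0 \<le> (cmod (h j))\<^sup>2 / w j" if "j \<in> {2..}" for j h
    using wpos[of j] that by simp
  have fin: "(\<Sum>m\<in>F. (cmod (dconv a f m))\<^sup>2 / w m) \<le> ?B" if F: "finite F" "F \<subseteq> {2..}" for F
  proof -
    obtain M where M: "F \<subseteq> {..M}" using F(1) finite_nat_iff_bounded_le by blast
    have "(\<Sum>m\<in>F. (cmod (dconv a f m))\<^sup>2 / w m) \<le> weighted_sq w M (dconv a f)"
      unfolding weighted_sq_def by (rule sum_mono2) (use F M nn in auto)
    also have "\<dots> \<le> C\<^sup>2 * weighted_sq w M f"
      using bdd coeff_spaceD(2)[OF f] unfolding dconv_bounded_def by blast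
    also have "\<dots> \<le> ?B"
      unfolding weighted_sq_def using coeff_spaceD(3)[OF f] nn
      by (intro mult_left_mono finite_sum_le_infsum) auto
    finally show ?thesis .
  qed
  have summ: "(\<lambda>m. (cmod (dconv a f m))\<^sup>2 / w m) summable_on {2..}"
  proof (rule nonneg_bdd_above_summable_on)
    show "bdd_above (sum (\<lambda>m. (cmod (dconv a f m))\<^sup>2 / w m) ` {F. F \<subseteq> {2..} \<and> finite F})"
      by (rule bdd_aboveI2[where M = ?B]) (use fin in auto)
  qed (rule nn)
  moreover have "dconv a f j = 0" if "j < 2" for j
  proof (cases "j = 0")
    case False
    then have j: "j = 1" using that by simp
    then have "{d. d dvd j} = {1}" by auto
    then show ?thesis using coeff_spaceD(2)[OF f] j by (simp add: dconv_def)
  qed (simp add: dconv_def)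
  ultimately show "dconv a f \<in> coeff_space w" by (simp add: coeff_space_def)
  show "(\<Sum>\<^sub>\<infinity>m\<in>{2..}. (cmod (dconv a f m))\<^sup>2 / w m) \<le> ?B"
    by (rule infsum_le_finite_sums[OF summ fin])
qed

text \<open>
  The coefficients \<open>a k\<close> need not be those of an element of the space, but convolution with the
  indicator of 2 moves \<open>a k\<close> to index \<open>2 k\<close> and lands in the space, where the Cauchy-Schwarz
  inequality gives absolute convergence.
\<close>

lemma coefficients_summable_on_closed_set:
  assumes conv: "dconv a (\<lambda>j. if j = 2 then 1 else 0) \<in> coeff_space w"
    and ws: "(\<lambda>j. w j * real j powr (- 2 * Re s)) summable_on (A \<inter> {2..})"
    and A: "\<And>k. k \<in> A \<Longrightarrow> 2 * k \<in> A"
  shows "dirichlet_term a s summable_on A"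
proof -
  let ?h = "dconv a (\<lambda>j. if j = 2 then 1 else 0)"
  have "(\<lambda>j. (cmod (?h j))\<^sup>2 / w j) summable_on (A \<inter> {2..})"
    by (rule summable_on_subset[OF coeff_spaceD(3)[OF conv]]) auto
  then have "dirichlet_term ?h s summable_on (A \<inter> {2..})"
    by (intro weighted_Cauchy_Schwarz(1)[OF _ _ ws]) (use wpos in auto)
  then have "dirichlet_term ?h s summable_on ((\<lambda>k. 2 * k) ` (A \<inter> {1..}))"
    by (rule summable_on_subset) (use A in auto)
  then have S: "(dirichlet_term ?h s \<circ> (\<lambda>k. 2 * k)) summable_on (A \<inter> {1..})"
    by (subst (asm) summable_on_reindex) (auto simp: inj_on_def)
  have eq: "(dirichlet_term ?h s \<circ> (\<lambda>k. 2 * k)) k = 2 powr (- s) * dirichlet_term a s k" if "k \<in> A \<inter> {1..}" for k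
    using that dconv_indicator[of "2 * k" a 2] powr_mult_nat[of 2 k "- s"]
    by (simp add: dirichlet_term_def)
  have "(\<lambda>k. 2 powr (- s) * dirichlet_term a s k) summable_on (A \<inter> {1..})"
    by (rule summable_on_cong[THEN iffD1, OF eq S])
  then have "(\<lambda>k. 2 powr s * (2 powr (- s) * dirichlet_term a s k)) summable_on (A \<inter> {1..})"
    by (rule summable_on_cmult_right)
  then have "dirichlet_term a s summable_on (A \<inter> {1..})"
    by (simp add: powr_minus field_simps)
  then show ?thesis
    by (rule summable_on_cong_neutral[THEN iffD1, rotated -1]) (auto simp: not_less_eq_eq)
qed

text \<open>
  The set \<open>A\<close> is closed under products and under divisors, so the sequences supported in \<open>A\<close> form a
  space with a kernel of its own, and compressing the operator to it amounts to restricting the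
  coefficients \<open>a\<close> to \<open>A\<close>. Test the operator on the kernel \<open>f\<close> at \<open>s\<close>, whose value at \<open>s\<close> and whose
  squared norm are both \<open>K\<close>: the value of \<open>\<phi> f\<close> at \<open>s\<close> is \<open>\<phi> K\<close>, and it is at most
  \<open>(C sqrt K) sqrt K\<close>.
\<close>

lemma compressed_symbol_bound:
  assumes bdd: "dconv_bounded w a C"
    and A: "\<And>j k. j \<ge> 1 \<Longrightarrow> k \<ge> 1 \<Longrightarrow> j * k \<in> A \<longleftrightarrow> j \<in> A \<and> k \<in> A" "2 \<in> A"
    and ws: "(\<lambda>j. w j * real j powr (- 2 * Re s)) summable_on (A \<inter> {2..})"
    and summ: "dirichlet_term a s summable_on A"
  shows "norm (infsum (dirichlet_term a s) A) \<le> C"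
proof -
  define B where "B = A \<inter> {2..}"
  define \<phi> where "\<phi> = infsum (dirichlet_term a s) A"
  define a1 where "a1 k = (if k \<in> A then a k else 0)" for k
  define f where "f j = (if j \<in> B then of_real (w j) * cnj (of_nat j powr (- s)) else 0)" for j
  define K where "K = (\<Sum>\<^sub>\<infinity>j\<in>B. w j * real j powr (- 2 * Re s))"
  have C: "C \<ge> 0" using bdd by (simp add: dconv_bounded_def)
  have posB: "w j > 0 \<and> j > 0" if "j \<in> B" for j using that wpos by (auto simp: B_def)
  have norm2: "(cmod (of_nat j powr (- s)))\<^sup>2 = real j powr (- 2 * Re s)" if "j \<in> B" for j
  proof -
    have "cmod (of_nat j powr (- s)) = real j powr (- Re s)"
      using posB[OF that] by (subst norm_powr_real_powr) auto
    then show ?thesis by (simp add: power2_eq_square flip: powr_add)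
  qed
  have K: "((\<lambda>j. w j * real j powr (- 2 * Re s)) has_sum K) B"
    unfolding K_def using ws by (intro has_sum_infsum) (simp add: B_def)
  have Kpos: "K > 0"
  proof -
    have "sum (\<lambda>j. w j * real j powr (- 2 * Re s)) {2} \<le> K"
      by (rule finite_sum_le_has_sum[OF K]) (use A(2) posB in \<open>auto simp: B_def less_imp_le\<close>)
    moreover have "w 2 * 2 powr (- 2 * Re s) > 0" using wpos[of 2] by simp
    ultimately show ?thesis by simp
  qed
  have fnorm: "(cmod (f j))\<^sup>2 / w j = w j * real j powr (- 2 * Re s)" if "j \<in> B" for j
    using that posB[OF that] norm2[OF that] by (simp add: f_def norm_mult power_mult_distrib power2_eq_square)
  have f2: "((\<lambda>j. (cmod (f j))\<^sup>2 / w j) has_sum K) {2..}"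
    using K by (rule has_sum_cong_neutral[THEN iffD1, rotated -1]) (auto simp: fnorm, auto simp: f_def B_def)
  have f: "f \<in> coeff_space w"
    using has_sum_imp_summable[OF f2] by (auto simp: coeff_space_def f_def B_def)
  have ffs: "(dirichlet_term f s has_sum of_real K) UNIV"
  proof -
    have R: "((\<lambda>j. of_real (w j * real j powr (- 2 * Re s)) :: complex) has_sum of_real K) B"
      using K by (rule has_sum_of_real)
    have eq: "of_real (w j * real j powr (- 2 * Re s)) = dirichlet_term f s j" if "j \<in> B" for j
    proof -
      have "of_real (w j * real j powr (- 2 * Re s)) = of_real (w j) * (of_nat j powr (- s) * cnj (of_nat j powr (- s)))"
        unfolding of_real_mult norm2[OF that, symmetric] complex_norm_square ..
      then show ?thesis using that by (simp add: dirichlet_term_def f_def mult_ac)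
    qed
    show ?thesis
      by (rule has_sum_cong_neutral[THEN iffD1, OF _ _ eq R]) (auto simp: dirichlet_term_def f_def)
  qed
  have as: "(dirichlet_term a1 s has_sum \<phi>) UNIV"
    unfolding \<phi>_def using has_sum_infsum[OF summ]
    by (rule has_sum_cong_neutral[THEN iffD1, rotated -1]) (auto simp: a1_def dirichlet_term_def)
  have prod: "(dirichlet_term (dconv a1 f) s has_sum \<phi> * of_real K) UNIV"
    by (rule has_sum_dirichlet_product[OF as ffs])
  have dc: "dconv a1 f m = (if m \<in> B then dconv a f m else 0)" if m: "m \<ge> 1" for m
  proof -
    have "a1 (m div d) * f d = (if m \<in> A then a (m div d) * f d else 0)" if d: "d dvd m" for d
    proof -
      obtain k where k: "m = d * k" using d by auto
      then have "d \<ge> 1" "k \<ge> 1" using m by (auto simp: Suc_le_eq)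
      then show ?thesis using A(1)[of d k] k by (auto simp: a1_def f_def B_def)
    qed
    then have 1: "dconv a1 f m = (if m \<in> A then dconv a f m else 0)"
      unfolding dconv_def by (cases "m \<in> A") (auto intro!: sum.cong sum.neutral)
    have "dconv a f 1 = 0" using coeff_spaceD(2)[OF f] by (simp add: dconv_def)
    then show ?thesis using 1 m by (auto simp: B_def not_less_eq_eq Suc_le_eq le_less)
  qed
  have "norm (infsum (dirichlet_term (dconv a f) s) B) \<le>
      sqrt (\<Sum>\<^sub>\<infinity>m\<in>B. (cmod (dconv a f m))\<^sup>2 / w m) * sqrt K"
    unfolding K_def
  proof (rule weighted_Cauchy_Schwarz(2))
    show "(\<lambda>m. (cmod (dconv a f m))\<^sup>2 / w m) summable_on B"
      using coeff_spaceD(3)[OF dconv_bounded_infsum(1)[OF bdd f]] by (rule summable_on_subset) (simp add: B_def)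
  qed (use posB ws in \<open>auto simp: B_def\<close>)
  also have "infsum (dirichlet_term (dconv a f) s) B = infsum (dirichlet_term (dconv a1 f) s) UNIV"
    by (rule infsum_cong_neutral) (use dc posB in \<open>auto simp: dirichlet_term_def Suc_le_eq\<close>)
  also have "\<dots> = \<phi> * of_real K" using prod by (rule infsumI)
  also have "sqrt (\<Sum>\<^sub>\<infinity>m\<in>B. (cmod (dconv a f m))\<^sup>2 / w m) * sqrt K \<le> sqrt (C\<^sup>2 * K) * sqrt K"
  proof (intro mult_right_mono real_sqrt_le_mono)
    have "(\<Sum>\<^sub>\<infinity>m\<in>B. (cmod (dconv a f m))\<^sup>2 / w m) \<le> (\<Sum>\<^sub>\<infinity>m\<in>{2..}. (cmod (dconv a f m))\<^sup>2 / w m)"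
      using coeff_spaceD(3)[OF dconv_bounded_infsum(1)[OF bdd f]]
      by (intro infsum_mono2 summable_on_subset[of _ "{2..}" B]) (use wpos in \<open>auto simp: B_def less_imp_le\<close>)
    also have "\<dots> \<le> C\<^sup>2 * K"
      using dconv_bounded_infsum(2)[OF bdd f] infsumI[OF f2] by simp
    finally show "(\<Sum>\<^sub>\<infinity>m\<in>B. (cmod (dconv a f m))\<^sup>2 / w m) \<le> C\<^sup>2 * K" .
  qed (use Kpos in auto)
  also have "\<dots> = C * K" using C Kpos by (simp add: real_sqrt_mult)
  finally have "norm \<phi> * K \<le> C * K" using Kpos by (simp add: norm_mult)
  then show ?thesis using Kpos by (simp add: \<phi>_def)
qed

end

text \<open>
  The error at stage \<open>n\<close> only involves non-zero terms with indices not below \<open>n\<close>, so it is dominated by a tail of the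
  absolutely convergent series.
\<close>

lemma infsum_exhaustion_tendsto:
  fixes f :: "nat \<Rightarrow> complex"
  assumes f: "f summable_on UNIV" "f 0 = 0" and A: "\<And>k n. 1 \<le> k \<Longrightarrow> k \<le> n \<Longrightarrow> k \<in> A n"
  shows "(\<lambda>n. infsum f (A n)) \<longlonglongrightarrow> infsum f UNIV"
proof -
  have abs: "(\<lambda>k. norm (f k)) summable_on UNIV"
    using f(1) summable_on_iff_abs_summable_on_complex by blast
  define S where "S = infsum (\<lambda>k. norm (f k)) UNIV"
  have bound: "norm (infsum f (A n) - infsum f UNIV) \<le> S - (\<Sum>k<n. norm (f k))" for n
  proof -
    have "infsum f UNIV = infsum f (A n) + infsum f (- A n)"
      using infsum_Un_disjoint[of f "A n" "- A n"] summable_on_subset[OF f(1)] by (simp add: Compl_partition)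
    then have "norm (infsum f (A n) - infsum f UNIV) = norm (infsum f (- A n))"
      by simp
    also have "\<dots> \<le> infsum (\<lambda>k. norm (f k)) (- A n)"
      by (intro norm_infsum_bound summable_on_subset[OF abs]) simp
    also have "\<dots> \<le> infsum (\<lambda>k. norm (f k)) {n..}"
    proof (rule infsum_mono_neutral)
      fix k assume "k \<in> - A n - {n..}"
      then have "k = 0" using A[of k n] by (cases "k = 0") auto
      then show "norm (f k) \<le> 0" using f(2) by simp
    qed (auto intro: summable_on_subset[OF abs])
    also have "\<dots> = S - (\<Sum>k<n. norm (f k))"
    proof -
      have "{..<n} \<union> {n..} = UNIV" "{..<n} \<inter> {n..} = {}" by auto
      then have "S = infsum (\<lambda>k. norm (f k)) {..<n} + infsum (\<lambda>k. norm (f k)) {n..}"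
        unfolding S_def using infsum_Un_disjoint[of "\<lambda>k. norm (f k)" "{..<n}" "{n..}"] summable_on_subset[OF abs]
        by simp
      then show ?thesis by simp
    qed
    finally show ?thesis .
  qed
  have "(\<lambda>k. norm (f k)) sums S"
    unfolding S_def using abs by (intro has_sum_imp_sums has_sum_infsum)
  then have "(\<lambda>n. S - (\<Sum>k<n. norm (f k))) \<longlonglongrightarrow> S - S"
    unfolding sums_def by (intro tendsto_diff tendsto_const)
  then have "(\<lambda>n. infsum f (A n) - infsum f UNIV) \<longlonglongrightarrow> 0"
    by (intro Lim_null_comparison[OF always_eventually[OF allI, OF bound]]) simp
  then show ?thesis by (rule LIM_zero_cancel)
qed

text \<open>
  The restrictions of the series to the sets \<open>A n\<close> are holomorphic and bounded by \<open>C\<close> on the large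
  half-plane. Montel's theorem extracts a limit from them, and on the small half-plane, where the
  full series converges absolutely, the limit is its sum.
\<close>

lemma bounded_extension:
  assumes wpos: "\<And>j. j \<ge> 2 \<Longrightarrow> w j > 0" and bdd: "dconv_bounded w a C"
    and A: "\<And>n j k. j \<ge> 1 \<Longrightarrow> k \<ge> 1 \<Longrightarrow> j * k \<in> A n \<longleftrightarrow> j \<in> A n \<and> k \<in> A n" "\<And>n. 2 \<in> A n"
      "\<And>n. 0 \<notin> A n"
      "\<And>k n. 1 \<le> k \<Longrightarrow> k \<le> n \<Longrightarrow> k \<in> A n"
    and wA: "\<And>n x. x > 2 * \<alpha> \<Longrightarrow> (\<lambda>j. w j * real j powr (- x)) summable_on (A n \<inter> {2..})"
    and w: "\<And>x. x > 2 * \<beta> \<Longrightarrow> (\<lambda>j. w j * real j powr (- x)) summable_on {2..}" and \<alpha>\<beta>: "\<alpha> \<le> \<beta>"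
  obtains \<psi> where "\<psi> holomorphic_on {s. Re s > \<alpha>}" "\<And>s. Re s > \<alpha> \<Longrightarrow> norm (\<psi> s) \<le> C"
    "\<And>s. Re s > \<beta> \<Longrightarrow> \<psi> s = dirichlet_sum a s"
proof -
  define a' where "a' n k = (if k \<in> A n then a k else 0)" for n k
  have conv: "dconv a (\<lambda>j. if j = 2 then 1 else 0) \<in> coeff_space w"
    by (intro dconv_bounded_infsum[OF wpos bdd] indicator_in_coeff_space) auto
  have double: "2 * k \<in> A n" if "k \<in> A n" for k n
    using A(1)[of 2 k n] A(2)[of n] A(3)[of n] that by (cases "k = 0") auto
  have summA: "dirichlet_term a s summable_on A n" if "Re s > \<alpha>" for s n
    by (rule coefficients_summable_on_closed_set[OF wpos conv])
      (use that wA[of "2 * Re s" n] double in auto)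
  have dir: "dirichlet_sum (a' n) s = infsum (dirichlet_term a s) (A n)" for n s
    unfolding dirichlet_sum_def by (rule infsum_cong_neutral) (auto simp: a'_def dirichlet_term_def)
  have bound: "norm (dirichlet_sum (a' n) s) \<le> C" if "Re s > \<alpha>" for n s
    unfolding dir
    by (rule compressed_symbol_bound[OF wpos bdd A(1) A(2)]) (use that wA[of "2 * Re s" n] summA in auto)
  have hol: "dirichlet_sum (a' n) holomorphic_on {s. Re s > \<alpha>}" for n
  proof (rule holomorphic_dirichlet_sum)
    fix x assume x: "x > \<alpha>"
    then have "dirichlet_term a (of_real x) summable_on A n" by (intro summA) simp
    then show "dirichlet_term (a' n) (of_real x) summable_on UNIV"
      by (rule summable_on_cong_neutral[THEN iffD1, rotated -1]) (auto simp: a'_def dirichlet_term_def)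
  qed
  let ?H = "{h. h holomorphic_on {s. Re s > \<alpha>} \<and> (\<forall>s. Re s > \<alpha> \<longrightarrow> norm (h s) \<le> C)}"
  obtain \<psi> r where \<psi>: "\<psi> holomorphic_on {s. Re s > \<alpha>}" "strict_mono (r :: nat \<Rightarrow> nat)"
    "\<And>s. s \<in> {s. Re s > \<alpha>} \<Longrightarrow> (\<lambda>n. dirichlet_sum (a' (r n)) s) \<longlonglongrightarrow> \<psi> s"
  proof (rule Montel[of "{s. Re s > \<alpha>}" ?H "\<lambda>n. dirichlet_sum (a' n)"])
    show "range (\<lambda>n. dirichlet_sum (a' n)) \<subseteq> ?H" using hol bound by auto
    show "\<exists>B. \<forall>h\<in>?H. \<forall>z\<in>K. norm (h z) \<le> B" if "compact K" "K \<subseteq> {s. \<alpha> < Re s}" for K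
      using that by (intro exI[of _ C]) blast
  qed (auto simp: open_halfspace_Re_gt)
  show ?thesis
  proof
    show "\<psi> holomorphic_on {s. Re s > \<alpha>}" by fact
    show "norm (\<psi> s) \<le> C" if "Re s > \<alpha>" for s
      using \<psi>(3)[of s] bound[OF that] that by (intro Lim_norm_ubound[of sequentially]) auto
    show "\<psi> s = dirichlet_sum a s" if s: "Re s > \<beta>" for s
    proof -
      have "dirichlet_term a s summable_on UNIV"
        by (rule coefficients_summable_on_closed_set[OF wpos conv]) (use w[of "2 * Re s"] s in auto)
      then have "(\<lambda>n. infsum (dirichlet_term a s) (A n)) \<longlonglongrightarrow> dirichlet_sum a s"
        unfolding dirichlet_sum_def by (rule infsum_exhaustion_tendsto) (use A(4) in auto)
      then have "(\<lambda>n. dirichlet_sum (a' (r n)) s) \<longlonglongrightarrow> dirichlet_sum a s"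
        unfolding dir using \<psi>(2) by (rule LIMSEQ_subseq_LIMSEQ[unfolded o_def])
      moreover have "(\<lambda>n. dirichlet_sum (a' (r n)) s) \<longlonglongrightarrow> \<psi> s"
        using \<psi>(3)[of s] s \<alpha>\<beta> by simp
      ultimately show ?thesis using LIMSEQ_unique by blast
    qed
  qed
qed

section \<open>Automatic boundedness of convolution operators\<close>

lemma dconv_add: "dconv a (\<lambda>j. f j + g j) = (\<lambda>m. dconv a f m + dconv a g m)"
  by (rule ext) (simp add: dconv_def ring_distribs sum.distrib)

lemma dconv_cmult: "dconv a (\<lambda>j. c * f j) = (\<lambda>m. c * dconv a f m)"
  by (rule ext) (simp add: dconv_def sum_distrib_left mult_ac)

lemma dconv_cong_le:
  assumes "\<And>j. j \<le> M \<Longrightarrow> f j = g j" "m \<le> M"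
  shows "dconv a f m = dconv a g m"
proof (cases "m = 0")
  case False
  then show ?thesis using assms by (intro dconv_cong) (auto dest: dvd_imp_le)
qed (simp add: dconv_def)

lemma dconv_zero: "(\<And>j. j \<le> M \<Longrightarrow> f j = 0) \<Longrightarrow> m \<le> M \<Longrightarrow> dconv a f m = 0"
  using dconv_cong_le[of M f "\<lambda>_. 0" m a] by (simp add: dconv_def)

lemma weighted_sq_cong: "(\<And>j. j \<le> M \<Longrightarrow> f j = g j) \<Longrightarrow> weighted_sq w M f = weighted_sq w M g"
  unfolding weighted_sq_def by (rule sum.cong) auto

lemma weighted_sq_cmult: "weighted_sq w M (\<lambda>j. c * f j) = (cmod c)\<^sup>2 * weighted_sq w M f"
  by (simp add: weighted_sq_def norm_mult power_mult_distrib sum_distrib_left)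

lemma weighted_sq_zero: "(\<And>j. 2 \<le> j \<Longrightarrow> j \<le> M \<Longrightarrow> f j = 0) \<Longrightarrow> weighted_sq w M f = 0"
  unfolding weighted_sq_def by (rule sum.neutral) auto

context
  fixes w :: "nat \<Rightarrow> real"
  assumes wpos: "\<And>j. j \<ge> 2 \<Longrightarrow> w j > 0"
begin

lemma weighted_sq_nonneg: "weighted_sq w M f \<ge> 0"
  unfolding weighted_sq_def by (rule sum_nonneg) (use wpos in \<open>auto simp: less_imp_le\<close>)

lemma weighted_sq_triangle:
  "sqrt (weighted_sq w M (\<lambda>j. f j + g j)) \<le> sqrt (weighted_sq w M f) + sqrt (weighted_sq w M g)"
proof -
  have L2: "sqrt (weighted_sq w M h) = L2_set (\<lambda>j. cmod (h j) / sqrt (w j)) {2..M}" for h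
    unfolding L2_set_def weighted_sq_def
    by (intro arg_cong[where f = sqrt] sum.cong) (use wpos in \<open>auto simp: power_divide less_imp_le\<close>)
  have "L2_set (\<lambda>j. cmod (f j + g j) / sqrt (w j)) {2..M}
      \<le> L2_set (\<lambda>j. cmod (f j) / sqrt (w j) + cmod (g j) / sqrt (w j)) {2..M}"
    by (rule L2_set_mono)
      (use wpos in \<open>auto simp: less_imp_le norm_triangle_ineq divide_right_mono simp flip: add_divide_distrib\<close>)
  also have "\<dots> \<le> L2_set (\<lambda>j. cmod (f j) / sqrt (w j)) {2..M} + L2_set (\<lambda>j. cmod (g j) / sqrt (w j)) {2..M}"
    by (rule L2_set_triangle_ineq)
  finally show ?thesis unfolding L2 .
qed

lemma weighted_sq_mono:
  assumes "M \<le> N"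
  shows "weighted_sq w M f \<le> weighted_sq w N f"
  unfolding weighted_sq_def by (rule sum_mono2) (use assms wpos in \<open>auto simp: less_imp_le\<close>)

lemma weighted_sq_le_infsum:
  assumes "f \<in> coeff_space w"
  shows "weighted_sq w M f \<le> (\<Sum>\<^sub>\<infinity>j\<in>{2..}. (cmod (f j))\<^sup>2 / w j)"
  unfolding weighted_sq_def using coeff_spaceD(3)[OF assms]
  by (rule finite_sum_le_infsum) (use wpos in \<open>auto simp: less_imp_le\<close>)

lemma weighted_sq_bounded_imp_coeff_space:
  assumes "\<And>j. j < 2 \<Longrightarrow> f j = 0" "\<And>M. weighted_sq w M f \<le> B"
  shows "f \<in> coeff_space w"
proof -
  have "(\<lambda>j. (cmod (f j))\<^sup>2 / w j) summable_on {2..}"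
  proof (rule nonneg_bdd_above_summable_on)
    have "(\<Sum>j\<in>F. (cmod (f j))\<^sup>2 / w j) \<le> B" if F: "F \<subseteq> {2..}" "finite F" for F
    proof -
      obtain M where M: "F \<subseteq> {..M}" using F(2) finite_nat_iff_bounded_le by blast
      have "(\<Sum>j\<in>F. (cmod (f j))\<^sup>2 / w j) \<le> weighted_sq w M f"
        unfolding weighted_sq_def by (rule sum_mono2) (use F M wpos in \<open>auto simp: less_imp_le\<close>)
      also have "\<dots> \<le> B" by (rule assms(2))
      finally show ?thesis .
    qed
    then show "bdd_above (sum (\<lambda>j. (cmod (f j))\<^sup>2 / w j) ` {F. F \<subseteq> {2..} \<and> finite F})"
      by (intro bdd_aboveI2[where M = B]) auto
  qed (use wpos in \<open>auto simp: less_imp_le\<close>)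
  with assms(1) show ?thesis by (simp add: coeff_space_def)
qed

lemma finite_support_in_coeff_space:
  assumes "\<And>j. j < 2 \<Longrightarrow> f j = 0" "\<And>j. j > N \<Longrightarrow> f j = 0"
  shows "f \<in> coeff_space w"
proof (rule weighted_sq_bounded_imp_coeff_space)
  fix M
  have "weighted_sq w M f \<le> weighted_sq w (max M N) f" by (rule weighted_sq_mono) simp
  also have "\<dots> = weighted_sq w N f"
    unfolding weighted_sq_def by (rule sum.mono_neutral_right) (use assms in auto)
  finally show "weighted_sq w M f \<le> weighted_sq w N f" .
qed (rule assms)

definition tail_bounded :: "(nat \<Rightarrow> complex) \<Rightarrow> nat \<Rightarrow> real \<Rightarrow> bool" where
  "tail_bounded a M C \<longleftrightarrow> (\<forall>M' f. (\<forall>j\<le>M. f j = 0) \<longrightarrow>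
     sqrt (weighted_sq w M' (dconv a f)) \<le> C * sqrt (weighted_sq w M' f))"

text \<open>
  Freeing one more coordinate adds an operator of rank one, which is bounded because the convolution
  maps the unit sequence at \<open>Suc M\<close> into the space.
\<close>

lemma tail_bounded_step:
  assumes maps: "\<And>f. f \<in> coeff_space w \<Longrightarrow> dconv a f \<in> coeff_space w"
    and M: "M \<ge> 1" and C: "tail_bounded a (Suc M) C"
  shows "\<exists>C'. tail_bounded a M C'"
proof -
  define e where "e j = (if j = Suc M then 1 else 0 :: complex)" for j
  have e: "e \<in> coeff_space w" unfolding e_def using M by (intro indicator_in_coeff_space) auto
  define D where "D = sqrt (\<Sum>\<^sub>\<infinity>j\<in>{2..}. (cmod (dconv a e j))\<^sup>2 / w j)"
  have D: "sqrt (weighted_sq w M' (dconv a e)) \<le> D" for M'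
    unfolding D_def by (intro real_sqrt_le_mono weighted_sq_le_infsum maps e)
  have D0: "D \<ge> 0" using D[of 0] weighted_sq_nonneg[of 0 "dconv a e"] by (meson order_trans real_sqrt_ge_zero)
  have "tail_bounded a M (sqrt (w (Suc M)) * D + \<bar>C\<bar>)"
    unfolding tail_bounded_def
  proof (intro allI impI)
    fix M' and f :: "nat \<Rightarrow> complex" assume f: "\<forall>j\<le>M. f j = 0"
    have wM: "w (Suc M) > 0" using M by (intro wpos) simp
    show "sqrt (weighted_sq w M' (dconv a f)) \<le> (sqrt (w (Suc M)) * D + \<bar>C\<bar>) * sqrt (weighted_sq w M' f)"
    proof (cases "M' \<le> M")
      case True
      then have "weighted_sq w M' (dconv a f) = 0"
        using f by (intro weighted_sq_zero dconv_zero[of M']) auto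
      then show ?thesis using D0 weighted_sq_nonneg[of M' f] wM by simp
    next
      case False
      define r where "r j = (if j = Suc M then 0 else f j)" for j
      have fr: "f = (\<lambda>j. f (Suc M) * e j + r j)" by (auto simp: e_def r_def)
      have rz: "r j = 0" if "j \<le> Suc M" for j using f that by (auto simp: r_def le_Suc_eq)
      have "sqrt (weighted_sq w M' (dconv a f)) \<le>
         sqrt (weighted_sq w M' (\<lambda>m. f (Suc M) * dconv a e m)) + sqrt (weighted_sq w M' (dconv a r))"
        by (subst fr) (simp only: dconv_add dconv_cmult weighted_sq_triangle)
      moreover have "sqrt (weighted_sq w M' (\<lambda>m. f (Suc M) * dconv a e m)) \<le> cmod (f (Suc M)) * D"
        unfolding weighted_sq_cmult using D[of M'] by (simp add: real_sqrt_mult mult_left_mono)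
      moreover have "cmod (f (Suc M)) \<le> sqrt (w (Suc M)) * sqrt (weighted_sq w M' f)"
      proof -
        have "(\<Sum>j\<in>{Suc M}. (cmod (f j))\<^sup>2 / w j) \<le> weighted_sq w M' f"
          unfolding weighted_sq_def by (rule sum_mono2) (use M False wpos in \<open>auto simp: less_imp_le\<close>)
        then have "(cmod (f (Suc M)))\<^sup>2 \<le> w (Suc M) * weighted_sq w M' f"
          using wM by (simp add: field_simps)
        then have "cmod (f (Suc M)) \<le> sqrt (w (Suc M) * weighted_sq w M' f)" by (rule real_le_rsqrt)
        then show ?thesis by (simp add: real_sqrt_mult)
      qed
      then have "cmod (f (Suc M)) * D \<le> sqrt (w (Suc M)) * sqrt (weighted_sq w M' f) * D"
        using D0 by (rule mult_right_mono)
      moreover have "sqrt (weighted_sq w M' (dconv a r)) \<le> \<bar>C\<bar> * sqrt (weighted_sq w M' f)"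
      proof -
        have "sqrt (weighted_sq w M' (dconv a r)) \<le> C * sqrt (weighted_sq w M' r)"
          using C rz unfolding tail_bounded_def by blast
        also have "\<dots> \<le> \<bar>C\<bar> * sqrt (weighted_sq w M' r)"
          by (intro mult_right_mono) (auto simp: weighted_sq_nonneg)
        also have "weighted_sq w M' r \<le> weighted_sq w M' f"
          unfolding weighted_sq_def by (rule sum_mono) (use wpos in \<open>auto simp: r_def less_imp_le\<close>)
        finally show ?thesis by (simp add: mult_left_mono)
      qed
      ultimately show ?thesis by (simp add: algebra_simps)
    qed
  qed
  then show ?thesis by blast
qed

text \<open>
  As the operator is unbounded on sequences beyond \<open>M\<close>, some hump \<open>h\<close> of norm \<open>e\<close>, supported beyond \<open>M\<close>,
  has an image so large that it cannot be cancelled by the image of \<open>g\<close>.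
\<close>

lemma gliding_hump_step:
  assumes maps: "\<And>f. f \<in> coeff_space w \<Longrightarrow> dconv a f \<in> coeff_space w"
    and unb: "\<not> (\<exists>C. tail_bounded a M C)" and M: "M \<ge> 1"
    and g: "\<And>j. j < 2 \<Longrightarrow> g j = 0" "\<And>j. j > M \<Longrightarrow> g j = 0" and e: "e > 0" and K: "K \<ge> 0"
  shows "\<exists>M' g'. M < M' \<and> (\<forall>j\<le>M. g' j = g j) \<and> (\<forall>j>M'. g' j = 0) \<and>
     weighted_sq w M' g' \<le> weighted_sq w M g + e\<^sup>2 \<and> sqrt (weighted_sq w M' (dconv a g')) \<ge> K"
proof -
  define G where "G = sqrt (\<Sum>\<^sub>\<infinity>j\<in>{2..}. (cmod (dconv a g j))\<^sup>2 / w j)"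
  have G: "sqrt (weighted_sq w M' (dconv a g)) \<le> G" for M'
    unfolding G_def by (intro real_sqrt_le_mono weighted_sq_le_infsum maps finite_support_in_coeff_space g)
  have G0: "G \<ge> 0" using G[of 0] weighted_sq_nonneg[of 0 "dconv a g"] by (meson order_trans real_sqrt_ge_zero)
  obtain M' f where f: "\<forall>j\<le>M. f j = 0"
    and big: "sqrt (weighted_sq w M' (dconv a f)) > (K + G) / e * sqrt (weighted_sq w M' f)"
    using unb unfolding tail_bounded_def by (meson not_le)
  have ge: "(K + G) / e * sqrt (weighted_sq w M' f) \<ge> 0"
    using K G0 e weighted_sq_nonneg[of M' f] by simp
  have nz: "\<not> (\<forall>j\<le>M'. f j = 0)"
  proof
    assume "\<forall>j\<le>M'. f j = 0"
    then have "weighted_sq w M' (dconv a f) = 0" by (intro weighted_sq_zero dconv_zero[of M']) auto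
    with big ge show False by simp
  qed
  have MM': "M < M'" using nz f by (meson not_le order_trans)
  define \<nu> where "\<nu> = sqrt (weighted_sq w M' f)"
  have \<nu>: "\<nu> > 0"
  proof -
    obtain j where j: "j \<le> M'" "f j \<noteq> 0" using nz by blast
    with f have "j > M" by (meson not_le)
    then have j2: "j \<ge> 2" using M by simp
    have "(\<Sum>i\<in>{j}. (cmod (f i))\<^sup>2 / w i) \<le> weighted_sq w M' f"
      unfolding weighted_sq_def by (rule sum_mono2) (use j j2 wpos in \<open>auto simp: less_imp_le\<close>)
    moreover have "(cmod (f j))\<^sup>2 / w j > 0" using j wpos[OF j2] by simp
    ultimately show ?thesis by (simp add: \<nu>_def)
  qed
  define c where "c = complex_of_real (e / \<nu>)"
  have c: "cmod c = e / \<nu>" using e \<nu> by (simp add: c_def norm_divide)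
  define h where "h j = (if j \<le> M' then c * f j else 0)" for j
  define g' where "g' j = g j + h j" for j
  have h: "weighted_sq w M' h = e\<^sup>2"
  proof -
    have "weighted_sq w M' h = weighted_sq w M' (\<lambda>j. c * f j)" by (rule weighted_sq_cong) (simp add: h_def)
    also have "\<dots> = (e / \<nu>)\<^sup>2 * \<nu>\<^sup>2" unfolding weighted_sq_cmult c by (simp add: \<nu>_def weighted_sq_nonneg)
    finally show ?thesis using \<nu> by (simp add: power_divide)
  qed
  have hT: "sqrt (weighted_sq w M' (dconv a h)) \<ge> K + G"
  proof -
    have "weighted_sq w M' (dconv a h) = weighted_sq w M' (dconv a (\<lambda>j. c * f j))"
      by (rule weighted_sq_cong, rule dconv_cong_le[of M']) (auto simp: h_def)
    then have "sqrt (weighted_sq w M' (dconv a h)) = e / \<nu> * sqrt (weighted_sq w M' (dconv a f))"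
      using e \<nu> by (simp add: dconv_cmult weighted_sq_cmult c real_sqrt_mult)
    also have "\<dots> \<ge> e / \<nu> * ((K + G) / e * \<nu>)"
      using big e \<nu> by (intro mult_left_mono) (auto simp: \<nu>_def)
    finally show ?thesis using e \<nu> by simp
  qed
  have "weighted_sq w M' g' = weighted_sq w M' g + weighted_sq w M' h"
    unfolding weighted_sq_def sum.distrib[symmetric]
  proof (rule sum.cong)
    fix j
    show "(cmod (g' j))\<^sup>2 / w j = (cmod (g j))\<^sup>2 / w j + (cmod (h j))\<^sup>2 / w j"
      using f g(2)[of j] by (cases "j \<le> M") (auto simp: g'_def h_def)
  qed simp
  also have "weighted_sq w M' g = weighted_sq w M g"
    unfolding weighted_sq_def by (rule sum.mono_neutral_right) (use MM' g in auto)
  finally have "weighted_sq w M' g' = weighted_sq w M g + e\<^sup>2" by (simp add: h)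
  moreover have "sqrt (weighted_sq w M' (dconv a g')) \<ge> K"
  proof -
    have "h = (\<lambda>j. g' j + (-1) * g j)" by (auto simp: g'_def)
    then have "dconv a h = (\<lambda>m. dconv a g' m + (-1) * dconv a g m)"
      by (metis dconv_add dconv_cmult)
    then have "sqrt (weighted_sq w M' (dconv a h)) \<le>
        sqrt (weighted_sq w M' (dconv a g')) + sqrt (weighted_sq w M' (\<lambda>m. (-1) * dconv a g m))"
      by (simp only: weighted_sq_triangle)
    then show ?thesis using hT G[of M'] unfolding weighted_sq_cmult by simp
  qed
  ultimately show ?thesis using MM' f g
    by (intro exI[of _ M'] exI[of _ g']) (auto simp: g'_def h_def)
qed

text \<open>
  If the operator were unbounded, then by \<open>tail_bounded_step\<close> it would be unbounded on every tail.
  Adding humps of norms \<open>2\<^sup>-\<^sup>n\<close> with disjoint supports builds a sequence \<open>F\<close> in the space. By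
  triangularity, the coordinates of its image up to \<open>N (Suc n)\<close> depend only on the humps constructed
  up to then, so the norm of the image is at least \<open>n\<close> for every \<open>n\<close>, a contradiction.
\<close>

lemma dconv_maps_imp_bounded:
  assumes maps: "\<And>f. f \<in> coeff_space w \<Longrightarrow> dconv a f \<in> coeff_space w"
  shows "\<exists>C. dconv_bounded w a C"
proof (rule ccontr)
  assume contra: "\<not> (\<exists>C. dconv_bounded w a C)"
  have unb1: "\<not> (\<exists>C. tail_bounded a 1 C)"
  proof
    assume "\<exists>C. tail_bounded a 1 C"
    then obtain C where C: "tail_bounded a 1 C" by blast
    have "dconv_bounded w a \<bar>C\<bar>"
      unfolding dconv_bounded_def
    proof (intro conjI allI impI)
      fix M and f :: "nat \<Rightarrow> complex" assume f1: "f 1 = 0"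
      define f' where "f' j = (if j = 0 then 0 else f j)" for j
      have "sqrt (weighted_sq w M (dconv a f')) \<le> C * sqrt (weighted_sq w M f')"
      proof -
        have "f' j = 0" if "j \<le> 1" for j using f1 that by (cases "j = 0") (auto simp: f'_def le_Suc_eq)
        then show ?thesis using C unfolding tail_bounded_def by blast
      qed
      then have "(sqrt (weighted_sq w M (dconv a f')))\<^sup>2 \<le> (C * sqrt (weighted_sq w M f'))\<^sup>2"
        by (rule power_mono) (simp add: weighted_sq_nonneg)
      then have "weighted_sq w M (dconv a f') \<le> C\<^sup>2 * weighted_sq w M f'"
        by (simp add: power_mult_distrib weighted_sq_nonneg)
      moreover have "weighted_sq w M f' = weighted_sq w M f"
        unfolding weighted_sq_def f'_def by (rule sum.cong) auto
      moreover have "weighted_sq w M (dconv a f') = weighted_sq w M (dconv a f)"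
        unfolding weighted_sq_def
      proof (rule sum.cong)
        fix m assume "m \<in> {2..M}"
        then have "dconv a f' m = dconv a f m" by (intro dconv_cong) (auto simp: f'_def)
        then show "(cmod (dconv a f' m))\<^sup>2 / w m = (cmod (dconv a f m))\<^sup>2 / w m" by simp
      qed simp
      ultimately show "weighted_sq w M (dconv a f) \<le> \<bar>C\<bar>\<^sup>2 * weighted_sq w M f" by simp
    qed simp
    with contra show False by blast
  qed
  have unb: "\<not> (\<exists>C. tail_bounded a M C)" if "M \<ge> 1" for M
    using that
  proof (induction M rule: nat_induct_at_least)
    case base
    show ?case by (rule unb1)
  next
    case (Suc M)
    then show ?case using tail_bounded_step[OF maps, of M] by blast
  qed
  define P where "P n S \<longleftrightarrow> (case S of (M, g) \<Rightarrow> M \<ge> 1 \<and> (\<forall>j<2. g j = 0) \<and> (\<forall>j>M. g j = 0) \<and> (n = 0 \<longrightarrow> g = (\<lambda>_. 0)))"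
    for n :: nat and S :: "nat \<times> (nat \<Rightarrow> complex)"
  define Q where "Q n S S' \<longleftrightarrow> (case S of (M, g) \<Rightarrow> case S' of (M', g') \<Rightarrow> M < M' \<and> (\<forall>j\<le>M. g' j = g j) \<and>
     weighted_sq w M' g' \<le> weighted_sq w M g + ((1/2) ^ n)\<^sup>2 \<and> sqrt (weighted_sq w M' (dconv a g')) \<ge> real n)"
    for n :: nat and S S' :: "nat \<times> (nat \<Rightarrow> complex)"
  have "\<exists>\<sigma>. \<forall>n. P n (\<sigma> n) \<and> Q n (\<sigma> n) (\<sigma> (Suc n))"
  proof (rule dependent_nat_choice)
    show "\<exists>S. P 0 S" by (auto simp: P_def)
    fix S n assume "P n S"
    then obtain M g where S: "S = (M, g)" "M \<ge> 1" "\<And>j. j < 2 \<Longrightarrow> g j = 0" "\<And>j. j > M \<Longrightarrow> g j = 0"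
      by (auto simp: P_def)
    from gliding_hump_step[where g = g and M = M and e = "(1/2) ^ n" and K = "real n", OF maps unb[OF S(2)] S(2) S(3) S(4)]
    obtain M' g' where "M < M'" "\<forall>j\<le>M. g' j = g j" "\<forall>j>M'. g' j = 0"
      "weighted_sq w M' g' \<le> weighted_sq w M g + ((1/2) ^ n)\<^sup>2" "sqrt (weighted_sq w M' (dconv a g')) \<ge> real n"
      by auto
    then have "P (Suc n) (M', g') \<and> Q n S (M', g')"
      using S by (auto simp: P_def Q_def)
    then show "\<exists>S'. P (Suc n) S' \<and> Q n S S'" by blast
  qed
  then obtain \<sigma> where \<sigma>: "\<And>n. P n (\<sigma> n)" "\<And>n. Q n (\<sigma> n) (\<sigma> (Suc n))" by blast
  define N where "N n = fst (\<sigma> n)" for n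
  define g where "g n = snd (\<sigma> n)" for n
  have g: "g n j = 0" if "j < 2" for n j using \<sigma>(1)[of n] that by (auto simp: P_def g_def split: prod.splits)
  have g0: "g 0 = (\<lambda>_. 0)" using \<sigma>(1)[of 0] by (auto simp: P_def g_def split: prod.splits)
  have step: "N n < N (Suc n)" "\<And>j. j \<le> N n \<Longrightarrow> g (Suc n) j = g n j"
    "weighted_sq w (N (Suc n)) (g (Suc n)) \<le> weighted_sq w (N n) (g n) + ((1/2) ^ n)\<^sup>2"
    "sqrt (weighted_sq w (N (Suc n)) (dconv a (g (Suc n)))) \<ge> real n" for n
    using \<sigma>(2)[of n] by (auto simp: Q_def g_def N_def split: prod.splits)
  have "strict_mono N" using step(1) by (simp add: strict_mono_Suc_iff)
  then have Nle: "n \<le> N n" for n by (rule strict_mono_imp_increasing)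
  have Nmono: "N n \<le> N m" if "n \<le> m" for n m
    using \<open>strict_mono N\<close> that by (simp add: strict_mono_less_eq)
  have stable: "g m j = g n j" if "n \<le> m" "j \<le> N n" for n m j
    using that(1)
  proof (induction m rule: dec_induct)
    case (step m)
    then show ?case using \<open>\<And>n j. j \<le> N n \<Longrightarrow> g (Suc n) j = g n j\<close>[of j m] Nmono[of n m] that(2) by simp
  qed simp
  \<comment> \<open>The diagonal sequence is the limit, because \<open>j \<le> N j\<close> and \<open>g n\<close> does not change any more
    on \<open>{..N n}\<close> after stage \<open>n\<close>.\<close>
  define F where "F j = g j j" for j
  have F: "F j = g n j" if "j \<le> N n" for n j
    using stable[of j n j] stable[of n j j] that Nle[of j] unfolding F_def by (metis nle_le)
  have gb: "weighted_sq w (N n) (g n) \<le> 2 - (1/2) ^ n * 2" for n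
  proof (induction n)
    case 0
    show ?case by (simp add: g0 weighted_sq_def)
  next
    case (Suc n)
    have "((1/2) ^ n)\<^sup>2 \<le> ((1/2) ^ n :: real)" by (simp add: power2_eq_square mult_left_le power_le_one)
    with Suc step(3)[of n] show ?case by simp
  qed
  have "F \<in> coeff_space w"
  proof (rule weighted_sq_bounded_imp_coeff_space)
    show "F j = 0" if "j < 2" for j using g[OF that] by (simp add: F_def)
    show "weighted_sq w M F \<le> 2" for M
    proof -
      have "weighted_sq w M F \<le> weighted_sq w (N M) F" using Nle by (rule weighted_sq_mono)
      also have "\<dots> = weighted_sq w (N M) (g M)" by (rule weighted_sq_cong) (rule F)
      also have "\<dots> \<le> 2 - (1/2) ^ M * 2" by (rule gb)
      also have "\<dots> \<le> 2" by simp
      finally show ?thesis .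
    qed
  qed
  then have TF: "dconv a F \<in> coeff_space w" by (rule maps)
  define S where "S = sqrt (\<Sum>\<^sub>\<infinity>j\<in>{2..}. (cmod (dconv a F j))\<^sup>2 / w j)"
  have "real n \<le> S" for n
  proof -
    have "real n \<le> sqrt (weighted_sq w (N (Suc n)) (dconv a (g (Suc n))))" by (rule step(4))
    also have "weighted_sq w (N (Suc n)) (dconv a (g (Suc n))) = weighted_sq w (N (Suc n)) (dconv a F)"
      by (rule weighted_sq_cong, rule dconv_cong_le[of "N (Suc n)"]) (auto simp: F)
    also have "sqrt \<dots> \<le> S"
      unfolding S_def by (intro real_sqrt_le_mono weighted_sq_le_infsum TF)
    finally show ?thesis .
  qed
  moreover obtain n where "S < real n" using reals_Archimedean2 by blast
  ultimately show False by (meson not_le)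
qed

end

section \<open>The weighted Hilbert space and its multipliers\<close>

lemma of_real_summable_imp_real_summable:
  assumes w: "\<And>j. j \<in> A \<Longrightarrow> w j > 0" and s: "Re s \<le> x"
    and summ: "(\<lambda>j. complex_of_real (w j) * of_nat j powr (- s)) summable_on A"
  shows "(\<lambda>j. w j * real j powr (- x)) summable_on A"
proof -
  have "dirichlet_term (\<lambda>j. of_real (w j)) s summable_on A"
    using summ by (simp add: dirichlet_term_def[abs_def])
  then have "dirichlet_term (\<lambda>j. of_real (w j)) (of_real x) summable_on A"
    by (rule dirichlet_summable_mono) (use s in simp)
  then have "(\<lambda>j. norm (dirichlet_term (\<lambda>j. of_real (w j)) (of_real x) j)) summable_on A"
    using summable_on_iff_abs_summable_on_complex by blast
  then show ?thesis
    by (rule summable_on_cong[THEN iffD1, rotated]) (use w in \<open>simp add: norm_dirichlet_term less_imp_le\<close>)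
qed

lemma half_plane_identity:
  assumes "f holomorphic_on {s. Re s > \<alpha>}" "g holomorphic_on {s. Re s > \<alpha>}"
    and "\<And>s. Re s > \<rho> \<Longrightarrow> f s = g s" and "Re s > \<alpha>"
  shows "f s = g s"
proof -
  have ne: "{s. Re s > max \<alpha> \<rho>} \<noteq> {}"
    by (metis Re_complex_of_real empty_iff lt_ex gt_ex mem_Collect_eq)
  have "f s - g s = 0"
  proof (rule analytic_continuation_open[OF _ _ ne, where s' = "{s. Re s > \<alpha>}" and f = "\<lambda>s. f s - g s" and g = "\<lambda>s. 0"])
    show "connected {s. Re s > \<alpha>}" by (intro convex_connected convex_halfspace_Re_gt)
    show "open {s. Re s > max \<alpha> \<rho>}" by (rule open_halfspace_Re_gt)
  qed (use assms in \<open>auto intro!: holomorphic_intros simp: open_halfspace_Re_gt\<close>)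
  then show ?thesis by simp
qed

text \<open>
  The identity theorem makes restriction injective on holomorphic extensional functions. It also
  shows that the inverse of restriction preserves the operations: both sides of each equation are
  holomorphic on \<open>Y\<close> and agree on \<open>X\<close>. Hence only the algebra on the smaller set has to be
  known to be closed under the operations.
\<close>

lemma isometrically_isomorphic_by_restriction:
  assumes "\<alpha> \<le> \<beta>" and X: "X = {s. Re s > \<beta>}" and Y: "Y = {s. Re s > \<alpha>}"
    and B: "\<And>\<psi>. \<psi> \<in> B \<Longrightarrow> \<psi> \<in> extensional Y" "\<And>\<psi>. \<psi> \<in> B \<Longrightarrow> \<psi> holomorphic_on Y"
    and onto: "(\<lambda>\<psi>. restrict \<psi> X) ` B = A"
    and norm: "\<And>\<psi>. \<psi> \<in> B \<Longrightarrow> N (restrict \<psi> X) = N' \<psi>"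
    and A_add: "\<And>f g. f \<in> A \<Longrightarrow> g \<in> A \<Longrightarrow> pointwise_add X f g \<in> A"
    and A_scale: "\<And>c f. f \<in> A \<Longrightarrow> pointwise_scale X c f \<in> A"
    and A_mult: "\<And>f g. f \<in> A \<Longrightarrow> g \<in> A \<Longrightarrow> pointwise_mult X f g \<in> A"
  shows "isometrically_isomorphic X A N Y B N'"
proof -
  let ?R = "\<lambda>\<psi>. restrict \<psi> X"
  have XY: "s \<in> Y" if "s \<in> X" for s using that assms(1) by (simp add: X Y)
  have unique: "f = g" if "f \<in> extensional Y" "f holomorphic_on Y" "g \<in> extensional Y" "g holomorphic_on Y"
    "\<And>s. s \<in> X \<Longrightarrow> f s = g s" for f g
  proof (rule extensionalityI[OF that(1) that(3)])
    fix s assume "s \<in> Y"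
    then show "f s = g s"
      using half_plane_identity[of f \<alpha> g \<beta> s] that by (simp add: X Y)
  qed
  have inj: "inj_on ?R B"
  proof (rule inj_onI)
    fix f g assume fg: "f \<in> B" "g \<in> B" "?R f = ?R g"
    have "f s = g s" if "s \<in> X" for s using fun_cong[OF fg(3), of s] that by simp
    then show "f = g" using fg B by (intro unique) auto
  qed
  define \<Phi> where "\<Phi> = inv_into B ?R"
  have bij: "bij_betw \<Phi> A B"
    unfolding \<Phi>_def by (rule bij_betw_inv_into) (use inj onto in \<open>simp add: bij_betw_def\<close>)
  have \<Phi>: "\<Phi> f \<in> B" "?R (\<Phi> f) = f" if "f \<in> A" for f
    using that onto unfolding \<Phi>_def by (auto intro: inv_into_into f_inv_into_f[of _ ?R])
  have \<Phi>_on: "\<Phi> f s = f s" if "f \<in> A" "s \<in> X" for f s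
    using \<Phi>(2)[OF that(1)] that(2) by (metis restrict_apply')
  have eq: "\<Phi> h = k" if "h \<in> A" "k \<in> extensional Y" "k holomorphic_on Y" "\<And>s. s \<in> X \<Longrightarrow> k s = h s" for h k
    using that \<Phi>(1)[OF that(1)] B by (intro unique) (auto simp: \<Phi>_on)
  have hol: "restrict k Y holomorphic_on Y" if "k holomorphic_on Y" for k
    using that by (rule holomorphic_transform) simp
  show ?thesis
    unfolding isometrically_isomorphic_def
  proof (intro exI[of _ \<Phi>] conjI ballI allI bij)
    fix f g assume f: "f \<in> A" and g: "g \<in> A"
    note [holomorphic_intros] = B(2)[OF \<Phi>(1)[OF f]] B(2)[OF \<Phi>(1)[OF g]]
    show "\<Phi> (pointwise_add X f g) = pointwise_add Y (\<Phi> f) (\<Phi> g)"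
      by (rule eq[OF A_add[OF f g]])
        (auto simp: pointwise_add_def XY \<Phi>_on f g intro!: hol holomorphic_intros)
    show "\<Phi> (pointwise_mult X f g) = pointwise_mult Y (\<Phi> f) (\<Phi> g)"
      by (rule eq[OF A_mult[OF f g]])
        (auto simp: pointwise_mult_def XY \<Phi>_on f g intro!: hol holomorphic_intros)
  next
    fix c f assume f: "f \<in> A"
    note [holomorphic_intros] = B(2)[OF \<Phi>(1)[OF f]]
    show "\<Phi> (pointwise_scale X c f) = pointwise_scale Y c (\<Phi> f)"
      by (rule eq[OF A_scale[OF f]])
        (auto simp: pointwise_scale_def XY \<Phi>_on f intro!: hol holomorphic_intros)
  next
    fix f assume f: "f \<in> A"
    show "N' (\<Phi> f) = N f" using norm[OF \<Phi>(1)[OF f]] \<Phi>(2)[OF f] by simp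
  qed
qed

lemma dirichlet_sums_Suc_iff:
  "(\<lambda>j. a (Suc j) * of_nat (Suc j) powr (- s)) sums S \<longleftrightarrow> dirichlet_term a s sums S"
proof -
  have "(\<lambda>j. dirichlet_term a s (Suc j)) sums S \<longleftrightarrow> dirichlet_term a s sums (S + dirichlet_term a s 0)"
    by (rule sums_Suc_iff)
  then show ?thesis by (simp add: dirichlet_term_def)
qed

text \<open>
  Where the series converges, its terms are bounded; two units further to the right they are
  dominated by a multiple of \<open>k\<^sup>-\<^sup>2\<close>.
\<close>

lemma dirichlet_sums_imp_absolute:
  assumes conv: "\<And>s. Re s > \<rho> \<Longrightarrow> dirichlet_term a s sums f s" and s: "Re s \<ge> \<rho> + 3"
  shows "dirichlet_term a s summable_on UNIV" "dirichlet_sum a s = f s"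
proof -
  let ?s0 = "complex_of_real (\<rho> + 1)"
  have "dirichlet_term a ?s0 \<longlonglongrightarrow> 0"
    using conv[of ?s0] by (intro summable_LIMSEQ_zero) (auto intro: sums_summable)
  then have "Bseq (dirichlet_term a ?s0)"
    by (intro convergent_imp_Bseq) (auto simp: convergent_def)
  then obtain B where B: "B > 0" "\<And>k. norm (dirichlet_term a ?s0 k) \<le> B" by (auto simp: Bseq_def)
  have le: "norm (dirichlet_term a s k) \<le> B * real k powr (-2)" for k
  proof (cases "k = 0")
    case False
    have "norm (dirichlet_term a s k) \<le> norm (a k) * real k powr (- (\<rho> + 3))"
      unfolding norm_dirichlet_term using s False by (intro mult_left_mono powr_mono) auto
    also have "real k powr (- (\<rho> + 3)) = real k powr (- (\<rho> + 1)) * real k powr (-2)"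
      by (simp add: algebra_simps flip: powr_add)
    also have "norm (a k) * \<dots> = norm (dirichlet_term a ?s0 k) * real k powr (-2)"
      unfolding norm_dirichlet_term by simp
    also have "\<dots> \<le> B * real k powr (-2)" by (intro mult_right_mono B) simp
    finally show ?thesis .
  qed simp
  have "summable (\<lambda>k. B * real k powr (-2))"
    by (intro summable_mult) (simp add: summable_real_powr_iff)
  then have "summable (\<lambda>k. norm (dirichlet_term a s k))"
    by (rule summable_comparison_test'[of _ 0]) (simp add: le)
  then show *: "dirichlet_term a s summable_on UNIV" by (rule norm_summable_imp_summable_on)
  have "dirichlet_term a s sums dirichlet_sum a s"
    by (rule has_sum_imp_sums[OF has_sum_dirichlet_sum[OF *]])
  then show "dirichlet_sum a s = f s"
    using conv[of s] s sums_unique2 by fastforce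
qed

lemma multipliers_mult:
  assumes "\<phi> \<in> multipliers w" "\<psi> \<in> multipliers w"
  shows "pointwise_mult (Hw_dom w) \<phi> \<psi> \<in> multipliers w"
proof -
  have "pointwise_mult (Hw_dom w) (pointwise_mult (Hw_dom w) \<phi> \<psi>) f =
      pointwise_mult (Hw_dom w) \<phi> (pointwise_mult (Hw_dom w) \<psi> f)" for f
    by (auto simp: pointwise_mult_def restrict_def)
  then show ?thesis using assms by (auto simp: multipliers_def) (simp add: pointwise_mult_def)
qed

definition Hw_function :: "(nat \<Rightarrow> real) \<Rightarrow> (nat \<Rightarrow> complex) \<Rightarrow> complex \<Rightarrow> complex" where
  "Hw_function w a = restrict (dirichlet_sum a) (Hw_dom w)"

definition coeff_norm :: "(nat \<Rightarrow> real) \<Rightarrow> (nat \<Rightarrow> complex) \<Rightarrow> real" where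
  "coeff_norm w a = sqrt (\<Sum>\<^sub>\<infinity>j\<in>{2..}. (cmod (a j))\<^sup>2 / w j)"

context
  fixes w :: "nat \<Rightarrow> real" and \<beta> :: real
  assumes wpos: "\<And>j. j \<ge> 2 \<Longrightarrow> w j > 0"
    and dom: "Hw_dom w = {s. Re s > \<beta>}"
    and wsum: "\<And>x. x > 2 * \<beta> \<Longrightarrow> (\<lambda>j. w j * real j powr (- x)) summable_on {2..}"
begin

lemma coeff_space_has_sum:
  assumes f: "f \<in> coeff_space w" and s: "Re s > \<beta>"
  shows "dirichlet_term f s summable_on {2..}" "dirichlet_term f s summable_on UNIV"
    "infsum (dirichlet_term f s) {2..} = dirichlet_sum f s"
proof -
  show *: "dirichlet_term f s summable_on {2..}"
    by (rule weighted_Cauchy_Schwarz(1)[OF _ coeff_spaceD(3)[OF f]])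
      (use wpos wsum[of "2 * Re s"] s in auto)
  have z: "dirichlet_term f s j = 0" if "\<not> 2 \<le> j" for j
    using f that by (simp add: coeff_space_def dirichlet_term_def)
  show "dirichlet_term f s summable_on UNIV"
    by (rule summable_on_cong_neutral[THEN iffD1, OF _ _ _ *]) (auto simp: z)
  show "infsum (dirichlet_term f s) {2..} = dirichlet_sum f s"
    unfolding dirichlet_sum_def by (rule infsum_cong_neutral) (auto simp: z)
qed

lemma Hw_repr_iff:
  "Hw_repr w a f \<longleftrightarrow> a \<in> coeff_space w \<and> (\<forall>s\<in>Hw_dom w. f s = dirichlet_sum a s)"
proof
  assume r: "Hw_repr w a f"
  then have a: "a \<in> coeff_space w" by (simp add: Hw_repr_def coeff_space_def)
  have "f s = dirichlet_sum a s" if "s \<in> Hw_dom w" for s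
  proof -
    have "(dirichlet_term a s has_sum f s) {2..}"
      using r that by (simp add: Hw_repr_def dirichlet_term_def[abs_def])
    then show ?thesis using infsumI coeff_space_has_sum(3)[OF a, of s] that dom by force
  qed
  with a show "a \<in> coeff_space w \<and> (\<forall>s\<in>Hw_dom w. f s = dirichlet_sum a s)" by blast
next
  assume r: "a \<in> coeff_space w \<and> (\<forall>s\<in>Hw_dom w. f s = dirichlet_sum a s)"
  then have a: "a \<in> coeff_space w" ..
  have "(dirichlet_term a s has_sum f s) {2..}" if "s \<in> Hw_dom w" for s
    using has_sum_infsum[OF coeff_space_has_sum(1)[OF a, of s]] coeff_space_has_sum(3)[OF a, of s] r that dom
    by simp
  then show "Hw_repr w a f"
    using a by (simp add: Hw_repr_def coeff_space_def dirichlet_term_def[abs_def])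
qed

lemma Hw_repr_unique:
  assumes "Hw_repr w a f" "Hw_repr w b f"
  shows "a = b"
proof
  fix n
  have ab: "a \<in> coeff_space w" "b \<in> coeff_space w" using assms by (auto simp: Hw_repr_iff)
  show "a n = b n"
  proof (cases "n < 2")
    case True
    then show ?thesis using ab by (simp add: coeff_space_def)
  next
    case False
    show ?thesis
    proof (rule dirichlet_coefficients_unique[of a "\<beta> + 1" b])
      show "dirichlet_sum a (Complex (\<beta> + 1) t) = dirichlet_sum b (Complex (\<beta> + 1) t)" for t
        using assms dom unfolding Hw_repr_iff by (metis complex.sel(1) less_add_one mem_Collect_eq)
    qed (use ab False in \<open>auto intro!: coeff_space_has_sum(2)\<close>)
  qed
qed

lemma Hw_repr_Hw_function: "a \<in> coeff_space w \<Longrightarrow> Hw_repr w a (Hw_function w a)"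
  by (simp add: Hw_repr_iff Hw_function_def)

lemma Hw_eq: "Hw w = Hw_function w ` coeff_space w"
proof
  show "Hw w \<subseteq> Hw_function w ` coeff_space w"
  proof
    fix f assume "f \<in> Hw w"
    then obtain a where a: "f \<in> extensional (Hw_dom w)" "a \<in> coeff_space w"
      "\<forall>s\<in>Hw_dom w. f s = dirichlet_sum a s"
      by (auto simp: Hw_def Hw_repr_iff)
    then have "f = Hw_function w a"
      by (auto simp: Hw_function_def restrict_def extensional_def)
    with a show "f \<in> Hw_function w ` coeff_space w" by blast
  qed
qed (auto simp: Hw_def Hw_function_def intro!: exI Hw_repr_Hw_function[unfolded Hw_function_def])

lemma Hw_function_in_Hw_iff:
  assumes "\<And>s. Re s > \<beta> \<Longrightarrow> dirichlet_term a s summable_on UNIV" "a 0 = 0"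
  shows "Hw_function w a \<in> Hw w \<longleftrightarrow> a \<in> coeff_space w"
proof
  assume "Hw_function w a \<in> Hw w"
  then obtain b where b: "b \<in> coeff_space w" "Hw_function w a = Hw_function w b"
    unfolding Hw_eq by blast
  have "a n = b n" for n
  proof (cases "n = 0")
    case True
    then show ?thesis using b assms by (simp add: coeff_space_def)
  next
    case False
    show ?thesis
    proof (rule dirichlet_coefficients_unique[of a "\<beta> + 1" b])
      show "dirichlet_sum a (Complex (\<beta> + 1) t) = dirichlet_sum b (Complex (\<beta> + 1) t)" for t
        using fun_cong[OF b(2), of "Complex (\<beta> + 1) t"] dom by (simp add: Hw_function_def)
    qed (use False assms b in \<open>auto intro!: coeff_space_has_sum(2)\<close>)
  qed
  then have "a = b" by auto
  with b show "a \<in> coeff_space w" by simp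
qed (auto simp: Hw_eq)

lemma Hw_norm_Hw_function:
  assumes "a \<in> coeff_space w"
  shows "Hw_norm w (Hw_function w a) = coeff_norm w a"
proof -
  have "Hw_coeff w (Hw_function w a) = a"
    unfolding Hw_coeff_def
    using Hw_repr_Hw_function[OF assms] Hw_repr_unique by (intro the_equality) blast+
  then show ?thesis by (simp add: Hw_norm_def coeff_norm_def)
qed

lemma Hw_function_mult:
  assumes "\<And>s. Re s > \<beta> \<Longrightarrow> dirichlet_term a s summable_on UNIV"
    and "\<And>s. Re s > \<beta> \<Longrightarrow> dirichlet_term f s summable_on UNIV"
  shows "pointwise_mult (Hw_dom w) (Hw_function w a) (Hw_function w f) = Hw_function w (dconv a f)"
    and "\<And>s. Re s > \<beta> \<Longrightarrow> dirichlet_term (dconv a f) s summable_on UNIV"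
proof -
  have *: "(dirichlet_term (dconv a f) s has_sum dirichlet_sum a s * dirichlet_sum f s) UNIV" if "Re s > \<beta>" for s
    using that assms by (intro has_sum_dirichlet_product has_sum_dirichlet_sum)
  then have "dirichlet_sum (dconv a f) s = dirichlet_sum a s * dirichlet_sum f s" if "Re s > \<beta>" for s
    using that unfolding dirichlet_sum_def[of "dconv a f"] by (blast intro: infsumI)
  then show "pointwise_mult (Hw_dom w) (Hw_function w a) (Hw_function w f) = Hw_function w (dconv a f)"
    by (auto simp: pointwise_mult_def Hw_function_def dom restrict_def)
  show "\<And>s. Re s > \<beta> \<Longrightarrow> dirichlet_term (dconv a f) s summable_on UNIV"
    using * has_sum_imp_summable by blast
qed

lemma bounded_coefficients_summable:
  assumes "dconv_bounded w a C" "Re s > \<beta>"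
  shows "dirichlet_term a s summable_on UNIV"
proof (rule coefficients_summable_on_closed_set[OF wpos])
  show "dconv a (\<lambda>j. if j = 2 then 1 else 0) \<in> coeff_space w"
    by (intro dconv_bounded_infsum[OF wpos assms(1)] indicator_in_coeff_space) auto
qed (use wsum[of "2 * Re s"] assms in auto)

lemma multiplier_of_bounded:
  assumes bdd: "dconv_bounded w a C"
  shows "Hw_function w a \<in> multipliers w" "multiplier_norm w (Hw_function w a) \<le> ereal C"
    and multiplier_norm_ge: "\<And>f. f \<in> coeff_space w \<Longrightarrow> coeff_norm w f \<le> 1 \<Longrightarrow>
      ereal (coeff_norm w (dconv a f)) \<le> multiplier_norm w (Hw_function w a)"
proof -
  have C: "C \<ge> 0" using bdd by (simp add: dconv_bounded_def)
  have mult: "pointwise_mult (Hw_dom w) (Hw_function w a) (Hw_function w f) = Hw_function w (dconv a f)"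
    "dconv a f \<in> coeff_space w" if "f \<in> coeff_space w" for f
    using Hw_function_mult(1)[OF bounded_coefficients_summable[OF bdd] coeff_space_has_sum(2)[OF that]]
      dconv_bounded_infsum(1)[OF wpos bdd that] by auto
  have norm: "Hw_norm w (pointwise_mult (Hw_dom w) (Hw_function w a) (Hw_function w f)) = coeff_norm w (dconv a f)"
    if "f \<in> coeff_space w" for f
    using mult[OF that] by (simp add: Hw_norm_Hw_function)
  show "Hw_function w a \<in> multipliers w"
    unfolding multipliers_def using mult by (auto simp: Hw_eq) (simp add: Hw_function_def)
  have le: "coeff_norm w (dconv a f) \<le> C * coeff_norm w f" if "f \<in> coeff_space w" for f
  proof -
    have "coeff_norm w (dconv a f) \<le> sqrt (C\<^sup>2 * (\<Sum>\<^sub>\<infinity>j\<in>{2..}. (cmod (f j))\<^sup>2 / w j))"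
      unfolding coeff_norm_def by (intro real_sqrt_le_mono dconv_bounded_infsum(2)[OF wpos bdd that])
    then show ?thesis using C by (simp add: real_sqrt_mult coeff_norm_def)
  qed
  show "multiplier_norm w (Hw_function w a) \<le> ereal C"
    unfolding multiplier_norm_def
  proof (rule SUP_least)
    fix F assume "F \<in> {f \<in> Hw w. Hw_norm w f \<le> 1}"
    then obtain f where f: "f \<in> coeff_space w" "F = Hw_function w f" "coeff_norm w f \<le> 1"
      by (auto simp: Hw_eq Hw_norm_Hw_function)
    have "coeff_norm w (dconv a f) \<le> C"
      using le[OF f(1)] mult_left_mono[OF f(3) C] by simp
    then show "ereal (Hw_norm w (pointwise_mult (Hw_dom w) (Hw_function w a) F)) \<le> ereal C"
      using f norm by simp
  qed
  show "ereal (coeff_norm w (dconv a f)) \<le> multiplier_norm w (Hw_function w a)"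
    if "f \<in> coeff_space w" "coeff_norm w f \<le> 1" for f
    unfolding multiplier_norm_def norm[OF that(1), symmetric]
    by (rule SUP_upper) (use that in \<open>auto simp: Hw_eq Hw_norm_Hw_function\<close>)
qed

text \<open>
  The multiplier norm is a supremum over the unit ball of the space; truncating and normalising an
  arbitrary sequence brings it into this ball.
\<close>

lemma bounded_by_multiplier_norm:
  assumes bdd: "dconv_bounded w a C"
  obtains N where "multiplier_norm w (Hw_function w a) = ereal N" "dconv_bounded w a N"
proof -
  have zero: "coeff_norm w (\<lambda>_. 0) = 0" "(\<lambda>_. 0) \<in> coeff_space w"
    by (auto simp: coeff_norm_def coeff_space_def)
  have "dconv a (\<lambda>_. 0) = (\<lambda>_. 0)" by (auto simp: dconv_def)
  then have "0 \<le> multiplier_norm w (Hw_function w a)"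
    using multiplier_norm_ge[OF bdd zero(2)] zero by (simp add: zero_ereal_def)
  moreover have "multiplier_norm w (Hw_function w a) \<le> ereal C" by (rule multiplier_of_bounded(2)[OF bdd])
  ultimately obtain N where N: "multiplier_norm w (Hw_function w a) = ereal N" "N \<ge> 0"
    by (cases "multiplier_norm w (Hw_function w a)") auto
  have "dconv_bounded w a N"
    unfolding dconv_bounded_def
  proof (intro conjI allI impI N(2))
    fix M and f :: "nat \<Rightarrow> complex" assume f1: "f 1 = 0"
    define g where "g j = (if 2 \<le> j \<and> j \<le> M then f j else 0)" for j
    have g: "g \<in> coeff_space w" by (rule finite_support_in_coeff_space[where N = M, OF wpos]) (auto simp: g_def)
    have fg: "weighted_sq w M (dconv a f) = weighted_sq w M (dconv a g)"
      unfolding weighted_sq_def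
    proof (rule sum.cong)
      fix m assume m: "m \<in> {2..M}"
      have "f d = g d" if "d dvd m" for d
      proof -
        have "d \<le> M" "d \<noteq> 0" using m that by (auto dest: dvd_imp_le intro: Nat.gr0I)
        then show ?thesis using f1 by (cases "d = 1") (auto simp: g_def)
      qed
      then have "dconv a f m = dconv a g m" by (rule dconv_cong)
      then show "(cmod (dconv a f m))\<^sup>2 / w m = (cmod (dconv a g m))\<^sup>2 / w m" by simp
    qed simp
    have gn: "(\<Sum>\<^sub>\<infinity>j\<in>{2..}. (cmod (g j))\<^sup>2 / w j) = weighted_sq w M f"
    proof -
      have "(\<Sum>\<^sub>\<infinity>j\<in>{2..}. (cmod (g j))\<^sup>2 / w j) = (\<Sum>\<^sub>\<infinity>j\<in>{2..M}. (cmod (f j))\<^sup>2 / w j)"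
        by (rule infsum_cong_neutral) (auto simp: g_def)
      then show ?thesis by (simp add: weighted_sq_def)
    qed
    define \<nu> where "\<nu> = coeff_norm w g"
    have \<nu>2: "\<nu>\<^sup>2 = weighted_sq w M f"
      unfolding \<nu>_def coeff_norm_def gn using weighted_sq_nonneg[OF wpos] by simp
    show "weighted_sq w M (dconv a f) \<le> N\<^sup>2 * weighted_sq w M f"
    proof (cases "\<nu> = 0")
      case True
      then have "weighted_sq w M f = 0" using \<nu>2 by simp
      then have "weighted_sq w M (dconv a f) \<le> 0"
        using bdd f1 unfolding dconv_bounded_def by (metis mult_zero_right)
      then show ?thesis using \<open>weighted_sq w M f = 0\<close> by simp
    next
      case False
      then have \<nu>: "\<nu> > 0" unfolding \<nu>_def coeff_norm_def gn
        using weighted_sq_nonneg[where w = w and M = M and f = f, OF wpos] by (simp add: less_le)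
      define c where "c = complex_of_real (1 / \<nu>)"
      have c: "(cmod c)\<^sup>2 = 1 / \<nu>\<^sup>2" using \<nu> by (simp add: c_def norm_divide power_divide)
      define h where "h j = c * g j" for j
      have h: "h \<in> coeff_space w"
        by (rule finite_support_in_coeff_space[where N = M, OF wpos]) (auto simp: h_def g_def)
      have "coeff_norm w h = 1"
      proof -
        have "(\<Sum>\<^sub>\<infinity>j\<in>{2..}. (cmod (h j))\<^sup>2 / w j) = (\<Sum>\<^sub>\<infinity>j\<in>{2..}. (cmod c)\<^sup>2 * ((cmod (g j))\<^sup>2 / w j))"
          by (simp add: h_def norm_mult power_mult_distrib)
        also have "\<dots> = (cmod c)\<^sup>2 * \<nu>\<^sup>2" by (simp only: infsum_cmult_right' gn \<nu>2)
        also have "\<dots> = 1" using \<nu> by (simp add: c)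
        finally show ?thesis by (simp add: coeff_norm_def)
      qed
      then have "coeff_norm w (dconv a h) \<le> N" using multiplier_norm_ge[OF bdd h] N(1) by simp
      moreover have "sqrt (weighted_sq w M (dconv a h)) \<le> coeff_norm w (dconv a h)"
        unfolding coeff_norm_def
        by (intro real_sqrt_le_mono weighted_sq_le_infsum[OF wpos] dconv_bounded_infsum(1)[OF wpos bdd h])
      ultimately have "sqrt (weighted_sq w M (dconv a h)) \<le> N" by linarith
      then have "weighted_sq w M (dconv a h) \<le> N\<^sup>2"
        by (rule sqrt_le_D)
      moreover have "dconv a h = (\<lambda>m. c * dconv a g m)" unfolding h_def by (rule dconv_cmult)
      ultimately have "1 / \<nu>\<^sup>2 * weighted_sq w M (dconv a f) \<le> N\<^sup>2"
        by (simp add: weighted_sq_cmult c fg)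
      then show ?thesis using \<nu> by (simp add: \<nu>2[symmetric] field_simps)
    qed
  qed
  with N(1) show ?thesis by (rule that)
qed

text \<open>
  Let \<open>d\<close> and \<open>e\<close> be the coefficients of \<open>\<phi> 2\<^sup>-\<^sup>s\<close> and \<open>\<phi> 3\<^sup>-\<^sup>s\<close>. The product \<open>\<phi> 6\<^sup>-\<^sup>s\<close> then has the
  coefficients \<open>d\<close> moved to multiples of 3 and also \<open>e\<close> moved to multiples of 2. By uniqueness
  \<open>d\<close> vanishes at odd indices, and so \<open>\<phi>\<close> itself is the Dirichlet series with
  \<open>a\<^sub>k = d\<^sub>2\<^sub>k\<close>.
\<close>

lemma multiplier_obtain_coefficients:
  assumes \<phi>: "\<phi> \<in> multipliers w"
  obtains a C where "\<phi> = Hw_function w a" "dconv_bounded w a C"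
proof -
  have ext: "\<phi> \<in> extensional (Hw_dom w)" using \<phi> by (simp add: multipliers_def)
  have ind: "dirichlet_sum (\<lambda>j. if j = n then 1 else 0) s = of_nat n powr (- s)" for n s
    by (subst dirichlet_sum_finite_support(2)[of "{n}"]) (auto simp: dirichlet_term_def)
  have "\<exists>d. d \<in> coeff_space w \<and> (\<forall>s. Re s > \<beta> \<longrightarrow> \<phi> s * of_nat n powr (- s) = dirichlet_sum d s)" if n: "n \<ge> 2" for n
  proof -
    let ?e = "\<lambda>j. if j = n then 1 else 0 :: complex"
    have "Hw_function w ?e \<in> Hw w" unfolding Hw_eq
      by (intro imageI indicator_in_coeff_space n)
    then have "pointwise_mult (Hw_dom w) \<phi> (Hw_function w ?e) \<in> Hw w"
      using \<phi> by (simp add: multipliers_def)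
    then obtain d where d: "d \<in> coeff_space w"
      "pointwise_mult (Hw_dom w) \<phi> (Hw_function w ?e) = Hw_function w d" unfolding Hw_eq by auto
    have "\<phi> s * of_nat n powr (- s) = dirichlet_sum d s" if "Re s > \<beta>" for s
      using fun_cong[OF d(2), of s] that by (simp add: pointwise_mult_def Hw_function_def dom ind)
    with d(1) show ?thesis by blast
  qed
  from this[of 2] this[of 3] obtain d e where d: "d \<in> coeff_space w"
      "\<And>s. Re s > \<beta> \<Longrightarrow> \<phi> s * 2 powr (- s) = dirichlet_sum d s"
    and e: "e \<in> coeff_space w" "\<And>s. Re s > \<beta> \<Longrightarrow> \<phi> s * 3 powr (- s) = dirichlet_sum e s"
    by auto
  have shift: "dirichlet_term (dconv (\<lambda>j. if j = n then 1 else 0) c) s summable_on UNIV"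
    "dirichlet_sum (dconv (\<lambda>j. if j = n then 1 else 0) c) s = of_nat n powr (- s) * dirichlet_sum c s"
    if "Re s > \<beta>" "c \<in> coeff_space w" for n s c
  proof -
    have "(dirichlet_term (\<lambda>j. if j = n then 1 else 0) s has_sum of_nat n powr (- s)) UNIV"
      using dirichlet_sum_finite_support[of "{n}" "\<lambda>j. if j = n then 1 else 0" s] by (simp add: ind)
    then have *: "(dirichlet_term (dconv (\<lambda>j. if j = n then 1 else 0) c) s has_sum of_nat n powr (- s) * dirichlet_sum c s) UNIV"
      using that by (intro has_sum_dirichlet_product has_sum_dirichlet_sum coeff_space_has_sum(2))
    then show "dirichlet_term (dconv (\<lambda>j. if j = n then 1 else 0) c) s summable_on UNIV"
      by (rule has_sum_imp_summable)
    show "dirichlet_sum (dconv (\<lambda>j. if j = n then 1 else 0) c) s = of_nat n powr (- s) * dirichlet_sum c s"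
      unfolding dirichlet_sum_def[of "dconv _ _"] using * by (rule infsumI)
  qed
  have conv: "dconv (\<lambda>j. if j = n then 1 else 0) c m = (if n dvd m then c (m div n) else 0)"
    if m: "m \<ge> 1" for n c m
  proof -
    have "dconv (\<lambda>j. if j = n then 1 else 0) c m = (\<Sum>k | k dvd m. if m div k = n then c k else 0)"
      unfolding dconv_def by (rule sum.cong) auto
    also have "\<dots> = (\<Sum>k | k dvd m. if n dvd m \<and> k = m div n then c (m div n) else 0)"
    proof (rule sum.cong)
      fix k assume "k \<in> {k. k dvd m}"
      then obtain l where l: "m = k * l" by auto
      then have pos: "k > 0" "l > 0" using m by (auto intro!: Nat.gr0I)
      have "m div k = l" using l pos by simp
      moreover have "n dvd m \<and> k = m div n" if "l = n"
        using l pos that by simp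
      moreover have "l = n" if "n dvd m" "k = m div n"
        using that l pos by (metis dvd_div_mult_self mult_left_cancel less_numeral_extra(3))
      ultimately have "m div k = n \<longleftrightarrow> n dvd m \<and> k = m div n"
        by blast
      then show "(if m div k = n then c k else 0) = (if n dvd m \<and> k = m div n then c (m div n) else 0)" by auto
    qed simp
    also have "\<dots> = (if n dvd m then c (m div n) else 0)"
    proof (cases "n dvd m")
      case True
      then have "m div n dvd m" by (metis dvd_div_mult_self dvd_triv_left)
      then show ?thesis using True m by simp
    qed simp
    finally show ?thesis .
  qed
  have odd0: "d j = 0" if "odd j" for j
  proof -
    have j: "j \<ge> 1" using that by (cases j) auto
    have "dconv (\<lambda>j. if j = 3 then 1 else 0) d (3 * j) = dconv (\<lambda>j. if j = 2 then 1 else 0) e (3 * j)"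
    proof (rule dirichlet_coefficients_unique[where x = "\<beta> + 1"])
      show "dirichlet_sum (dconv (\<lambda>j. if j = 3 then 1 else 0) d) (Complex (\<beta> + 1) t) =
          dirichlet_sum (dconv (\<lambda>j. if j = 2 then 1 else 0) e) (Complex (\<beta> + 1) t)" for t
        using d e by (simp add: shift flip: d(2) e(2))
    qed (use d e j in \<open>auto intro!: shift(1)\<close>)
    then show ?thesis using j that by (simp add: conv)
  qed
  define a where "a k = d (2 * k)" for k
  have dconv_a: "dconv a (\<lambda>j. if j = 2 then 1 else 0) = d"
  proof
    fix m show "dconv a (\<lambda>j. if j = 2 then 1 else 0) m = d m"
    proof (cases "m = 0")
      case True
      then show ?thesis using coeff_spaceD(1)[OF d(1)] by (simp add: dconv_def)
    next
      case False
      then show ?thesis using dconv_indicator[of m a 2] odd0[of m] by (auto simp: a_def)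
    qed
  qed
  have asum: "dirichlet_term a s summable_on UNIV" if "Re s > \<beta>" for s
    by (rule coefficients_summable_on_closed_set[OF wpos]) (use dconv_a d wsum[of "2 * Re s"] that in auto)
  have "\<phi> s = dirichlet_sum a s" if s: "Re s > \<beta>" for s
  proof -
    have e2: "(dirichlet_term (\<lambda>j. if j = 2 then 1 else 0) s has_sum 2 powr (- s)) UNIV"
      using dirichlet_sum_finite_support[of "{2}" "\<lambda>j. if j = 2 then 1 else 0" s] ind[of 2 s] by simp
    have "(dirichlet_term d s has_sum dirichlet_sum a s * 2 powr (- s)) UNIV"
      using has_sum_dirichlet_product[OF has_sum_dirichlet_sum[OF asum[OF s]] e2] by (simp add: dconv_a)
    then have "dirichlet_sum a s * 2 powr (- s) = \<phi> s * 2 powr (- s)"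
      unfolding d(2)[OF s] dirichlet_sum_def[of d] by (rule infsumI[symmetric])
    then show ?thesis by simp
  qed
  then have \<phi>a: "\<phi> = Hw_function w a"
    using ext by (auto simp: Hw_function_def dom restrict_def extensional_def)
  have "dconv a f \<in> coeff_space w" if f: "f \<in> coeff_space w" for f
  proof -
    have "pointwise_mult (Hw_dom w) \<phi> (Hw_function w f) \<in> Hw w"
      using \<phi> f by (auto simp: multipliers_def Hw_eq)
    then have "Hw_function w (dconv a f) \<in> Hw w"
      using Hw_function_mult(1)[OF asum coeff_space_has_sum(2)[OF f]] by (simp add: \<phi>a)
    then show ?thesis
      by (subst (asm) Hw_function_in_Hw_iff)
        (auto intro!: Hw_function_mult(2) asum coeff_space_has_sum(2)[OF f] simp: dconv_def)
  qed
  then obtain C where "dconv_bounded w a C" using dconv_maps_imp_bounded[of w a, OF wpos] by blast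
  with \<phi>a show ?thesis by (rule that)
qed

lemma coeff_space_add:
  assumes "f \<in> coeff_space w" "g \<in> coeff_space w"
  shows "(\<lambda>j. f j + g j) \<in> coeff_space w"
proof -
  have "(\<lambda>j. (cmod (f j + g j))\<^sup>2 / w j) summable_on {2..}"
  proof (rule summable_on_comparison_test)
    show "(\<lambda>j. 2 * ((cmod (f j))\<^sup>2 / w j) + 2 * ((cmod (g j))\<^sup>2 / w j)) summable_on {2..}"
      using assms by (intro summable_on_add summable_on_cmult_right coeff_spaceD(3))
    fix j :: nat assume j: "j \<in> {2..}"
    have "(cmod (f j + g j))\<^sup>2 \<le> (cmod (f j) + cmod (g j))\<^sup>2"
      by (intro power_mono norm_triangle_ineq) simp
    also have "\<dots> \<le> 2 * (cmod (f j))\<^sup>2 + 2 * (cmod (g j))\<^sup>2"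
      using sum_squares_bound[of "cmod (f j)" "cmod (g j)"] by (simp add: power2_sum)
    finally have "(cmod (f j + g j))\<^sup>2 / w j \<le> (2 * (cmod (f j))\<^sup>2 + 2 * (cmod (g j))\<^sup>2) / w j"
      using wpos[of j] j by (intro divide_right_mono) auto
    then show "(cmod (f j + g j))\<^sup>2 / w j \<le> 2 * ((cmod (f j))\<^sup>2 / w j) + 2 * ((cmod (g j))\<^sup>2 / w j)"
      by (simp add: add_divide_distrib)
  qed (use wpos in \<open>auto simp: less_imp_le\<close>)
  with assms show ?thesis by (simp add: coeff_space_def)
qed

lemma Hw_add:
  assumes "F \<in> Hw w" "G \<in> Hw w"
  shows "pointwise_add (Hw_dom w) F G \<in> Hw w"
proof -
  obtain f g where fg: "f \<in> coeff_space w" "g \<in> coeff_space w" "F = Hw_function w f" "G = Hw_function w g"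
    using assms by (auto simp: Hw_eq)
  have "dirichlet_sum (\<lambda>j. f j + g j) s = dirichlet_sum f s + dirichlet_sum g s" if "Re s > \<beta>" for s
  proof -
    have "dirichlet_term (\<lambda>j. f j + g j) s = (\<lambda>k. dirichlet_term f s k + dirichlet_term g s k)"
      by (rule ext) (simp add: dirichlet_term_def ring_distribs)
    then show ?thesis
      using infsum_add[OF coeff_space_has_sum(2)[OF fg(1) that] coeff_space_has_sum(2)[OF fg(2) that]]
      by (simp add: dirichlet_sum_def)
  qed
  then have "pointwise_add (Hw_dom w) F G = Hw_function w (\<lambda>j. f j + g j)"
    by (auto simp: pointwise_add_def Hw_function_def dom restrict_def fg)
  then show ?thesis using coeff_space_add[OF fg(1,2)] by (auto simp: Hw_eq)
qed

lemma Hw_scale: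
  assumes "F \<in> Hw w"
  shows "pointwise_scale (Hw_dom w) c F \<in> Hw w"
proof -
  obtain f where f: "f \<in> coeff_space w" "F = Hw_function w f"
    using assms by (auto simp: Hw_eq)
  have "(\<lambda>j. c * f j) \<in> coeff_space w"
    using f(1) summable_on_cmult_right[OF coeff_spaceD(3)[OF f(1)], of "(cmod c)\<^sup>2"]
    by (simp add: coeff_space_def norm_mult power_mult_distrib)
  moreover have "dirichlet_sum (\<lambda>j. c * f j) s = c * dirichlet_sum f s" for s
  proof -
    have "dirichlet_term (\<lambda>j. c * f j) s = (\<lambda>k. c * dirichlet_term f s k)"
      by (rule ext) (simp add: dirichlet_term_def)
    then show ?thesis by (simp add: dirichlet_sum_def infsum_cmult_right')
  qed
  then have "pointwise_scale (Hw_dom w) c F = Hw_function w (\<lambda>j. c * f j)"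
    by (auto simp: pointwise_scale_def Hw_function_def restrict_def f)
  ultimately show ?thesis by (auto simp: Hw_eq)
qed

lemma multipliers_add:
  assumes "\<phi> \<in> multipliers w" "\<psi> \<in> multipliers w"
  shows "pointwise_add (Hw_dom w) \<phi> \<psi> \<in> multipliers w"
proof -
  have "pointwise_mult (Hw_dom w) (pointwise_add (Hw_dom w) \<phi> \<psi>) f =
      pointwise_add (Hw_dom w) (pointwise_mult (Hw_dom w) \<phi> f) (pointwise_mult (Hw_dom w) \<psi> f)" for f
    by (auto simp: pointwise_mult_def pointwise_add_def ring_distribs restrict_def)
  then show ?thesis using assms by (auto simp: multipliers_def Hw_add) (simp add: pointwise_add_def)
qed

lemma multipliers_scale:
  assumes "\<phi> \<in> multipliers w"
  shows "pointwise_scale (Hw_dom w) c \<phi> \<in> multipliers w"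
proof -
  have "pointwise_mult (Hw_dom w) (pointwise_scale (Hw_dom w) c \<phi>) f =
      pointwise_scale (Hw_dom w) c (pointwise_mult (Hw_dom w) \<phi> f)" for f
    by (auto simp: pointwise_mult_def pointwise_scale_def restrict_def)
  then show ?thesis using assms by (auto simp: multipliers_def Hw_scale) (simp add: pointwise_scale_def)
qed

end

section \<open>Smooth numbers and the isomorphism\<close>

definition smooth_numbers :: "nat \<Rightarrow> nat set" where
  "smooth_numbers P = {k. k \<ge> 1 \<and> (\<forall>p. prime p \<longrightarrow> p dvd k \<longrightarrow> p \<le> P)}"

lemma smooth_numbers_mult_iff:
  assumes "j \<ge> 1" "k \<ge> 1"
  shows "j * k \<in> smooth_numbers P \<longleftrightarrow> j \<in> smooth_numbers P \<and> k \<in> smooth_numbers P"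
  using assms by (auto simp: smooth_numbers_def prime_dvd_mult_iff)

lemma smooth_numbers_gpf: "smooth_numbers P \<inter> {2..} = {j. 2 \<le> j \<and> gpf j \<le> P}"
proof -
  have "gpf j \<le> P \<longleftrightarrow> (\<forall>p. prime p \<longrightarrow> p dvd j \<longrightarrow> p \<le> P)" if j: "j \<ge> 2" for j
  proof -
    have "prime_factors j \<noteq> {}"
      using j prime_factor_nat[of j] by (auto simp: prime_factors_dvd)
    then have "gpf j \<le> P \<longleftrightarrow> (\<forall>p\<in>prime_factors j. p \<le> P)" by (simp add: gpf_def)
    then show ?thesis using j by (auto simp: prime_factors_dvd)
  qed
  then show ?thesis by (auto simp: smooth_numbers_def)
qed

lemma nth_prime_bounds: "nth_prime (Suc n) \<ge> 2" "nth_prime (Suc n) \<ge> n"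
proof -
  \<comment> \<open>The numbering of \<open>nth_prime\<close> starts at 1 and that of \<open>enumerate\<close> at 0.\<close>
  have inf: "infinite {p::nat. prime p}" by (rule primes_infinite)
  show "nth_prime (Suc n) \<ge> 2"
    using enumerate_in_set[OF inf, of n] by (simp add: nth_prime_def prime_ge_2_nat)
  show "nth_prime (Suc n) \<ge> n"
    using le_enumerate[OF inf, of n] by (simp add: nth_prime_def)
qed

lemma le_mem_smooth_numbers: "1 \<le> k \<Longrightarrow> k \<le> P \<Longrightarrow> k \<in> smooth_numbers P"
  by (auto simp: smooth_numbers_def dest: dvd_imp_le)

lemma delta_abs_le_sigma_abs: "delta_abs x \<le> sigma_abs x"
  unfolding delta_abs_def sigma_abs_def
  by (rule Inf_superset_mono) (auto intro: summable_on_subset)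

lemma summable_above_sigma_abs:
  assumes wpos: "\<And>j. j \<ge> 2 \<Longrightarrow> w j > 0" and x: "sigma_abs w < ereal x"
  shows "(\<lambda>j. w j * real j powr (- x)) summable_on {2..}"
proof -
  obtain s where "Re s < x" "(\<lambda>j. complex_of_real (w j) * of_nat j powr (- s)) summable_on {2..}"
    using x unfolding sigma_abs_def Inf_less_iff by auto
  then show ?thesis by (intro of_real_summable_imp_real_summable[of _ w s]) (auto simp: wpos)
qed

lemma summable_above_delta_abs:
  assumes wpos: "\<And>j. j \<ge> 2 \<Longrightarrow> w j > 0" and x: "delta_abs w < ereal x"
  shows "(\<lambda>j. w j * real j powr (- x)) summable_on (smooth_numbers (nth_prime (Suc n)) \<inter> {2..})"
proof -
  obtain s where s: "Re s < x" "\<forall>n\<ge>1. (\<lambda>j. complex_of_real (w j) * of_nat j powr (- s))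
      summable_on {j. 2 \<le> j \<and> gpf j \<le> nth_prime n}"
    using x unfolding delta_abs_def Inf_less_iff by auto
  then have "(\<lambda>j. complex_of_real (w j) * of_nat j powr (- s))
      summable_on (smooth_numbers (nth_prime (Suc n)) \<inter> {2..})"
    unfolding smooth_numbers_gpf by simp
  then show ?thesis using s by (intro of_real_summable_imp_real_summable[of _ w s]) (auto simp: wpos)
qed

theorem theorem1p3:
  fixes w :: "nat \<Rightarrow> real" and \<delta> :: real
  assumes "\<And>j. j \<ge> 2 \<Longrightarrow> w j > 0"
    and "sigma_abs w < \<infinity>"
    and "delta_abs w = ereal \<delta>"
    and "\<And>n::nat. n \<ge> 2 \<Longrightarrow>
      (\<Sum>j | j \<ge> 2 \<and> j dvd n. real j powr (- \<delta>) * w j * real_of_int (moebius_mu (n div j))) \<ge> 0"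
  shows "isometrically_isomorphic
    (Hw_dom w) (multipliers w) (multiplier_norm w)
    (half_plane (delta_abs w / 2))
    (H_infty (half_plane (delta_abs w / 2)) \<inter> dirichlet_functions)
    (sup_norm (half_plane (delta_abs w / 2)))"
proof -
  note wpos = assms(1)
  define \<alpha> where "\<alpha> = \<delta> / 2"
  have "ereal \<delta> \<le> sigma_abs w" using delta_abs_le_sigma_abs[of w] assms(3) by simp
  then obtain \<sigma> where \<sigma>: "sigma_abs w = ereal \<sigma>" using assms(2) by (cases "sigma_abs w") auto
  define \<beta> where "\<beta> = \<sigma> / 2"
  have \<alpha>\<beta>: "\<alpha> \<le> \<beta>" using \<open>ereal \<delta> \<le> sigma_abs w\<close> \<sigma> by (simp add: \<alpha>_def \<beta>_def)
  define Y where "Y = {s. Re s > \<alpha>}"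
  have Y: "half_plane (delta_abs w / 2) = Y"
    by (simp add: half_plane_def assms(3) Y_def \<alpha>_def)
  have dom: "Hw_dom w = {s. Re s > \<beta>}"
    by (simp add: Hw_dom_def half_plane_def \<sigma> \<beta>_def)
  have wsum: "(\<lambda>j. w j * real j powr (- x)) summable_on {2..}" if "x > 2 * \<beta>" for x
    using that by (intro summable_above_sigma_abs wpos) (auto simp: \<sigma> \<beta>_def)
  note weight = wpos dom wsum
  let ?R = "\<lambda>\<psi>. restrict \<psi> (Hw_dom w)"
  let ?B = "H_infty Y \<inter> dirichlet_functions"
  have B: "\<exists>a C. dconv_bounded w a C \<and> sup_norm Y \<psi> = ereal C \<and> ?R \<psi> = Hw_function w a"
    if mem: "\<psi> \<in> ?B" for \<psi>
  proof -
    have hol: "\<psi> holomorphic_on {s. Re s > \<alpha>}" and bdd: "bounded (\<psi> ` Y)"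
      using mem by (auto simp: H_infty_def Y_def)
    obtain a \<rho> where "\<And>s. s \<in> half_plane (ereal \<rho>) \<Longrightarrow>
        (\<lambda>j. a (Suc j) * of_nat (Suc j) powr (- s)) sums \<psi> s"
      using mem unfolding dirichlet_functions_def by blast
    then have conv: "dirichlet_term a s sums \<psi> s" if "Re s > \<rho>" for s
      using that unfolding dirichlet_sums_Suc_iff by (simp add: half_plane_def)
    define y where "y = max (\<rho> + 3) (\<alpha> + 1)"
    have abs: "dirichlet_term a s summable_on UNIV" "dirichlet_sum a s = \<psi> s" if "Re s \<ge> y" for s
      using dirichlet_sums_imp_absolute[of \<rho> a \<psi> s, OF conv] that by (auto simp: y_def)
    obtain D where D: "\<And>s. s \<in> Y \<Longrightarrow> norm (\<psi> s) \<le> D"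
      using bdd unfolding bounded_iff by blast
    have "sup_norm Y \<psi> \<le> ereal D" unfolding sup_norm_def by (rule SUP_least) (simp add: D)
    moreover have "ereal (norm (\<psi> (of_real (\<alpha> + 1)))) \<le> sup_norm Y \<psi>"
      unfolding sup_norm_def by (rule SUP_upper) (simp add: Y_def)
    ultimately obtain C where C: "sup_norm Y \<psi> = ereal C" by (cases "sup_norm Y \<psi>") auto
    have bd: "norm (\<psi> s) \<le> C" if "Re s > \<alpha>" for s
    proof -
      have "ereal (norm (\<psi> s)) \<le> sup_norm Y \<psi>"
        unfolding sup_norm_def by (rule SUP_upper) (use that in \<open>simp add: Y_def\<close>)
      then show ?thesis by (simp add: C)
    qed
    have bounded: "dconv_bounded w a C"
    proof (rule dconv_bounded_of_bounded[OF wpos assms(4), of \<psi> C y])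
      show "\<delta> / 2 < y" unfolding y_def \<alpha>_def by linarith
    qed (use hol bd abs in \<open>auto simp: \<alpha>_def\<close>)
    have "dirichlet_sum a s = \<psi> s" if "Re s > \<beta>" for s
    proof (rule half_plane_identity[of "dirichlet_sum a" \<beta> \<psi> y s])
      show "dirichlet_sum a holomorphic_on {s. \<beta> < Re s}"
        by (rule holomorphic_dirichlet_sum, rule bounded_coefficients_summable[OF weight bounded]) auto
      show "\<psi> holomorphic_on {s. \<beta> < Re s}"
        by (rule holomorphic_on_subset[OF hol]) (use \<alpha>\<beta> in auto)
    qed (use abs that in auto)
    then have "?R \<psi> = Hw_function w a" by (auto simp: Hw_function_def dom restrict_def)
    with bounded C show ?thesis by blast
  qed
  have A: "\<exists>\<psi>\<in>?B. ?R \<psi> = Hw_function w a \<and> sup_norm Y \<psi> \<le> ereal C" if bdd: "dconv_bounded w a C" for a C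
  proof -
    obtain \<psi> where \<psi>: "\<psi> holomorphic_on {s. Re s > \<alpha>}" "\<And>s. Re s > \<alpha> \<Longrightarrow> norm (\<psi> s) \<le> C"
      "\<And>s. Re s > \<beta> \<Longrightarrow> \<psi> s = dirichlet_sum a s"
    proof (rule bounded_extension[of w a C "\<lambda>n. smooth_numbers (nth_prime (Suc n))" \<alpha> \<beta>])
      show "0 < w j" if "2 \<le> j" for j using that by (rule wpos)
      show "2 \<in> smooth_numbers (nth_prime (Suc n))" for n
        by (rule le_mem_smooth_numbers) (simp_all add: nth_prime_bounds)
      show "k \<in> smooth_numbers (nth_prime (Suc n))" if "1 \<le> k" "k \<le> n" for k n
        by (rule le_mem_smooth_numbers) (use that nth_prime_bounds(2)[of n] in auto)
      show "(\<lambda>j. w j * real j powr - x) summable_on (smooth_numbers (nth_prime (Suc n)) \<inter> {2..})"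
        if "x > 2 * \<alpha>" for n x
        by (rule summable_above_delta_abs[OF wpos]) (use that assms(3) in \<open>auto simp: \<alpha>_def\<close>)
      show "j * k \<in> smooth_numbers (nth_prime (Suc n)) \<longleftrightarrow>
          j \<in> smooth_numbers (nth_prime (Suc n)) \<and> k \<in> smooth_numbers (nth_prime (Suc n))"
        if "1 \<le> j" "1 \<le> k" for n j k using that by (rule smooth_numbers_mult_iff)
    qed (use bdd wsum \<alpha>\<beta> in \<open>auto simp: smooth_numbers_def\<close>)
    let ?\<psi> = "restrict \<psi> Y"
    have "?\<psi> \<in> H_infty Y"
      using \<psi>(1,2) unfolding H_infty_def bounded_iff Y_def
      by (auto intro: holomorphic_transform[where f = \<psi>])
    moreover have "?\<psi> \<in> dirichlet_functions"
    proof -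
      have "dirichlet_term a s sums ?\<psi> s" if "Re s > \<beta>" for s
        using has_sum_imp_sums[OF has_sum_dirichlet_sum[OF bounded_coefficients_summable[OF weight bdd that]]]
          \<psi>(3)[OF that] \<alpha>\<beta> that by (simp add: Y_def)
      then show ?thesis
        unfolding dirichlet_functions_def dirichlet_sums_Suc_iff
        by (intro CollectI exI[of _ a] exI[of _ \<beta>] ballI) (simp add: half_plane_def)
    qed
    moreover have "?R ?\<psi> = Hw_function w a"
      using \<psi>(3) \<alpha>\<beta> by (auto simp: Hw_function_def dom Y_def restrict_def)
    moreover have "sup_norm Y ?\<psi> \<le> ereal C"
      unfolding sup_norm_def by (rule SUP_least) (use \<psi>(2) in \<open>auto simp: Y_def\<close>)
    ultimately show ?thesis by blast
  qed
  have unique: "\<psi> = \<psi>'" if "\<psi> \<in> ?B" "\<psi>' \<in> ?B" "?R \<psi> = ?R \<psi>'" for \<psi> \<psi>'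
  proof (rule extensionalityI)
    show "\<psi> \<in> extensional Y" "\<psi>' \<in> extensional Y" using that by (auto simp: H_infty_def)
    have "\<psi> s = \<psi>' s" if "Re s > \<beta>" for s
      using fun_cong[OF \<open>?R \<psi> = ?R \<psi>'\<close>, of s] that by (simp add: dom)
    then show "\<psi> s = \<psi>' s" if "s \<in> Y" for s
      using half_plane_identity[of \<psi> \<alpha> \<psi>' \<beta> s] that \<open>\<psi> \<in> ?B\<close> \<open>\<psi>' \<in> ?B\<close> by (auto simp: H_infty_def Y_def)
  qed
  show ?thesis
    unfolding Y
  proof (rule isometrically_isomorphic_by_restriction[OF \<alpha>\<beta> dom Y_def])
    show "\<psi> \<in> extensional Y" "\<psi> holomorphic_on Y" if "\<psi> \<in> ?B" for \<psi>
      using that by (auto simp: H_infty_def)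
    show "?R ` ?B = multipliers w"
    proof (intro equalityI subsetI)
      fix \<phi> assume "\<phi> \<in> ?R ` ?B"
      then obtain \<psi> where \<psi>: "\<psi> \<in> ?B" "\<phi> = ?R \<psi>" by (rule imageE)
      from B[OF \<psi>(1)] obtain a C where "dconv_bounded w a C" "?R \<psi> = Hw_function w a" by blast
      then show "\<phi> \<in> multipliers w"
        using multiplier_of_bounded(1)[OF weight, of a C] \<psi>(2) by simp
    next
      fix \<phi> assume "\<phi> \<in> multipliers w"
      then obtain a C where aC: "\<phi> = Hw_function w a" "dconv_bounded w a C"
        using multiplier_obtain_coefficients[OF weight] by blast
      from A[OF aC(2)] obtain \<psi> where "\<psi> \<in> ?B" "?R \<psi> = Hw_function w a" by blast
      then show "\<phi> \<in> ?R ` ?B" unfolding aC(1) by (metis imageI)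
    qed
    show "multiplier_norm w (?R \<psi>) = sup_norm Y \<psi>" if \<psi>: "\<psi> \<in> ?B" for \<psi>
    proof -
      obtain a C where aC: "dconv_bounded w a C" "sup_norm Y \<psi> = ereal C" "?R \<psi> = Hw_function w a"
        using B[OF \<psi>] by blast
      obtain N where N: "multiplier_norm w (Hw_function w a) = ereal N" "dconv_bounded w a N"
        using bounded_by_multiplier_norm[OF weight aC(1)] by blast
      obtain \<psi>' where \<psi>': "\<psi>' \<in> ?B" "?R \<psi>' = Hw_function w a" "sup_norm Y \<psi>' \<le> ereal N"
        using A[OF N(2)] by blast
      \<comment> \<open>Extending with the sharp bound \<open>N\<close> reproduces \<open>\<psi>\<close>, which gives the lower bound on the
        multiplier norm.\<close>
      have "\<psi>' = \<psi>" using unique[OF \<psi>'(1) \<psi>] \<psi>'(2) aC(3) by simp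
      then show ?thesis
        using multiplier_of_bounded(2)[OF weight aC(1)] \<psi>'(3) aC N(1) by (intro antisym) auto
    qed
    show "pointwise_add (Hw_dom w) f g \<in> multipliers w" if "f \<in> multipliers w" "g \<in> multipliers w" for f g
      by (rule multipliers_add[of w \<beta>, OF weight that])
    show "pointwise_scale (Hw_dom w) c f \<in> multipliers w" if "f \<in> multipliers w" for c f
      by (rule multipliers_scale[of w \<beta>, OF weight that])
    show "pointwise_mult (Hw_dom w) f g \<in> multipliers w" if "f \<in> multipliers w" "g \<in> multipliers w" for f g
      by (rule multipliers_mult[OF that])
  qed
qed

end
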